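(* Assume Conditions (C1)–(C4) below hold. Let $D_1,D_2>0$ be constants, let $$\lambda=C_x\sqrt{\frac Kn}+2C_x\sqrt{\frac{D_2K\log p}{n}},$$ and let $\hat{\bm\beta}$ be a minimizer of $L_\lambda$. There is a positive constant $C^*$ (not depending on $n,p,s$) such that, with $\delta^*=8C^*\sqrt{\frac{s+1}{n}}\left[4D_1\sqrt{\log p}+\sqrt{2K}\right]$, with probability at least $1-16p^{1-D_1}-2p^{1-D_2}$, $$\|\hat{\bm\beta}-\bm\beta^*\|_2\le\frac{3}{c_1\tilde b}\left[\max\left(\delta^*,\,K\sqrt{\frac{8\tilde B}{n}}\right)+c_2\lambda\sqrt s\right],$$ provided this upper bound is smaller than $\tilde d$.
   Context: Setting: $(y_i,\bm x_i)$, $i=1,\dots,n$, i.i.d., $y_i\in\mathbb{R}$, $\bm x_i=(1,x_{i1},\dots,x_{ip})^\top\in\mathbb{R}^{p+1}$ (index $j=0$ is the intercept), $p\ge2$. Quantile levels $0<\tau_1<\dots<\tau_K<1$; check loss $\rho_\tau(u)=u(\tau-I(u<0))$. Model: for each $k$, $y_i=\bm x_i^\top\bm\beta_k^*+\epsilon_i^k$ with $P(\epsilon_i^k<0\mid\bm x_i)=\tau_k$. Stacked vectors $\bm\beta=(\bm\beta_1^\top,\dots,\bm\beta_K^\top)^\top\in\mathbb{R}^{K(p+1)}$; for $j\in\{0,\dots,p\}$, $\bm\beta^j=(\beta_{1j},\dots,\beta_{Kj})^\top$; for $\bm\Delta\in\mathbb{R}^{K(p+1)}$, $\bm\Delta_k\in\mathbb{R}^{p+1}$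 is its $k$-th quantile block and $\bm\Delta^j\in\mathbb{R}^K$ its $j$-th predictor group. Estimator: $\hat{\bm\beta}$ minimizes $L_\lambda(\bm\beta)=\frac1n\sum_{k=1}^K\sum_{i=1}^n\rho_{\tau_k}(y_i-\bm x_i^\top\bm\beta_k)+\lambda\sum_{j=1}^p\|\bm\beta^j\|_2$. Active set $\mathcal S=\{j\in\{1,\dots,p\}:\|\bm\beta^{*j}\|_2\ne0\}$, $s=|\mathcal S|$, $\bar{\mathcal S}=\mathcal S\cup\{0\}$. Cone $\mathcal C=\{\bm\Delta:\sum_{j\in\bar{\mathcal S}^c}\|\bm\Delta^j\|_2\le3\sum_{j\in\bar{\mathcal S}}\|\bm\Delta^j\|_2\}$. Conditions: (C1) Let $f_i,f_i'$ be the conditional density of $y_i$ given $\bm x_i$ and its derivative; there are constants $c_1,c_2>0$ with $f_i(\bm x_i^\top\bm\beta_k^* )\ge c_1$ for all $i,k$ and $\sup_t|f_i'(t)|\le c_2$ for all $i$. (C2) There is $C_x>0$ with $\max_{i,j}|x_{ij}|<C_x$. (C3) There are positive constants $\tilde b\le b_k$ and $B_k\le\tilde B$ ($k=1,\dots,K$) such that for every $\bm\Delta\in\mathcal C$ and every $k$, $b_k\|\bm\Delta_k\|_2^2\le\bm\Delta_k^\top E[\bm x_i\bm x_i^\top]\bm\Delta_k\le B_k\|\bm\Delta_k\|_2^2$. (C4) There is $\tilde d>0$ such that for every $k$, $d_k:=\frac{c_1}{c_2\sqrt{B_k}}\inf_{\bm\Delta\in\mathcal C,\ \bm\Delta_k\ne0}\frac{E[(\bm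 x_i^\top\bm\Delta_k)^2]^{3/2}}{E[|\bm x_i^\top\bm\Delta_k|^3]}\ge\tilde d$. *)

theory Defs
  imports "HOL-Probability.Probability"
begin

text \<open>Conventions. Quantile levels are indexed by k in {1..K}, predictors by j in {0..p}
 (j = 0 is the intercept). A stacked coefficient vector beta in R^(K(p+1)) is a function
 beta :: nat => nat => real, beta k j = beta_{kj}; only the values for k in {1..K},
 j in {0..p} matter. An observation is a pair (y, x) :: real * (nat => real), with
 x j = x_{ij} for j in {0..p}. A sample of size n is omega :: nat => real * (nat => real),
 observations indexed by i in {1..n}.\<close>

definition check_loss :: "real \<Rightarrow> real \<Rightarrow> real" where
  "check_loss \<tau> u = u * (\<tau> - (if u < 0 then 1 else 0))"

definition xdot :: "nat \<Rightarrow> (nat \<Rightarrow> real) \<Rightarrow> (nat \<Rightarrow> real) \<Rightarrow> real" where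
  "xdot p x v = (\<Sum>j\<in>{0..p}. x j * v j)"

definition grp_norm :: "nat \<Rightarrow> (nat \<Rightarrow> nat \<Rightarrow> real) \<Rightarrow> nat \<Rightarrow> real" where
  "grp_norm K \<beta> j = sqrt (\<Sum>k\<in>{1..K}. (\<beta> k j)^2)"

definition blk_norm :: "nat \<Rightarrow> (nat \<Rightarrow> nat \<Rightarrow> real) \<Rightarrow> nat \<Rightarrow> real" where
  "blk_norm p \<beta> k = sqrt (\<Sum>j\<in>{0..p}. (\<beta> k j)^2)"

definition full_norm :: "nat \<Rightarrow> nat \<Rightarrow> (nat \<Rightarrow> nat \<Rightarrow> real) \<Rightarrow> real" where
  "full_norm K p \<beta> = sqrt (\<Sum>k\<in>{1..K}. \<Sum>j\<in>{0..p}. (\<beta> k j)^2)"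

definition active_set :: "nat \<Rightarrow> nat \<Rightarrow> (nat \<Rightarrow> nat \<Rightarrow> real) \<Rightarrow> nat set" where
  "active_set K p \<beta> = {j\<in>{1..p}. grp_norm K \<beta> j \<noteq> 0}"

definition cone :: "nat \<Rightarrow> nat \<Rightarrow> nat set \<Rightarrow> (nat \<Rightarrow> nat \<Rightarrow> real) set" where
  "cone K p S = {\<Delta>. (\<Sum>j\<in>{0..p} - (S \<union> {0}). grp_norm K \<Delta> j)
                     \<le> 3 * (\<Sum>j\<in>S \<union> {0}. grp_norm K \<Delta> j)}"

definition qr_loss :: "nat \<Rightarrow> nat \<Rightarrow> nat \<Rightarrow> (nat \<Rightarrow> real) \<Rightarrow> real
     \<Rightarrow> (nat \<Rightarrow> real \<times> (nat \<Rightarrow> real)) \<Rightarrow> (nat \<Rightarrow> nat \<Rightarrow> real) \<Rightarrow> real" where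
  "qr_loss K p n \<tau> lam \<omega> \<beta> =
     (1 / real n) * (\<Sum>k\<in>{1..K}. \<Sum>i\<in>{1..n}.
         check_loss (\<tau> k) (fst (\<omega> i) - xdot p (snd (\<omega> i)) (\<beta> k)))
     + lam * (\<Sum>j\<in>{1..p}. grp_norm K \<beta> j)"

definition obs_space :: "(real \<times> (nat \<Rightarrow> real)) measure" where
  "obs_space = borel \<Otimes>\<^sub>M (\<Pi>\<^sub>M j\<in>(UNIV::nat set). (borel :: real measure))"

text \<open>Model assumptions on the common law P of (y_i, x_i):
  f x is the conditional density of y given x = x (f' its derivative);
  for each k, P(y - x^T beta*_k < 0 | x) = tau_k; intercept x_0 = 1;
  condition (C1) and condition (C2).\<close>
definition qr_model :: "nat \<Rightarrow> (nat \<Rightarrow> real) \<Rightarrow> nat \<Rightarrow> (real \<times> (nat \<Rightarrow> real)) measure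
     \<Rightarrow> ((nat \<Rightarrow> real) \<Rightarrow> real \<Rightarrow> real) \<Rightarrow> ((nat \<Rightarrow> real) \<Rightarrow> real \<Rightarrow> real)
     \<Rightarrow> (nat \<Rightarrow> nat \<Rightarrow> real) \<Rightarrow> real \<Rightarrow> real \<Rightarrow> real \<Rightarrow> bool" where
  "qr_model K \<tau> p P f f' \<beta>s c1 c2 Cx \<longleftrightarrow>
     prob_space P \<and> sets P = sets obs_space \<and>
     (\<forall>x s. 0 \<le> f x s) \<and>
     (\<forall>C\<in>sets (\<Pi>\<^sub>M j\<in>(UNIV::nat set). (borel :: real measure)). \<forall>t.
        emeasure P {z\<in>space P. fst z \<le> t \<and> snd z \<in> C}
        = (\<integral>\<^sup>+ z. indicator C (snd z) *
              (\<integral>\<^sup>+ s. indicator {..t} s * ennreal (f (snd z) s) \<partial>lborel) \<partial>P)) \<and>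
     (\<forall>k\<in>{1..K}. \<forall>C\<in>sets (\<Pi>\<^sub>M j\<in>(UNIV::nat set). (borel :: real measure)).
        measure P {z\<in>space P. fst z - xdot p (snd z) (\<beta>s k) < 0 \<and> snd z \<in> C}
        = \<tau> k * measure P {z\<in>space P. snd z \<in> C}) \<and>
     (AE z in P. snd z 0 = 1) \<and>
     (AE z in P. \<forall>k\<in>{1..K}. c1 \<le> f (snd z) (xdot p (snd z) (\<beta>s k))) \<and>
     (AE z in P. \<forall>t. (f (snd z) has_real_derivative f' (snd z) t) (at t)
                      \<and> \<bar>f' (snd z) t\<bar> \<le> c2) \<and>
     (AE z in P. \<forall>j\<in>{0..p}. \<bar>snd z j\<bar> < Cx)"

definition cond_C3 :: "nat \<Rightarrow> nat \<Rightarrow> (real \<times> (nat \<Rightarrow> real)) measure \<Rightarrow> nat set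
     \<Rightarrow> (nat \<Rightarrow> real) \<Rightarrow> (nat \<Rightarrow> real) \<Rightarrow> real \<Rightarrow> real \<Rightarrow> bool" where
  "cond_C3 K p P S b B bt Bt \<longleftrightarrow>
     (\<forall>k\<in>{1..K}. 0 < bt \<and> bt \<le> b k \<and> 0 < B k \<and> B k \<le> Bt) \<and>
     (\<forall>\<Delta>\<in>cone K p S. \<forall>k\<in>{1..K}.
        b k * (blk_norm p \<Delta> k)^2 \<le> (\<integral>z. (xdot p (snd z) (\<Delta> k))^2 \<partial>P) \<and>
        (\<integral>z. (xdot p (snd z) (\<Delta> k))^2 \<partial>P) \<le> B k * (blk_norm p \<Delta> k)^2)"

definition d_const :: "nat \<Rightarrow> nat \<Rightarrow> (real \<times> (nat \<Rightarrow> real)) measure \<Rightarrow> nat set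
     \<Rightarrow> real \<Rightarrow> real \<Rightarrow> (nat \<Rightarrow> real) \<Rightarrow> nat \<Rightarrow> real" where
  "d_const K p P S c1 c2 B k =
     c1 / (c2 * sqrt (B k)) *
     (INF \<Delta>\<in>{\<Delta>\<in>cone K p S. \<exists>j\<in>{0..p}. \<Delta> k j \<noteq> 0}.
        (\<integral>z. (xdot p (snd z) (\<Delta> k))^2 \<partial>P) powr (3/2)
        / (\<integral>z. \<bar>xdot p (snd z) (\<Delta> k)\<bar>^3 \<partial>P))"

end

theory Submission
  imports Defs
begin

text \<open>The argument is the usual one for M-estimators with a decomposable penalty. If the score of every
  group has norm at most \<open>\<lambda>/2\<close>, the error lies in the cone. On the cone, Knight's identity and the
  lower bound on the conditional density near the quantile make the expected excess loss at
  least \<open>c\<^sub>1 b/3\<close> times the squared norm of the error, as long as this norm is below \<open>d\<close>. By convexity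
  one may shrink the error to the claimed bound, where the l1 norm is controlled by the cone condition,
  and a uniform deviation inequality over an l1 ball gives a contradiction.

  The score is bounded by a Bennett-type inequality for the Doob martingale of the norm of a sum. The
  deviation inequality is obtained directly for exponential moments, by symmetrizing and contracting
  one observation at a time.\<close>

text \<open>Sharp constants matter in one place only. The penalty level \<open>lam\<close> is
  prescribed, so the score of a group must exceed exactly \<open>n * lam / 2\<close> with
  probability at most \<open>p powr (- D2)\<close>; this exploits that a centered indicator has
  variance at most 1/4. The constant \<open>Cs\<close> is free, so the deviation inequality may lose
  constant factors in symmetrization and contraction. The bound to be proved contains
  \<open>c2 * lam * sqrt s\<close>, whereas the penalty enters the argument as
  \<open>lam * sqrt s\<close>, and \<open>c2\<close> may be small. Since \<open>lam * sqrt s\<close>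
  is at most a constant times \<open>sqrt ((s + 1) / n) * (sqrt (ln p) + 1)\<close>, the maximum's
  first term can pay for it once \<open>Cs\<close> is large; hence \<open>Cs\<close> depends on
  \<open>D2\<close> as well as on \<open>D1\<close>, \<open>K\<close> and \<open>Cx\<close>. Suprema
  over coefficient vectors run over rational points to stay measurable. The exceptional events do
  not mention the estimator, so a measurable choice of minimizers is never at issue.\<close>

section \<open>Norms of sums of bounded random vectors\<close>

text \<open>The constant comes from \<open>exp (8/5) \<le> 5\<close>, since \<open>(exp x - 1 - x) / x\<^sup>2\<close> is increasing.\<close>
lemma exp_le_quadratic:
  fixes x :: real
  assumes "x \<le> 8/5"
  shows "exp x \<le> 1 + x + 15/16 * x\<^sup>2"
proof -
  \<comment> \<open>The claim is \<open>g x \<ge> 1\<close>. The derivative vanishes only at 0 and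
    14/15, and \<open>g\<close> falls, rises, then falls again, so it suffices to check 0 and the
    right end 8/5, where the quadratic equals 5.\<close>
  define g where "g = (\<lambda>x::real. (1 + x + 15/16 * x\<^sup>2) * exp (- x))"
  have dg: "(g has_real_derivative exp (- t) * (t * (7/8 - 15/16 * t))) (at t)" for t
    unfolding g_def
    by (auto intro!: derivative_eq_intros simp: field_simps power2_eq_square)
  have g0: "g 0 = 1" by (simp add: g_def)
  have "exp (8/5::real) \<le> 5"
  proof -
    have "exp (8/5::real) ^ 5 = exp 1 ^ 8"
      by (simp flip: exp_of_nat_mult)
    also have "\<dots> \<le> (272/100) ^ 8"
      using e_less_272 by (intro power_mono) auto
    also have "\<dots> \<le> (5::real) ^ 5" by (simp add: power_divide)
    finally show ?thesis by (rule power_le_imp_le_base[of _ 4, simplified]) simp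
  qed
  then have g1: "g (8/5) \<ge> 1"
    by (simp add: g_def exp_minus field_simps power2_eq_square)
  have "g x \<ge> 1"
  proof (cases "x \<le> 0")
    case True
    have "g 0 \<le> g x"
    proof (rule DERIV_nonpos_imp_nonincreasing[OF True])
      fix t :: real assume "x \<le> t" "t \<le> 0"
      then have "exp (- t) * (t * (7/8 - 15/16 * t)) \<le> 0"
        by (intro mult_nonneg_nonpos mult_nonpos_nonneg) auto
      with dg show "\<exists>y. (g has_real_derivative y) (at t) \<and> y \<le> 0" by blast
    qed
    then show ?thesis using g0 by simp
  next
    case False
    show ?thesis
    proof (cases "x \<le> 14/15")
      case True
      have "g 0 \<le> g x"
      proof (rule DERIV_nonneg_imp_nondecreasing[where f = g and a = 0 and b = x])
        fix t :: real assume "0 \<le> t" "t \<le> x"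
        then have "exp (- t) * (t * (7/8 - 15/16 * t)) \<ge> 0"
          using True by (intro mult_nonneg_nonneg) auto
        with dg show "\<exists>y. (g has_real_derivative y) (at t) \<and> y \<ge> 0" by blast
      qed (use False in simp)
      then show ?thesis using g0 by simp
    next
      case F2: False
      have "g (8/5) \<le> g x"
      proof (rule DERIV_nonpos_imp_nonincreasing[OF assms])
        fix t :: real assume "x \<le> t" "t \<le> 8/5"
        then have "exp (- t) * (t * (7/8 - 15/16 * t)) \<le> 0"
          using F2 by (intro mult_nonneg_nonpos) auto
        with dg show "\<exists>y. (g has_real_derivative y) (at t) \<and> y \<le> 0" by blast
      qed
      then show ?thesis using g1 by simp
    qed
  qed
  then show ?thesis by (simp add: g_def exp_minus field_simps)
qed

locale bounded_random_vector = prob_space P for P :: "'a measure" +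
  fixes X :: "'a \<Rightarrow> 'k \<Rightarrow> real" and F :: "'k set" and M V :: real
  assumes finite_F [simp]: "finite F"
    and X_measurable [measurable]: "\<And>k. k \<in> F \<Longrightarrow> (\<lambda>z. X z k) \<in> borel_measurable P"
    and X_bound: "\<And>z. z \<in> space P \<Longrightarrow> L2_set (X z) F \<le> M"
    and X_mean: "\<And>k. k \<in> F \<Longrightarrow> (\<integral>z. X z k \<partial>P) = 0"
    and X_var: "(\<integral>z. (L2_set (X z) F)\<^sup>2 \<partial>P) \<le> V"
begin

lemma M_nonneg: "0 \<le> M"
proof -
  obtain z where "z \<in> space P" using not_empty by blast
  from X_bound[OF this] show ?thesis using L2_set_nonneg[of "X z" F] by linarith
qed

lemma X_abs_bound: "z \<in> space P \<Longrightarrow> k \<in> F \<Longrightarrow> \<bar>X z k\<bar> \<le> M"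
  using member_le_L2_set[of F k "\<lambda>k. \<bar>X z k\<bar>"] X_bound[of z] by (simp add: L2_set_def)

lemma X_integrable [simp]: "k \<in> F \<Longrightarrow> integrable P (\<lambda>z. X z k)"
  using X_abs_bound by (intro integrable_const_bound[where B = M] AE_I2) auto

lemma X_sq_integrable [simp]: "k \<in> F \<Longrightarrow> integrable P (\<lambda>z. (X z k)\<^sup>2)"
  using X_abs_bound
  by (intro integrable_const_bound[where B = "M\<^sup>2"] AE_I2) (auto intro: power2_le_iff_abs_le[THEN iffD2] simp: M_nonneg abs_le_square_iff)

lemma V_nonneg: "0 \<le> V"
  by (rule order_trans[OF _ X_var]) (simp add: integral_nonneg_AE)

abbreviation sample_space :: "'i set \<Rightarrow> ('i \<Rightarrow> 'a) measure" where
  "sample_space I \<equiv> \<Pi>\<^sub>M i\<in>I. P"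

definition shifted_norm :: "'i set \<Rightarrow> ('k \<Rightarrow> real) \<Rightarrow> ('i \<Rightarrow> 'a) \<Rightarrow> real" where
  "shifted_norm I v x = L2_set (\<lambda>k. v k + (\<Sum>i\<in>I. X (x i) k)) F"

text \<open>\<open>mean_norm\<close> is the Doob martingale of the norm of the sum: \<open>v\<close> is the part already revealed and
  \<open>I\<close> indexes the remaining summands.\<close>
definition mean_norm :: "'i set \<Rightarrow> ('k \<Rightarrow> real) \<Rightarrow> real" where
  "mean_norm I v = (\<integral>x. shifted_norm I v x \<partial>sample_space I)"

sublocale PS: product_prob_space "\<lambda>_. P" I for I :: "'i set"
  by unfold_locales

lemma norm_shift_le: "L2_set (\<lambda>k. v k + w k) F \<le> L2_set v F + L2_set w F"
  by (rule L2_set_triangle_ineq)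

lemma shifted_norm_measurable [measurable]:
  "shifted_norm I v \<in> borel_measurable (sample_space I)"
  unfolding shifted_norm_def L2_set_def by measurable

lemma shifted_norm_nonneg [simp]: "0 \<le> shifted_norm I v x"
  by (simp add: shifted_norm_def)

lemma shifted_norm_empty [simp]: "shifted_norm {} v x = L2_set v F"
  by (simp add: shifted_norm_def)

lemma shifted_norm_insert:
  assumes "finite I" "i \<notin> I"
  shows "shifted_norm (insert i I) v (x(i := y)) = shifted_norm I (\<lambda>k. v k + X y k) x"
proof -
  have "(\<Sum>j\<in>I. X ((x(i := y)) j) k) = (\<Sum>j\<in>I. X (x j) k)" for k
    using assms by (intro sum.cong) auto
  then show ?thesis using assms by (simp add: shifted_norm_def add.assoc)
qed

lemma norm_sum_le:
  assumes "finite I" "x \<in> space (sample_space I)"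
  shows "L2_set (\<lambda>k. \<Sum>i\<in>I. X (x i) k) F \<le> card I * M"
  using assms
proof (induction I arbitrary: x rule: finite_induct)
  case empty
  then show ?case by (simp add: L2_set_def)
next
  case (insert i I)
  have "x i \<in> space P" "restrict x I \<in> space (sample_space I)"
    using insert.prems by (auto simp: space_PiM PiE_def)
  from insert.IH[OF this(2)] X_bound[OF this(1)]
  have "L2_set (X (x i)) F + L2_set (\<lambda>k. \<Sum>i\<in>I. X (x i) k) F \<le> (card I + 1) * M"
    by (simp add: algebra_simps)
  then show ?case
    using insert.hyps norm_shift_le[of "X (x i)" "\<lambda>k. \<Sum>i\<in>I. X (x i) k"]
    by (simp add: add.commute)
qed

lemma shifted_norm_le:
  assumes "finite I" "x \<in> space (sample_space I)"
  shows "shifted_norm I v x \<le> L2_set v F + card I * M"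
  using norm_sum_le[OF assms] norm_shift_le[of v "\<lambda>k. \<Sum>i\<in>I. X (x i) k"]
  by (simp add: shifted_norm_def)

lemma shifted_norm_integrable:
  assumes "finite I"
  shows "integrable (sample_space I) (shifted_norm I v)"
proof -
  show ?thesis
    using shifted_norm_le[OF assms, of _ v]
    by (intro PS.integrable_const_bound[where B = "L2_set v F + card I * M"] AE_I2) auto
qed

lemma mean_norm_nonneg: "0 \<le> mean_norm I v"
  unfolding mean_norm_def by (intro integral_nonneg_AE) simp

text \<open>The triangle inequality holds under the integral. Revealing one observation thus moves
  the martingale by at most the norm of that observation, which controls both range and variance of
  the increment.\<close>

lemma mean_norm_lipschitz:
  assumes "finite I"
  shows "\<bar>mean_norm I (\<lambda>k. v k + w k) - mean_norm I v\<bar> \<le> L2_set w F"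
proof -
  note [simp] = shifted_norm_integrable[OF assms]
  have 1: "shifted_norm I (\<lambda>k. v k + w k) x \<le> shifted_norm I v x + L2_set w F" for x
    using norm_shift_le[of "\<lambda>k. v k + (\<Sum>i\<in>I. X (x i) k)" w]
    by (simp add: shifted_norm_def algebra_simps)
  have 2: "shifted_norm I v x \<le> shifted_norm I (\<lambda>k. v k + w k) x + L2_set w F" for x
    using norm_shift_le[of "\<lambda>k. v k + w k + (\<Sum>i\<in>I. X (x i) k)" "\<lambda>k. - w k"]
    by (simp add: shifted_norm_def algebra_simps L2_set_def)
  have "mean_norm I (\<lambda>k. v k + w k) \<le> (\<integral>x. shifted_norm I v x + L2_set w F \<partial>sample_space I)"
    unfolding mean_norm_def using 1 by (intro integral_mono) auto
  moreover have "mean_norm I v \<le> (\<integral>x. shifted_norm I (\<lambda>k. v k + w k) x + L2_set w F \<partial>sample_space I)"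
    unfolding mean_norm_def using 2 by (intro integral_mono) auto
  ultimately show ?thesis
    by (simp add: mean_norm_def PS.P.prob_space)
qed

lemma mean_norm_measurable [measurable]:
  assumes "finite I"
  shows "(\<lambda>z. mean_norm I (\<lambda>k. v k + X z k)) \<in> borel_measurable P"
proof -
  show ?thesis unfolding mean_norm_def shifted_norm_def L2_set_def by measurable
qed

lemma mean_norm_insert:
  assumes "finite I" "i \<notin> I"
  shows "integrable P (\<lambda>z. mean_norm I (\<lambda>k. v k + X z k))"
    and "mean_norm (insert i I) v = (\<integral>z. mean_norm I (\<lambda>k. v k + X z k) \<partial>P)"
proof -
  note [measurable] = mean_norm_measurable[OF assms(1)]
  have "\<bar>mean_norm I (\<lambda>k. v k + X z k)\<bar> \<le> mean_norm I v + M" if "z \<in> space P" for z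
    using mean_norm_lipschitz[OF assms(1), of v "X z"] X_bound[OF that] mean_norm_nonneg
      [of I "\<lambda>k. v k + X z k"] by linarith
  then show int: "integrable P (\<lambda>z. mean_norm I (\<lambda>k. v k + X z k))"
    by (intro integrable_const_bound[where B = "mean_norm I v + M"] AE_I2) auto
  have "ennreal (mean_norm (insert i I) v) = (\<integral>\<^sup>+x. shifted_norm (insert i I) v x \<partial>sample_space (insert i I))"
    unfolding mean_norm_def using assms
    by (intro nn_integral_eq_integral[symmetric] shifted_norm_integrable) auto
  also have "\<dots> = (\<integral>\<^sup>+y. \<integral>\<^sup>+x. shifted_norm I (\<lambda>k. v k + X y k) x \<partial>sample_space I \<partial>P)"
    using assms by (subst PS.product_nn_integral_insert_rev) (auto simp: shifted_norm_insert simp del: fun_upd_apply)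
  also have "\<dots> = (\<integral>\<^sup>+y. mean_norm I (\<lambda>k. v k + X y k) \<partial>P)"
    unfolding mean_norm_def using assms
    by (intro nn_integral_cong nn_integral_eq_integral shifted_norm_integrable) auto
  also have "\<dots> = ennreal (\<integral>y. mean_norm I (\<lambda>k. v k + X y k) \<partial>P)"
    by (intro nn_integral_eq_integral int) (simp add: mean_norm_nonneg)
  finally show "mean_norm (insert i I) v = (\<integral>z. mean_norm I (\<lambda>k. v k + X z k) \<partial>P)"
    by (subst (asm) ennreal_inj) (auto intro!: mean_norm_nonneg integral_nonneg_AE)
qed

text \<open>Jensen's inequality for the norm of a centered perturbation. Pairing
  \<open>w + X\<close> with \<open>w\<close> has mean the squared norm of \<open>w\<close>, and
  Cauchy-Schwarz bounds the pairing pointwise.\<close>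

lemma mean_shift_norm_ge: "L2_set w F \<le> (\<integral>z. L2_set (\<lambda>k. w k + X z k) F \<partial>P)"
proof -
  have int: "integrable P (\<lambda>z. L2_set (\<lambda>k. w k + X z k) F)"
  proof (intro integrable_const_bound[where B = "L2_set w F + M"] AE_I2)
    show "(\<lambda>z. L2_set (\<lambda>k. w k + X z k) F) \<in> borel_measurable P"
      unfolding L2_set_def by measurable
    show "norm (L2_set (\<lambda>k. w k + X z k) F) \<le> L2_set w F + M" if "z \<in> space P" for z
      using norm_shift_le[of w "X z"] X_bound[OF that] by simp
  qed
  have "(L2_set w F)\<^sup>2 = (\<Sum>k\<in>F. w k * w k)"
    by (simp add: L2_set_def sum_nonneg power2_eq_square)
  also have "\<dots> = (\<integral>z. (\<Sum>k\<in>F. w k * (w k + X z k)) \<partial>P)"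
    by (simp add: distrib_left X_mean prob_space)
  also have "\<dots> \<le> (\<integral>z. L2_set w F * L2_set (\<lambda>k. w k + X z k) F \<partial>P)"
  proof (intro integral_mono)
    show "(\<Sum>k\<in>F. w k * (w k + X z k)) \<le> L2_set w F * L2_set (\<lambda>k. w k + X z k) F" for z
      by (rule order_trans[OF sum_mono L2_set_mult_ineq]) (simp flip: abs_mult)
  qed (auto intro!: integrable_mult_right int simp: distrib_left)
  finally have "L2_set w F * L2_set w F \<le> L2_set w F * (\<integral>z. L2_set (\<lambda>k. w k + X z k) F \<partial>P)"
    by (simp add: power2_eq_square)
  then show ?thesis
    by (cases "L2_set w F = 0") (auto simp: less_le integral_nonneg_AE)
qed

text \<open>Jensen's inequality is applied to the new summand with the others fixed. In
  \<open>norm_mgf_step\<close> it bounds the upward increment by \<open>M\<close>, where Lipschitz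
  continuity alone would give \<open>2 * M\<close>.\<close>

lemma mean_norm_insert_ge:
  assumes "finite I"  "i \<notin> I"
  shows "mean_norm I v \<le> mean_norm (insert i I) v"
proof -
  note [measurable] = shifted_norm_measurable
  have "ennreal (mean_norm I v) = (\<integral>\<^sup>+x. shifted_norm I v x \<partial>sample_space I)"
    unfolding mean_norm_def using assms
    by (intro nn_integral_eq_integral[symmetric] shifted_norm_integrable) auto
  also have "\<dots> \<le> (\<integral>\<^sup>+x. \<integral>\<^sup>+y. shifted_norm (insert i I) v (x(i := y)) \<partial>P \<partial>sample_space I)"
  proof (intro nn_integral_mono)
    fix x :: "'b \<Rightarrow> 'a"
    let ?w = "\<lambda>k. v k + (\<Sum>i\<in>I. X (x i) k)"
    have "shifted_norm (insert i I) v (x(i := y)) = L2_set (\<lambda>k. ?w k + X y k) F" for y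
      using assms by (simp add: shifted_norm_insert) (simp add: shifted_norm_def algebra_simps)
    moreover have "ennreal (L2_set ?w F) \<le> (\<integral>\<^sup>+y. L2_set (\<lambda>k. ?w k + X y k) F \<partial>P)"
    proof (rule order_trans[OF ennreal_leI[OF mean_shift_norm_ge]])
      show "ennreal (\<integral>z. L2_set (\<lambda>k. ?w k + X z k) F \<partial>P) \<le> (\<integral>\<^sup>+y. L2_set (\<lambda>k. ?w k + X y k) F \<partial>P)"
      proof (subst integral_eq_nn_integral)
        show "(\<lambda>z. L2_set (\<lambda>k. ?w k + X z k) F) \<in> borel_measurable P"
          unfolding L2_set_def by measurable
      qed (auto simp: ennreal_enn2real_if)
    qed
    ultimately show "ennreal (shifted_norm I v x) \<le> (\<integral>\<^sup>+y. shifted_norm (insert i I) v (x(i := y)) \<partial>P)"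
      by (simp add: shifted_norm_def del: fun_upd_apply)
  qed
  also have "\<dots> = (\<integral>\<^sup>+x. shifted_norm (insert i I) v x \<partial>sample_space (insert i I))"
    using assms by (subst PS.product_nn_integral_insert) auto
  also have "\<dots> = ennreal (mean_norm (insert i I) v)"
    unfolding mean_norm_def using assms
    by (intro nn_integral_eq_integral shifted_norm_integrable) auto
  finally show ?thesis by (simp add: mean_norm_nonneg)
qed

lemma norm_mgf_step:
  assumes "finite I" "i \<notin> I" and s: "0 \<le> s" "s * M \<le> 8/5"
  shows "(\<integral>\<^sup>+y. exp (s * mean_norm I (\<lambda>k. v k + X y k)) \<partial>P)
    \<le> ennreal (exp (s * mean_norm (insert i I) v + 15/16 * s\<^sup>2 * V))"
proof -
  define h where "h = (\<lambda>y. mean_norm I (\<lambda>k. v k + X y k))"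
  \<comment> \<open>The mean norm without observation \<open>i\<close> is a constant that
    \<open>lip\<close> compares with \<open>h\<close> by the norm of \<open>X y\<close> alone.
    Passing from \<open>c\<close> to the true mean \<open>H\<close> afterwards only lowers the
    second moment.\<close>
  define c where "c = mean_norm I v"
  define H where "H = mean_norm (insert i I) v"
  have [measurable]: "h \<in> borel_measurable P"
    unfolding h_def by (rule mean_norm_measurable) fact
  have hint [simp]: "integrable P h" and H: "H = (\<integral>y. h y \<partial>P)"
    unfolding h_def H_def by (rule mean_norm_insert[OF assms(1,2)])+
  have cH: "c \<le> H" unfolding c_def H_def by (rule mean_norm_insert_ge[OF assms(1,2)])
  have lip: "\<bar>h y - c\<bar> \<le> L2_set (X y) F" for y
    unfolding h_def c_def by (rule mean_norm_lipschitz) fact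
  have lipM: "\<bar>h y - c\<bar> \<le> M" if "y \<in> space P" for y
    using lip[of y] X_bound[OF that] by linarith
  have sqint [simp]: "integrable P (\<lambda>y. (h y - c)\<^sup>2)"
    using lipM by (intro integrable_const_bound[where B = "M\<^sup>2"] AE_I2)
      (auto simp: abs_le_square_iff[symmetric] M_nonneg)
  have "(\<integral>y. (h y - c)\<^sup>2 \<partial>P) \<le> (\<integral>y. (L2_set (X y) F)\<^sup>2 \<partial>P)"
  proof (intro integral_mono)
    show "integrable P (\<lambda>y. (L2_set (X y) F)\<^sup>2)"
      by (simp add: L2_set_def sum_nonneg)
    show "(h y - c)\<^sup>2 \<le> (L2_set (X y) F)\<^sup>2" for y
      using lip[of y] by (simp add: abs_le_square_iff[symmetric])
  qed simp
  then have var: "(\<integral>y. (h y - c)\<^sup>2 \<partial>P) \<le> V" using X_var by linarith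
  have sqe: "(h y - H)\<^sup>2 = (h y - c)\<^sup>2 - 2 * (H - c) * (h y - c) + (H - c)\<^sup>2" for y
    by (simp add: power2_eq_square algebra_simps)
  have sqHint [simp]: "integrable P (\<lambda>y. (h y - H)\<^sup>2)"
    unfolding sqe by simp
  have "(\<integral>y. (h y - H)\<^sup>2 \<partial>P) = (\<integral>y. (h y - c)\<^sup>2 \<partial>P) - (H - c)\<^sup>2"
    unfolding sqe by (simp add: prob_space H[symmetric]) (simp add: power2_eq_square algebra_simps)
  then have varH: "(\<integral>y. (h y - H)\<^sup>2 \<partial>P) \<le> V" using var by (smt (verit) zero_le_power2)
  have pw: "exp (s * h y) \<le> exp (s * H) * (1 + s * (h y - H) + 15/16 * s\<^sup>2 * (h y - H)\<^sup>2)"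
    if "y \<in> space P" for y
  proof -
    have "h y - H \<le> M" using lipM[OF that] cH by linarith
    then have "s * (h y - H) \<le> 8/5"
      using s mult_left_mono[of "h y - H" M s] by linarith
    from exp_le_quadratic[OF this]
    have "exp (s * H) * exp (s * (h y - H)) \<le> exp (s * H) * (1 + s * (h y - H) + 15/16 * s\<^sup>2 * (h y - H)\<^sup>2)"
      by (intro mult_left_mono) (auto simp: power_mult_distrib)
    then show ?thesis by (simp add: algebra_simps flip: exp_add)
  qed
  have "(\<integral>\<^sup>+y. exp (s * h y) \<partial>P)
      \<le> (\<integral>\<^sup>+y. exp (s * H) * (1 + s * (h y - H) + 15/16 * s\<^sup>2 * (h y - H)\<^sup>2) \<partial>P)"
    using pw by (intro nn_integral_mono ennreal_leI) auto
  also have "\<dots> = ennreal (\<integral>y. exp (s * H) * (1 + s * (h y - H) + 15/16 * s\<^sup>2 * (h y - H)\<^sup>2) \<partial>P)"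
    using pw by (intro nn_integral_eq_integral AE_I2) (auto intro: order_trans[OF exp_ge_zero])
  also have "(\<integral>y. exp (s * H) * (1 + s * (h y - H) + 15/16 * s\<^sup>2 * (h y - H)\<^sup>2) \<partial>P)
     = exp (s * H) * (1 + 15/16 * s\<^sup>2 * (\<integral>y. (h y - H)\<^sup>2 \<partial>P))"
    by (simp add: prob_space H[symmetric])
  also have "\<dots> \<le> exp (s * H) * exp (15/16 * s\<^sup>2 * V)"
  proof (intro mult_left_mono)
    have "15/16 * s\<^sup>2 * (\<integral>y. (h y - H)\<^sup>2 \<partial>P) \<le> 15/16 * s\<^sup>2 * V"
      using varH by (intro mult_left_mono) auto
    then show "1 + 15/16 * s\<^sup>2 * (\<integral>y. (h y - H)\<^sup>2 \<partial>P) \<le> exp (15/16 * s\<^sup>2 * V)"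
      using exp_ge_add_one_self[of "15/16 * s\<^sup>2 * V"] by linarith
  qed simp
  finally show ?thesis
    unfolding h_def H_def by (simp add: exp_add ennreal_leI)
qed

text \<open>The shift is generalized so that the inner integral over the remaining observations is
  the induction hypothesis at \<open>v + X y\<close>; the outer integral over \<open>y\<close> is
  one martingale step.\<close>

lemma norm_mgf:
  assumes "finite I" and s: "0 \<le> s" "s * M \<le> 8/5"
  shows "(\<integral>\<^sup>+x. exp (s * shifted_norm I v x) \<partial>sample_space I)
    \<le> ennreal (exp (s * mean_norm I v + card I * (15/16 * s\<^sup>2 * V)))"
  using assms(1)
proof (induction I arbitrary: v rule: finite_induct)
  case empty
  then show ?case
    by (simp add: mean_norm_def PiM_empty nn_integral_count_space_finite lebesgue_integral_count_space_finite)
next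
  case (insert i I)
  let ?\<kappa> = "15/16 * s\<^sup>2 * V"
  have "(\<integral>\<^sup>+x. exp (s * shifted_norm (insert i I) v x) \<partial>sample_space (insert i I))
    = (\<integral>\<^sup>+y. \<integral>\<^sup>+x. exp (s * shifted_norm I (\<lambda>k. v k + X y k) x) \<partial>sample_space I \<partial>P)"
    using insert.hyps by (subst PS.product_nn_integral_insert_rev) (auto simp: shifted_norm_insert simp del: fun_upd_apply)
  also have "\<dots> \<le> (\<integral>\<^sup>+y. ennreal (exp (card I * ?\<kappa>)) * exp (s * mean_norm I (\<lambda>k. v k + X y k)) \<partial>P)"
    by (intro nn_integral_mono order_trans[OF insert.IH]) (simp add: mult.commute flip: exp_add ennreal_mult')
  also have "\<dots> = ennreal (exp (card I * ?\<kappa>)) * (\<integral>\<^sup>+y. exp (s * mean_norm I (\<lambda>k. v k + X y k)) \<partial>P)"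
    using mean_norm_measurable[OF insert.hyps(1)] by (intro nn_integral_cmult) auto
  also have "\<dots> \<le> ennreal (exp (card I * ?\<kappa>)) * ennreal (exp (s * mean_norm (insert i I) v + ?\<kappa>))"
    by (intro mult_left_mono norm_mgf_step insert.hyps s) auto
  also have "\<dots> = ennreal (exp (s * mean_norm (insert i I) v + card (insert i I) * ?\<kappa>))"
    using insert.hyps by (simp add: algebra_simps flip: exp_add ennreal_mult')
  finally show ?case .
qed

section \<open>Second moments and the tail of the norm\<close>

lemma second_moment_le:
  assumes "finite I"
  shows "(\<integral>\<^sup>+x. (shifted_norm I v x)\<^sup>2 \<partial>sample_space I) \<le> ennreal ((L2_set v F)\<^sup>2 + card I * V)"
  using assms
proof (induction I arbitrary: v rule: finite_induct)
  case empty
  then show ?case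
    by (simp add: PiM_empty nn_integral_count_space_finite)
next
  case (insert i I)
  have L2sq: "(L2_set w F)\<^sup>2 = (\<Sum>k\<in>F. (w k)\<^sup>2)" for w
    by (simp add: L2_set_def sum_nonneg)
  have "(\<integral>\<^sup>+x. (shifted_norm (insert i I) v x)\<^sup>2 \<partial>sample_space (insert i I))
    = (\<integral>\<^sup>+y. \<integral>\<^sup>+x. (shifted_norm I (\<lambda>k. v k + X y k) x)\<^sup>2 \<partial>sample_space I \<partial>P)"
    using insert.hyps by (subst PS.product_nn_integral_insert_rev) (auto simp: shifted_norm_insert simp del: fun_upd_apply)
  also have "\<dots> \<le> (\<integral>\<^sup>+y. ennreal ((L2_set (\<lambda>k. v k + X y k) F)\<^sup>2 + card I * V) \<partial>P)"
    by (intro nn_integral_mono insert.IH)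
  also have "\<dots> = ennreal (\<integral>y. (L2_set (\<lambda>k. v k + X y k) F)\<^sup>2 + card I * V \<partial>P)"
  proof (intro nn_integral_eq_integral AE_I2)
    show "integrable P (\<lambda>y. (L2_set (\<lambda>k. v k + X y k) F)\<^sup>2 + card I * V)"
      by (simp add: L2sq power2_sum)
  qed (simp add: V_nonneg)
  also have "(\<integral>y. (L2_set (\<lambda>k. v k + X y k) F)\<^sup>2 + card I * V \<partial>P)
     = (L2_set v F)\<^sup>2 + (\<integral>y. (L2_set (X y) F)\<^sup>2 \<partial>P) + card I * V"
    by (simp add: L2sq power2_sum prob_space X_mean mult.assoc sum.distrib)
  also have "\<dots> \<le> (L2_set v F)\<^sup>2 + card (insert i I) * V"
    using X_var insert.hyps by (simp add: algebra_simps)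
  finally show ?case by (simp add: ennreal_leI)
qed

lemma mean_norm_zero_le:
  assumes "finite I"
  shows "mean_norm I (\<lambda>_. 0) \<le> sqrt (card I * V)"
proof -
  let ?g = "shifted_norm I (\<lambda>_. 0)"
  have bd: "?g x \<le> card I * M" if "x \<in> space (sample_space I)" for x
    using shifted_norm_le[OF assms that, of "\<lambda>_. 0"] by (simp add: L2_set_def)
  have i2: "integrable (sample_space I) (\<lambda>x. (?g x)\<^sup>2)"
    using bd by (intro PS.integrable_const_bound[where B = "(card I * M)\<^sup>2"] AE_I2)
      (auto simp del: of_nat_0_le_iff intro!: power_mono)
  have "(\<integral>x. ?g x \<partial>sample_space I)\<^sup>2 \<le> (\<integral>x. (?g x)\<^sup>2 \<partial>sample_space I)"
    using PS.variance_positive[where X = ?g and I = I] PS.variance_eq[OF shifted_norm_integrable[OF assms] i2] by simp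
  also have "\<dots> \<le> card I * V"
  proof -
    have "ennreal (\<integral>x. (?g x)\<^sup>2 \<partial>sample_space I) = (\<integral>\<^sup>+x. (?g x)\<^sup>2 \<partial>sample_space I)"
      by (intro nn_integral_eq_integral[symmetric] i2) simp
    also have "\<dots> \<le> ennreal (card I * V)"
      using second_moment_le[OF assms, of "\<lambda>_. 0"] by (simp add: L2_set_def)
    finally show ?thesis using V_nonneg by (simp add: ennreal_le_iff)
  qed
  finally show ?thesis unfolding mean_norm_def by (rule real_le_rsqrt)
qed

text \<open>Using the variance \<open>M\<^sup>2 / 4\<close> in place of the range gives the exponent \<open>u\<^sup>2\<close> that matches \<open>\<lambda>\<close>,
  without conditioning on the covariates.\<close>
lemma norm_sum_tail:
  assumes I: "finite I" "I \<noteq> {}" and M: "0 < M" and V: "V = M\<^sup>2 / 4" and u: "0 \<le> u"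
  defines "n \<equiv> real (card I)"
  shows "measure (sample_space I) {x\<in>space (sample_space I). M * sqrt n * (1/2 + u) \<le> L2_set (\<lambda>k. \<Sum>i\<in>I. X (x i) k) F}
     \<le> exp (- u\<^sup>2)" (is "measure _ ?E \<le> _")
\<comment> \<open>Beyond \<open>sqrt n\<close> the threshold exceeds \<open>n * M\<close> and the
  event is empty. Below it, the Chernoff parameter satisfies the constraint
  \<open>s * M \<le> 8/5\<close> of \<open>norm_mgf\<close>.\<close>
proof (cases "u \<le> sqrt n")
  case False
  have n: "n > 0" using I by (simp add: n_def card_gt_0_iff)
  have "M * n < M * sqrt n * (1/2 + u)"
  proof -
    have "M * sqrt n * sqrt n < M * sqrt n * (1/2 + u)"
      using False M n by (intro mult_strict_left_mono) auto
    then show ?thesis using n by (simp add: mult.assoc)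
  qed
  then have "?E = {}"
    using norm_sum_le[OF I(1)] by (fastforce simp: n_def mult.commute)
  then show ?thesis by (simp only: measure_empty exp_ge_zero)
next
  case True
  have n: "n > 0" using I by (simp add: n_def card_gt_0_iff)
  \<comment> \<open>With this \<open>s\<close> the Chernoff exponent is \<open>- 8/5 u\<^sup>2 + 15/16 (8/5)\<^sup>2 u\<^sup>2 / 4 = - u\<^sup>2\<close>.\<close>
  define s where "s = 8/5 * u / (M * sqrt n)"
  have s0: "0 \<le> s" using u M n by (simp add: s_def)
  have sM: "s * M \<le> 8/5" using True M n by (simp add: s_def field_simps)
  let ?g = "shifted_norm I (\<lambda>_. 0)"
  have g: "?g x = L2_set (\<lambda>k. \<Sum>i\<in>I. X (x i) k) F" for x
    by (simp add: shifted_norm_def)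
  have "emeasure (sample_space I) ?E \<le> emeasure (sample_space I) {x\<in>space (sample_space I). 1 \<le> ennreal (exp (- s * (M * sqrt n * (1/2 + u)))) * exp (s * ?g x)}"
    proof (intro emeasure_mono)
    show "?E \<subseteq> {x\<in>space (sample_space I). 1 \<le> ennreal (exp (- s * (M * sqrt n * (1/2 + u)))) * exp (s * ?g x)}"
      using s0 by (auto simp: g mult_left_mono simp flip: exp_add ennreal_mult')
  qed measurable
  also have "\<dots> \<le> ennreal (exp (- s * (M * sqrt n * (1/2 + u)))) * (\<integral>\<^sup>+x. ennreal (exp (s * ?g x)) * indicator (space (sample_space I)) x \<partial>sample_space I)"
    using nn_integral_Markov_inequality[of "\<lambda>x. ennreal (exp (s * ?g x))" "space (sample_space I)" "sample_space I" "ennreal (exp (- s * (M * sqrt n * (1/2 + u))))"]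
    by simp
  also have "(\<integral>\<^sup>+x. ennreal (exp (s * ?g x)) * indicator (space (sample_space I)) x \<partial>sample_space I) = (\<integral>\<^sup>+x. exp (s * ?g x) \<partial>sample_space I)"
    by (intro nn_integral_cong) simp
  also have "ennreal (exp (- s * (M * sqrt n * (1/2 + u)))) * \<dots>
     \<le> ennreal (exp (- s * (M * sqrt n * (1/2 + u)))) * ennreal (exp (s * (M * sqrt n / 2) + n * (15/16 * s\<^sup>2 * V)))"
  proof (intro mult_left_mono order_trans[OF norm_mgf[OF I(1) s0 sM]] ennreal_leI)
    have "mean_norm I (\<lambda>_. 0) \<le> M * sqrt n / 2"
      using mean_norm_zero_le[OF I(1)] M by (simp add: V n_def real_sqrt_mult real_sqrt_divide mult.commute)
    then show "exp (s * mean_norm I (\<lambda>_. 0) + real (card I) * (15 / 16 * s\<^sup>2 * V)) \<le> exp (s * (M * sqrt n / 2) + n * (15/16 * s\<^sup>2 * V))"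
      using mult_left_mono[OF _ s0, of "mean_norm I (\<lambda>_. 0)" "M * sqrt n / 2"] by (simp add: n_def)
  qed simp
  also have "\<dots> = ennreal (exp (- s * (M * sqrt n * (1/2 + u)) + (s * (M * sqrt n / 2) + n * (15/16 * s\<^sup>2 * V))))"
    by (simp flip: exp_add ennreal_mult')
  also have "- s * (M * sqrt n * (1/2 + u)) + (s * (M * sqrt n / 2) + n * (15/16 * s\<^sup>2 * V)) = - u\<^sup>2"
  proof -
    have 1: "s * (M * sqrt n) = 8/5 * u" using M n by (simp add: s_def)
    have 2: "n * s\<^sup>2 * M\<^sup>2 = (8/5 * u)\<^sup>2"
      using n by (simp only: 1[symmetric] power_mult_distrib) simp
    have "- s * (M * sqrt n * (1/2 + u)) + (s * (M * sqrt n / 2) + n * (15/16 * s\<^sup>2 * V))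
      = - (s * (M * sqrt n)) * u + 15/64 * (n * s\<^sup>2 * M\<^sup>2)"
      by (simp add: V algebra_simps)
    then show ?thesis unfolding 1 2 by (simp add: power2_eq_square)
  qed
  finally show ?thesis
    by (simp add: PS.emeasure_eq_measure)
qed

end

section \<open>Uniform deviations over an l1 ball\<close>

text \<open>By convexity, pushing two points apart with fixed sum raises the sum of their
  exponentials. When the points are in the wrong order for this, the terms are compared crosswise,
  which is why the right side has maxima.\<close>

lemma exp_contraction_aux:
  fixes A A' f f' a a' :: real
  assumes "\<bar>f\<bar> \<le> \<bar>a\<bar>" "\<bar>f'\<bar> \<le> \<bar>a'\<bar>" "\<bar>f - f'\<bar> \<le> \<bar>a - a'\<bar>" "0 \<le> a'" "a' \<le> a"
  shows "exp (A + f) + exp (A' - f')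
    \<le> max (exp (A + a)) (exp (A' + a')) + max (exp (A - a)) (exp (A' - a'))"
proof -
  \<comment> \<open>The largest shift with \<open>f \<le> a - m\<close> and
    \<open>m \<le> 2 * a'\<close>. Then \<open>- f' \<le> m - a'\<close> follows from the bound on
    \<open>f - f'\<close> or from the bound on \<open>f'\<close>, according to which term is the
    minimum.\<close>
  define m where "m = min (a - f) (2 * a')"
  have m: "0 \<le> m" "m \<le> 2 * a'" "f \<le> a - m" "- f' \<le> m - a'"
    using assms by (auto simp: m_def min_def)
  have le: "exp (A + f) + exp (A' - f') \<le> exp (A + a - m) + exp (A' - a' + m)"
    using m by (intro add_mono) auto
  show ?thesis
  proof (cases "A' - a' + m \<le> A + a")
    case True
    have "exp (A' - a' + m) * (1 - exp (- m)) \<le> exp (A + a) * (1 - exp (- m))"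
      using True m by (intro mult_right_mono) auto
    then have "exp (A + a - m) + exp (A' - a' + m) \<le> exp (A + a) + exp (A' - a')"
      by (simp add: right_diff_distrib flip: exp_add)
    then show ?thesis using le by linarith
  next
    case False
    then have "exp (A + a - m) + exp (A' - a' + m) \<le> exp (A' - a') + exp (A' + a')"
      using m by (intro add_mono) auto
    then show ?thesis using le by linarith
  qed
qed

lemma exp_contraction_nonneg:
  fixes A A' f f' a a' :: real
  assumes "\<bar>f\<bar> \<le> \<bar>a\<bar>" "\<bar>f'\<bar> \<le> \<bar>a'\<bar>" "\<bar>f - f'\<bar> \<le> \<bar>a - a'\<bar>" "0 \<le> a"
  shows "exp (A + f) + exp (A' - f')
    \<le> max (exp (A + a)) (exp (A' + a')) + max (exp (A - a)) (exp (A' - a'))"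
proof (cases "0 \<le> a'")
  case False
  have "exp (A + f) + exp (A' - f') \<le> exp (A + a) + exp (A' - a')"
    using assms False by (intro add_mono) auto
  then show ?thesis by linarith
next
  case True
  show ?thesis
  proof (cases "a' \<le> a")
    case True
    then show ?thesis using assms \<open>0 \<le> a'\<close> by (intro exp_contraction_aux) auto
  next
    case False
    \<comment> \<open>Only the first point carries a plus sign, so exchanging the two points
      replaces \<open>f\<close>, \<open>f'\<close> by \<open>- f'\<close>,
      \<open>- f\<close>.\<close>
    then show ?thesis
      using assms exp_contraction_aux[of "- f'" a' "- f" a A' A]
      by (simp add: max.commute add.commute)
  qed
qed

text \<open>The two-point case of the Ledoux--Talagrand contraction principle, for the exponential.\<close>
lemma exp_contraction:
  fixes A A' f f' a a' :: real
  assumes "\<bar>f\<bar> \<le> \<bar>a\<bar>" "\<bar>f'\<bar> \<le> \<bar>a'\<bar>" "\<bar>f - f'\<bar> \<le> \<bar>a - a'\<bar>"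
  shows "exp (A + f) + exp (A' - f')
    \<le> max (exp (A + a)) (exp (A' + a')) + max (exp (A - a)) (exp (A' - a'))"
proof (cases "0 \<le> a")
  case True
  then show ?thesis using assms by (intro exp_contraction_nonneg)
next
  case False
  have "exp (A + f) + exp (A' - f')
    \<le> max (exp (A + - a)) (exp (A' + - a')) + max (exp (A - - a)) (exp (A' - - a'))"
    using assms False by (intro exp_contraction_nonneg) auto
  then show ?thesis by (simp only: minus_minus diff_conv_add_uminus add.commute)
qed

text \<open>A sum of two suprema is a supremum over pairs, so the two-point inequality suffices.
  Halved, both sides are averages over a random sign: this is contraction for a single
  observation.\<close>

lemma SUP_exp_contraction:
  fixes B a f :: "'t \<Rightarrow> real"
  assumes "\<And>t. t \<in> T \<Longrightarrow> \<bar>f t\<bar> \<le> \<bar>a t\<bar>"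
    and "\<And>t t'. t \<in> T \<Longrightarrow> t' \<in> T \<Longrightarrow> \<bar>f t - f t'\<bar> \<le> \<bar>a t - a t'\<bar>"
  shows "(SUP t\<in>T. ennreal (exp (B t + f t))) + (SUP t\<in>T. ennreal (exp (B t - f t)))
     \<le> (SUP t\<in>T. ennreal (exp (B t + a t))) + (SUP t\<in>T. ennreal (exp (B t - a t)))"
    (is "_ \<le> ?U + ?L")
proof (cases "T = {}")
  case False
  have *: "ennreal (exp (B t + f t)) + ennreal (exp (B t' - f t')) \<le> ?U + ?L"
    if "t \<in> T" "t' \<in> T" for t t'
  proof -
    have "ennreal (exp (B t + f t)) + ennreal (exp (B t' - f t'))
      = ennreal (exp (B t + f t) + exp (B t' - f t'))" by simp
    also have "\<dots> \<le> ennreal (max (exp (B t + a t)) (exp (B t' + a t'))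
        + max (exp (B t - a t)) (exp (B t' - a t')))"
      using assms that by (intro ennreal_leI exp_contraction) auto
    also have "\<dots> = max (ennreal (exp (B t + a t))) (ennreal (exp (B t' + a t')))
        + max (ennreal (exp (B t - a t))) (ennreal (exp (B t' - a t')))"
      by (subst ennreal_plus) (auto simp: max_def)
    also have "\<dots> \<le> ?U + ?L"
      using that by (intro add_mono max.boundedI) (auto intro: SUP_upper)
    finally show ?thesis .
  qed
  have "(SUP t\<in>T. ennreal (exp (B t + f t))) + (SUP t\<in>T. ennreal (exp (B t - f t)))
    = (SUP t\<in>T. SUP t'\<in>T. ennreal (exp (B t + f t)) + ennreal (exp (B t' - f t')))"
    by (simp only: ennreal_SUP_add_right[OF False, symmetric] ennreal_SUP_add_left[OF False])
  also have "\<dots> \<le> ?U + ?L" by (intro SUP_least *)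
  finally show ?thesis .
qed simp

section \<open>Symmetrization of a single observation\<close>

lemma exp_avg_le:
  fixes x y :: real
  shows "ennreal (exp ((x + y) / 2)) \<le> (ennreal (exp x) + ennreal (exp y)) / 2"
proof -
  have "exp ((x + y) / 2) \<le> (exp x + exp y) / 2"
  proof -
    have "0 \<le> (exp (x/2) - exp (y/2))\<^sup>2" by simp
    also have "\<dots> = exp x + exp y - 2 * exp ((x + y) / 2)"
      by (simp add: power2_eq_square algebra_simps add_divide_distrib flip: exp_add)
    finally show ?thesis by simp
  qed
  then have "ennreal (exp ((x + y) / 2)) \<le> ennreal ((exp x + exp y) / 2)" by (rule ennreal_leI)
  also have "\<dots> = (ennreal (exp x) + ennreal (exp y)) / 2"
    by (simp flip: divide_ennreal add: ennreal_numeral[symmetric] del: ennreal_numeral)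
  finally show ?thesis .
qed

text \<open>Jensen's inequality through the tangent of the exponential at the mean, with the right
  side allowed to be infinite.\<close>

lemma (in prob_space) exp_expectation_le:
  assumes "integrable M h"
  shows "ennreal (exp (c + expectation h)) \<le> (\<integral>\<^sup>+z. exp (c + h z) \<partial>M)"
proof -
  let ?m = "expectation h"
  let ?g = "\<lambda>z. exp (c + ?m) * (1 + (h z - ?m))"
  have [measurable]: "h \<in> borel_measurable M" using assms by auto
  have "exp (c + ?m) = (\<integral>z. ?g z \<partial>M)"
    using assms by (simp add: prob_space)
  also have "ennreal \<dots> \<le> (\<integral>\<^sup>+z. ?g z \<partial>M)"
  proof (cases "(\<integral>z. ?g z \<partial>M) \<ge> 0")
    case True
    have "integrable M ?g" using assms by simp
    then have "ennreal (\<integral>z. ?g z \<partial>M) \<le> ennreal (\<integral>z. max 0 (?g z) \<partial>M)"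
      by (intro ennreal_leI integral_mono) auto
    also have "\<dots> = (\<integral>\<^sup>+z. max 0 (?g z) \<partial>M)"
      using \<open>integrable M ?g\<close> by (intro nn_integral_eq_integral[symmetric]) auto
    also have "\<dots> = (\<integral>\<^sup>+z. ?g z \<partial>M)"
      by (intro nn_integral_cong) (auto simp: max_def ennreal_neg)
    finally show ?thesis .
  qed (simp add: ennreal_neg)
  also have "\<dots> \<le> (\<integral>\<^sup>+z. exp (c + h z) \<partial>M)"
  proof (intro nn_integral_mono ennreal_leI)
    fix z
    have "exp (c + ?m) * (1 + (h z - ?m)) \<le> exp (c + ?m) * exp (h z - ?m)"
      by (intro mult_left_mono exp_ge_add_one_self) auto
    then show "?g z \<le> exp (c + h z)" by (simp flip: exp_add)
  qed
  finally show ?thesis .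
qed

text \<open>For an independent copy \<open>z'\<close>, the difference \<open>f t z' - f t z\<close>
  is the average of \<open>2 * f t z'\<close> and \<open>- 2 * f t z\<close>. Midpoint convexity of
  the exponential separates the copies, so each is integrated alone. This costs the factor 2 and
  directly produces the average over a random sign.\<close>

lemma (in prob_space) symmetrization_step:
  assumes [simp]: "countable T"
    and f: "\<And>t. t \<in> T \<Longrightarrow> integrable M (f t)"
    and [measurable]: "\<And>t. t \<in> T \<Longrightarrow> a t \<in> borel_measurable M"
    and c1: "\<And>t z. t \<in> T \<Longrightarrow> \<bar>f t z\<bar> \<le> \<bar>a t z\<bar>"
    and c2: "\<And>t t' z. t \<in> T \<Longrightarrow> t' \<in> T \<Longrightarrow> \<bar>f t z - f t' z\<bar> \<le> \<bar>a t z - a t' z\<bar>"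
  shows "(\<integral>\<^sup>+z. (SUP t\<in>T. ennreal (exp (B t + (expectation (f t) - f t z)))) \<partial>M)
    \<le> (\<integral>\<^sup>+z. ((SUP t\<in>T. ennreal (exp (B t + 2 * a t z))) + (SUP t\<in>T. ennreal (exp (B t - 2 * a t z)))) / 2 \<partial>M)"
proof -
  have [measurable]: "f t \<in> borel_measurable M" if "t \<in> T" for t using f[OF that] by auto
  let ?U = "\<lambda>z. SUP t\<in>T. ennreal (exp (B t + 2 * f t z))"
  let ?L = "\<lambda>z. SUP t\<in>T. ennreal (exp (B t - 2 * f t z))"
  have "(\<integral>\<^sup>+z. (SUP t\<in>T. ennreal (exp (B t + (expectation (f t) - f t z)))) \<partial>M)
     \<le> (\<integral>\<^sup>+z. \<integral>\<^sup>+z'. (?U z' + ?L z) / 2 \<partial>M \<partial>M)"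
  proof (intro nn_integral_mono SUP_least)
    fix z t assume t: "t \<in> T"
    have "ennreal (exp (B t + (expectation (f t) - f t z))) = ennreal (exp ((B t - f t z) + expectation (f t)))"
      by (simp add: algebra_simps)
    also have "\<dots> \<le> (\<integral>\<^sup>+z'. exp ((B t - f t z) + f t z') \<partial>M)"
      by (intro exp_expectation_le f t)
    also have "\<dots> \<le> (\<integral>\<^sup>+z'. (?U z' + ?L z) / 2 \<partial>M)"
    proof (intro nn_integral_mono)
      fix z'
      have "ennreal (exp ((B t - f t z) + f t z')) = ennreal (exp (((B t + 2 * f t z') + (B t - 2 * f t z)) / 2))"
        by (simp add: algebra_simps)
      also have "\<dots> \<le> (ennreal (exp (B t + 2 * f t z')) + ennreal (exp (B t - 2 * f t z))) / 2"
        by (rule exp_avg_le)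
      also have "\<dots> \<le> (?U z' + ?L z) / 2"
        using t by (intro divide_right_mono_ennreal add_mono SUP_upper)
      finally show "ennreal (exp ((B t - f t z) + f t z')) \<le> (?U z' + ?L z) / 2" .
    qed
    finally show "ennreal (exp (B t + (expectation (f t) - f t z))) \<le> (\<integral>\<^sup>+z'. (?U z' + ?L z) / 2 \<partial>M)" .
  qed
  also have "\<dots> = (\<integral>\<^sup>+z. (?U z + ?L z) / 2 \<partial>M)"
    by (simp add: nn_integral_divide nn_integral_add emeasure_space_1)
  also have "\<dots> \<le> (\<integral>\<^sup>+z. ((SUP t\<in>T. ennreal (exp (B t + 2 * a t z))) + (SUP t\<in>T. ennreal (exp (B t - 2 * a t z)))) / 2 \<partial>M)"
  proof (intro nn_integral_mono divide_right_mono_ennreal SUP_exp_contraction)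
    show "\<bar>2 * f t z - 2 * f t' z\<bar> \<le> \<bar>2 * a t z - 2 * a t' z\<bar>" if "t \<in> T" "t' \<in> T" for t t' z
      using c2[OF that, of z] by linarith
  qed (use c1 in \<open>auto simp: abs_mult\<close>)
  finally show ?thesis .
qed

section \<open>Observations paired with independent random signs\<close>

definition signed :: "'a measure \<Rightarrow> ('a \<times> real) measure" where
  "signed P = P \<Otimes>\<^sub>M measure_pmf (pmf_of_set {1, -1})"

lemma prob_space_signed: "prob_space P \<Longrightarrow> prob_space (signed P)"
  unfolding signed_def
  by (intro prob_space_pair measure_pmf.prob_space_axioms)

lemma measurable_signed_fst [measurable]: "fst \<in> signed P \<rightarrow>\<^sub>M P"
  unfolding signed_def by measurable

lemma measurable_signed_snd [measurable]: "snd \<in> borel_measurable (signed P)"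
proof -
  have "(\<lambda>x. x) \<in> measure_pmf (pmf_of_set {1, -1}) \<rightarrow>\<^sub>M (borel :: real measure)" by simp
  from measurable_compose[OF measurable_snd this] show ?thesis unfolding signed_def .
qed

lemma nn_integral_signed:
  assumes "g \<in> borel_measurable (signed P)"
  shows "(\<integral>\<^sup>+q. g q \<partial>signed P) = (\<integral>\<^sup>+z. (g (z, 1) + g (z, -1)) / 2 \<partial>P)"
proof -
  let ?p = "pmf_of_set {1, -1 :: real}"
  have "(\<integral>\<^sup>+q. g q \<partial>signed P) = (\<integral>\<^sup>+z. \<integral>\<^sup>+e. g (z, e) \<partial>measure_pmf ?p \<partial>P)"
    using assms unfolding signed_def
    by (intro measure_pmf.nn_integral_fst[symmetric])
  moreover have "(\<integral>\<^sup>+e. g (z, e) \<partial>measure_pmf ?p) = (g (z, 1) + g (z, -1)) / 2" for z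
    by (subst nn_integral_pmf_of_set) auto
  ultimately show ?thesis by simp
qed

text \<open>The free offset \<open>B\<close> absorbs the terms of all other observations, so each
  induction step treats one. The induction hypothesis puts signs on the others first; Fubini then
  moves the new observation inside, where \<open>symmetrization_step\<close> applies. Since
  exponential moments are compared, a Chernoff bound can follow at once.\<close>

lemma symmetrization_contraction:
  fixes f a :: "'t \<Rightarrow> 'a \<Rightarrow> real"
  assumes P: "prob_space P" and T [simp]: "countable T" and I: "finite I"
    and f: "\<And>t. t \<in> T \<Longrightarrow> integrable P (f t)"
    and a [measurable]: "\<And>t. t \<in> T \<Longrightarrow> a t \<in> borel_measurable P"
    and c1: "\<And>t z. t \<in> T \<Longrightarrow> \<bar>f t z\<bar> \<le> \<bar>a t z\<bar>"
    and c2: "\<And>t t' z. t \<in> T \<Longrightarrow> t' \<in> T \<Longrightarrow> \<bar>f t z - f t' z\<bar> \<le> \<bar>a t z - a t' z\<bar>"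
  shows "(\<integral>\<^sup>+x. (SUP t\<in>T. ennreal (exp (B t + (\<Sum>i\<in>I. (\<integral>z. f t z \<partial>P) - f t (x i))))) \<partial>(\<Pi>\<^sub>M i\<in>I. P))
     \<le> (\<integral>\<^sup>+x. (SUP t\<in>T. ennreal (exp (B t + (\<Sum>i\<in>I. 2 * (snd (x i) * a t (fst (x i))))))) \<partial>(\<Pi>\<^sub>M i\<in>I. signed P))"
  using I
proof (induction I arbitrary: B rule: finite_induct)
  case empty
  then show ?case by (simp add: PiM_empty nn_integral_count_space_finite)
next
  case (insert i I)
  interpret P: prob_space P by fact
  interpret Q: prob_space "signed P" by (intro prob_space_signed P)
  interpret PS: product_sigma_finite "\<lambda>_. P" by unfold_locales
  interpret QS: product_sigma_finite "\<lambda>_. signed P" by unfold_locales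
  interpret QI: prob_space "\<Pi>\<^sub>M i\<in>I. signed P" by (intro prob_space_PiM Q.prob_space_axioms)
  interpret pair_sigma_finite P "\<Pi>\<^sub>M i\<in>I. signed P" by unfold_locales
  have fm [measurable]: "f t \<in> borel_measurable P" if "t \<in> T" for t using f[OF that] by auto
  define m where "m t = (\<integral>z. f t z \<partial>P)" for t
  define W where "W t x = (\<Sum>i\<in>I. 2 * (snd (x i) * a t (fst (x i))))" for t and x :: "_ \<Rightarrow> 'a \<times> real"
  have [measurable]: "W t \<in> borel_measurable (\<Pi>\<^sub>M i\<in>I. signed P)" if "t \<in> T" for t
    unfolding W_def using that by measurable
  have eqP: "(\<Sum>j\<in>insert i I. m t - f t ((x(i := y)) j)) = (m t - f t y) + (\<Sum>j\<in>I. m t - f t (x j))" for t x y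
  proof -
    have "(\<Sum>j\<in>I. m t - f t ((x(i := y)) j)) = (\<Sum>j\<in>I. m t - f t (x j))"
      using insert.hyps by (intro sum.cong) auto
    then show ?thesis using insert.hyps by simp
  qed
  have eqQ: "(\<Sum>j\<in>insert i I. 2 * (snd ((x(i := y)) j) * a t (fst ((x(i := y)) j))))
      = 2 * (snd y * a t (fst y)) + W t x" for t x y
  proof -
    have "(\<Sum>j\<in>I. 2 * (snd ((x(i := y)) j) * a t (fst ((x(i := y)) j)))) = W t x"
      unfolding W_def using insert.hyps by (intro sum.cong) auto
    then show ?thesis using insert.hyps by simp
  qed
  have "(\<integral>\<^sup>+x. (SUP t\<in>T. ennreal (exp (B t + (\<Sum>i\<in>insert i I. m t - f t (x i))))) \<partial>(\<Pi>\<^sub>M i\<in>insert i I. P))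
     = (\<integral>\<^sup>+y. \<integral>\<^sup>+x. (SUP t\<in>T. ennreal (exp ((B t + (m t - f t y)) + (\<Sum>i\<in>I. m t - f t (x i))))) \<partial>(\<Pi>\<^sub>M i\<in>I. P) \<partial>P)"
    using insert.hyps
    by (subst PS.product_nn_integral_insert_rev) (simp_all only: eqP add.assoc, measurable)
  also have "\<dots> \<le> (\<integral>\<^sup>+y. \<integral>\<^sup>+x. (SUP t\<in>T. ennreal (exp ((B t + (m t - f t y)) + W t x))) \<partial>(\<Pi>\<^sub>M i\<in>I. signed P) \<partial>P)"
    unfolding m_def W_def by (intro nn_integral_mono insert.IH)
  also have "\<dots> = (\<integral>\<^sup>+x. \<integral>\<^sup>+y. (SUP t\<in>T. ennreal (exp ((B t + (m t - f t y)) + W t x))) \<partial>P \<partial>(\<Pi>\<^sub>M i\<in>I. signed P))"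
    by (rule Fubini'[symmetric]) measurable
  also have "\<dots> = (\<integral>\<^sup>+x. \<integral>\<^sup>+y. (SUP t\<in>T. ennreal (exp ((B t + W t x) + (m t - f t y)))) \<partial>P \<partial>(\<Pi>\<^sub>M i\<in>I. signed P))"
    by (simp add: add_ac)
  also have "\<dots> \<le> (\<integral>\<^sup>+x. \<integral>\<^sup>+z. ((SUP t\<in>T. ennreal (exp ((B t + W t x) + 2 * a t z)))
        + (SUP t\<in>T. ennreal (exp ((B t + W t x) - 2 * a t z)))) / 2 \<partial>P \<partial>(\<Pi>\<^sub>M i\<in>I. signed P))"
    unfolding m_def by (intro nn_integral_mono P.symmetrization_step T f a c1 c2)
  also have "\<dots> = (\<integral>\<^sup>+x. \<integral>\<^sup>+y. (SUP t\<in>T. ennreal (exp (B t + (2 * (snd y * a t (fst y)) + W t x)))) \<partial>signed P \<partial>(\<Pi>\<^sub>M i\<in>I. signed P))"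
    by (intro nn_integral_cong, subst nn_integral_signed) (measurable, simp add: algebra_simps)
  also have "\<dots> = (\<integral>\<^sup>+x. (SUP t\<in>T. ennreal (exp (B t + (\<Sum>i\<in>insert i I. 2 * (snd (x i) * a t (fst (x i))))))) \<partial>(\<Pi>\<^sub>M i\<in>insert i I. signed P))"
    using insert.hyps
    by (subst QS.product_nn_integral_insert) (simp_all only: eqQ, measurable)
  finally show ?case by (simp add: m_def)
qed

section \<open>Exponential moments of sums with random signs\<close>

lemma cosh_le_exp_square:
  fixes y :: real
  shows "(exp y + exp (- y)) / 2 \<le> exp (y\<^sup>2 / 2)"
proof -
  \<comment> \<open>Hoeffding's lemma for a fair sign in [-1, 1], whose factor (1 - (-1))^2 / 8 is
    1/2.\<close>
  have *: "(exp l + exp (- l)) / 2 \<le> exp (l\<^sup>2 / 2)" if "l > 0" for l :: real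
  proof -
    let ?p = "pmf_of_set {1, -1 :: real}"
    interpret interval_bounded_random_variable "measure_pmf ?p" "\<lambda>x. x" "-1" 1
      by unfold_locales (auto simp: AE_measure_pmf_iff)
    have "measure_pmf.expectation ?p (\<lambda>x. x) = 0"
      by (subst integral_pmf_of_set) auto
    from Hoeffdings_lemma_nn_integral_0[OF that this]
    have "(\<integral>\<^sup>+x. ennreal (exp (l * x)) \<partial>measure_pmf ?p) \<le> ennreal (exp (l\<^sup>2 / 2))" by simp
    also have "(\<integral>\<^sup>+x. ennreal (exp (l * x)) \<partial>measure_pmf ?p) = ennreal ((exp l + exp (- l)) / 2)"
      by (subst nn_integral_pmf_of_set) (auto simp: divide_ennreal[symmetric] ennreal_numeral[symmetric] simp del: ennreal_numeral)
    finally show ?thesis by simp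
  qed
  consider "y > 0" | "y = 0" | "- y > 0" by linarith
  then show ?thesis
    using *[of y] *[of "- y"] by cases (simp_all add: add.commute)
qed

lemma nn_integral_signed_exp_le:
  fixes g :: "'a \<Rightarrow> real" and C :: real
  assumes "prob_space P" and [measurable]: "g \<in> borel_measurable P" and g: "\<And>z. \<bar>g z\<bar> \<le> C"
  shows "(\<integral>\<^sup>+q. exp (snd q * g (fst q)) \<partial>signed P) \<le> ennreal (exp (C\<^sup>2 / 2))"
proof -
  interpret prob_space P by fact
  have "(\<integral>\<^sup>+q. exp (snd q * g (fst q)) \<partial>signed P)
     = (\<integral>\<^sup>+z. (ennreal (exp (g z)) + ennreal (exp (- g z))) / 2 \<partial>P)"
    by (subst nn_integral_signed) auto
  also have "\<dots> \<le> (\<integral>\<^sup>+z. ennreal (exp (C\<^sup>2 / 2)) \<partial>P)"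
  proof (intro nn_integral_mono)
    fix z
    have "(ennreal (exp (g z)) + ennreal (exp (- g z))) / 2 = ennreal ((exp (g z) + exp (- g z)) / 2)"
      by (simp flip: divide_ennreal add: ennreal_numeral[symmetric] del: ennreal_numeral)
    also have "\<dots> \<le> ennreal (exp (C\<^sup>2 / 2))"
    proof (rule ennreal_leI, rule order_trans[OF cosh_le_exp_square])
      have "(g z)\<^sup>2 \<le> C\<^sup>2" using g[of z] by (simp add: abs_le_square_iff[symmetric])
      then show "exp ((g z)\<^sup>2 / 2) \<le> exp (C\<^sup>2 / 2)" by simp
    qed
    finally show "(ennreal (exp (g z)) + ennreal (exp (- g z))) / 2 \<le> ennreal (exp (C\<^sup>2 / 2))" .
  qed
  finally show ?thesis by (simp add: emeasure_space_1)
qed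

lemma rademacher_sum_mgf:
  fixes g :: "'a \<Rightarrow> real" and C :: real
  assumes P: "prob_space P" and "finite I" and [measurable]: "g \<in> borel_measurable P"
    and g: "\<And>z. \<bar>g z\<bar> \<le> C"
  shows "(\<integral>\<^sup>+x. exp (\<Sum>i\<in>I. snd (x i) * g (fst (x i))) \<partial>(\<Pi>\<^sub>M i\<in>I. signed P))
    \<le> ennreal (exp (card I * (C\<^sup>2 / 2)))"
proof -
  interpret Q: prob_space "signed P" by (intro prob_space_signed P)
  interpret QS: product_sigma_finite "\<lambda>_. signed P" by unfold_locales
  have "(\<integral>\<^sup>+x. exp (\<Sum>i\<in>I. snd (x i) * g (fst (x i))) \<partial>(\<Pi>\<^sub>M i\<in>I. signed P))
    = (\<integral>\<^sup>+x. (\<Prod>i\<in>I. ennreal (exp (snd (x i) * g (fst (x i))))) \<partial>(\<Pi>\<^sub>M i\<in>I. signed P))"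
    using assms(2) by (simp add: exp_sum prod_ennreal)
  also have "\<dots> = (\<Prod>i\<in>I. \<integral>\<^sup>+q. exp (snd q * g (fst q)) \<partial>signed P)"
    using assms(2) by (intro QS.product_nn_integral_prod) auto
  also have "\<dots> \<le> (\<Prod>i\<in>I. ennreal (exp (C\<^sup>2 / 2)))"
    by (intro prod_mono_ennreal nn_integral_signed_exp_le P g) auto
  also have "\<dots> = ennreal (exp (card I * (C\<^sup>2 / 2)))"
    by (simp add: ennreal_power flip: exp_of_nat_mult)
  finally show ?thesis .
qed

text \<open>Duality between the l1 ball and the maximum norm, the maximum being bounded by a sum.\<close>
lemma exp_linear_l1_le:
  fixes G t :: "'j \<Rightarrow> real" and R :: real
  assumes "finite J" "J \<noteq> {}" and t: "(\<Sum>j\<in>J. \<bar>t j\<bar>) \<le> R"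
  shows "exp (\<Sum>j\<in>J. G j * t j) \<le> (\<Sum>j\<in>J. exp (R * G j) + exp (- R * G j))"
proof -
  obtain j0 where j0: "j0 \<in> J" "\<And>j. j \<in> J \<Longrightarrow> \<bar>G j\<bar> \<le> \<bar>G j0\<bar>"
    using Max_in[of "(\<lambda>j. \<bar>G j\<bar>) ` J"] Max_ge[of "(\<lambda>j. \<bar>G j\<bar>) ` J"] assms(1,2) by fastforce
  have "(\<Sum>j\<in>J. G j * t j) \<le> (\<Sum>j\<in>J. \<bar>G j0\<bar> * \<bar>t j\<bar>)"
    using j0 by (intro sum_mono) (metis abs_ge_self abs_ge_zero abs_mult mult_right_mono order_trans)
  also have "\<dots> = \<bar>G j0\<bar> * (\<Sum>j\<in>J. \<bar>t j\<bar>)" by (simp add: sum_distrib_left)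
  also have "\<dots> \<le> \<bar>G j0\<bar> * R" using t by (intro mult_left_mono) auto
  finally have "exp (\<Sum>j\<in>J. G j * t j) \<le> exp (\<bar>G j0\<bar> * R)" by simp
  also have "\<dots> \<le> exp (R * G j0) + exp (- R * G j0)"
    by (cases "0 \<le> G j0") (auto simp: mult.commute)
  also have "\<dots> \<le> (\<Sum>j\<in>J. exp (R * G j) + exp (- R * G j))"
    using j0(1) assms(1) by (intro member_le_sum) auto
  finally show ?thesis .
qed

lemma l1_ball_deviation:
  fixes g :: "'j \<Rightarrow> 'a \<Rightarrow> real" and f :: "('j \<Rightarrow> real) \<Rightarrow> 'a \<Rightarrow> real"
    and R C u :: real
  assumes P: "prob_space P" and T [simp]: "countable T" and I: "finite I" "I \<noteq> {}"
    and J: "finite J" "J \<noteq> {}"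
    and TR: "\<And>t. t \<in> T \<Longrightarrow> (\<Sum>j\<in>J. \<bar>t j\<bar>) \<le> R"
    and g [measurable]: "\<And>j. j \<in> J \<Longrightarrow> g j \<in> borel_measurable P"
    and gC: "\<And>j z. j \<in> J \<Longrightarrow> \<bar>g j z\<bar> \<le> C"
    and f: "\<And>t. t \<in> T \<Longrightarrow> integrable P (f t)"
    and c1: "\<And>t z. t \<in> T \<Longrightarrow> \<bar>f t z\<bar> \<le> \<bar>\<Sum>j\<in>J. g j z * t j\<bar>"
    and c2: "\<And>t t' z. t \<in> T \<Longrightarrow> t' \<in> T \<Longrightarrow> \<bar>f t z - f t' z\<bar> \<le> \<bar>(\<Sum>j\<in>J. g j z * t j) - (\<Sum>j\<in>J. g j z * t' j)\<bar>"
    and R: "0 < R" "0 < C" and u: "0 \<le> u"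
  shows "measure (\<Pi>\<^sub>M i\<in>I. P) {x\<in>space (\<Pi>\<^sub>M i\<in>I. P). \<exists>t\<in>T. u \<le> (\<Sum>i\<in>I. (\<integral>z. f t z \<partial>P) - f t (x i))}
     \<le> 2 * card J * exp (- u\<^sup>2 / (8 * card I * R\<^sup>2 * C\<^sup>2))" (is "measure ?PI ?E \<le> _")
proof -
  interpret P: prob_space P by fact
  interpret PI: prob_space ?PI by (intro prob_space_PiM P)
  define n where "n = real (card I)"
  have n: "n > 0" using I by (simp add: n_def card_gt_0_iff)
  \<comment> \<open>Minimizes the exponent \<open>- s * u + 2 * n * (s * R * C)^2\<close> of the
    Chernoff bound; the 2 comes from the doubling in the symmetrization.\<close>
  define s where "s = u / (4 * n * R\<^sup>2 * C\<^sup>2)"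
  have s: "0 \<le> s" using u n by (simp add: s_def)
  define a where "a t z = s * (\<Sum>j\<in>J. g j z * t j)" for t z
  have fm [measurable]: "f t \<in> borel_measurable P" if "t \<in> T" for t using f[OF that] by auto
  have am [measurable]: "a t \<in> borel_measurable P" for t
    unfolding a_def by measurable
  let ?S = "\<lambda>x. SUP t\<in>T. ennreal (exp (0 + (\<Sum>i\<in>I. (\<integral>z. s * f t z \<partial>P) - s * f t (x i))))"
  have Sm [measurable]: "?S \<in> borel_measurable ?PI" by measurable
  let ?H = "\<lambda>c j x. ennreal (exp (\<Sum>i\<in>I. snd (x i) * (c * g j (fst (x i)))))"
  have "(\<integral>\<^sup>+x. ?S x \<partial>?PI) \<le> (\<integral>\<^sup>+x. (SUP t\<in>T. ennreal (exp (0 + (\<Sum>i\<in>I. 2 * (snd (x i) * a t (fst (x i))))))) \<partial>(\<Pi>\<^sub>M i\<in>I. signed P))"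
  proof (rule symmetrization_contraction[OF P T I(1)])
    show "\<bar>s * f t z\<bar> \<le> \<bar>a t z\<bar>" if "t \<in> T" for t z
      using c1[OF that, of z] s by (simp add: a_def abs_mult mult_left_mono)
    show "\<bar>s * f t z - s * f t' z\<bar> \<le> \<bar>a t z - a t' z\<bar>" if "t \<in> T" "t' \<in> T" for t t' z
      using mult_left_mono[OF c2[OF that, of z] s] s
      by (simp add: a_def abs_mult flip: right_diff_distrib)
  qed (use f in auto)
  \<comment> \<open>All points of \<open>T\<close> share one upper bound, a sum over the vertices of
    the l1 ball. The number of vertices is the factor \<open>2 * card J\<close> of the tail.\<close>
  also have "\<dots> \<le> (\<integral>\<^sup>+x. (\<Sum>j\<in>J. ?H (2 * s * R) j x + ?H (- (2 * s * R)) j x) \<partial>(\<Pi>\<^sub>M i\<in>I. signed P))"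
  proof (intro nn_integral_mono SUP_least)
    fix x t assume t: "t \<in> T"
    have "0 + (\<Sum>i\<in>I. 2 * (snd (x i) * a t (fst (x i)))) = (\<Sum>j\<in>J. (2 * s * (\<Sum>i\<in>I. snd (x i) * g j (fst (x i)))) * t j)"
      unfolding a_def sum_distrib_left sum_distrib_right
      by (subst sum.swap) (simp add: mult_ac)
    also have "exp \<dots> \<le> (\<Sum>j\<in>J. exp (R * (2 * s * (\<Sum>i\<in>I. snd (x i) * g j (fst (x i))))) + exp (- R * (2 * s * (\<Sum>i\<in>I. snd (x i) * g j (fst (x i))))))"
      by (intro exp_linear_l1_le J TR t)
    also have "ennreal \<dots> = (\<Sum>j\<in>J. ?H (2 * s * R) j x + ?H (- (2 * s * R)) j x)"
      by (simp add: sum_ennreal[symmetric] sum_distrib_left sum_negf mult_ac add_nonneg_nonneg)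
    finally show "ennreal (exp (0 + (\<Sum>i\<in>I. 2 * (snd (x i) * a t (fst (x i)))))) \<le> (\<Sum>j\<in>J. ?H (2 * s * R) j x + ?H (- (2 * s * R)) j x)"
      by (simp add: ennreal_leI)
  qed
  also have "\<dots> = (\<Sum>j\<in>J. (\<integral>\<^sup>+x. ?H (2 * s * R) j x \<partial>(\<Pi>\<^sub>M i\<in>I. signed P)) + (\<integral>\<^sup>+x. ?H (- (2 * s * R)) j x \<partial>(\<Pi>\<^sub>M i\<in>I. signed P)))"
    by (subst nn_integral_sum) (auto intro!: sum.cong nn_integral_add)
  also have "\<dots> \<le> (\<Sum>j\<in>J. ennreal (exp (n * ((2 * s * R * C)\<^sup>2 / 2))) + ennreal (exp (n * ((2 * s * R * C)\<^sup>2 / 2))))"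
    unfolding n_def
    using gC s R by (intro sum_mono add_mono rademacher_sum_mgf P I) (auto simp: abs_mult mult_left_mono)
  also have "\<dots> = ennreal (2 * card J * exp (n * ((2 * s * R * C)\<^sup>2 / 2)))"
    by (simp add: ennreal_of_nat_eq_real_of_nat ennreal_mult'[symmetric] ennreal_plus[symmetric] del: ennreal_plus)
  finally have bnd: "(\<integral>\<^sup>+x. ?S x \<partial>?PI) \<le> ennreal (2 * card J * exp (n * ((2 * s * R * C)\<^sup>2 / 2)))" .
  have "emeasure ?PI ?E \<le> emeasure ?PI {x\<in>space ?PI. 1 \<le> ennreal (exp (- s * u)) * ?S x}"
  proof (intro emeasure_mono)
    show "?E \<subseteq> {x\<in>space ?PI. 1 \<le> ennreal (exp (- s * u)) * ?S x}"
    proof clarify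
      fix x t assume t: "t \<in> T" and le: "u \<le> (\<Sum>i\<in>I. (\<integral>z. f t z \<partial>P) - f t (x i))"
      have "1 \<le> exp (- s * u) * exp (s * (\<Sum>i\<in>I. (\<integral>z. f t z \<partial>P) - f t (x i)))"
        using mult_left_mono[OF le s] by (simp flip: exp_add)
      then have "1 \<le> ennreal (exp (- s * u)) * ennreal (exp (0 + (\<Sum>i\<in>I. (\<integral>z. s * f t z \<partial>P) - s * f t (x i))))"
        by (simp add: sum_distrib_left right_diff_distrib flip: ennreal_mult')
      also have "\<dots> \<le> ennreal (exp (- s * u)) * ?S x"
        using t by (intro mult_left_mono SUP_upper) auto
      finally show "1 \<le> ennreal (exp (- s * u)) * ?S x" .
    qed
  qed measurable
  also have "\<dots> \<le> ennreal (exp (- s * u)) * (\<integral>\<^sup>+x. ?S x * indicator (space ?PI) x \<partial>?PI)"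
    by (rule nn_integral_Markov_inequality) auto
  also have "(\<integral>\<^sup>+x. ?S x * indicator (space ?PI) x \<partial>?PI) = (\<integral>\<^sup>+x. ?S x \<partial>?PI)"
    by (intro nn_integral_cong) simp
  also have "ennreal (exp (- s * u)) * \<dots> \<le> ennreal (exp (- s * u)) * ennreal (2 * card J * exp (n * ((2 * s * R * C)\<^sup>2 / 2)))"
    by (intro mult_left_mono bnd) auto
  also have "\<dots> = ennreal (2 * card J * exp (- s * u + n * ((2 * s * R * C)\<^sup>2 / 2)))"
    by (simp add: ennreal_mult'[symmetric] mult_ac flip: exp_add)
  also have "- s * u + n * ((2 * s * R * C)\<^sup>2 / 2) = - u\<^sup>2 / (8 * card I * R\<^sup>2 * C\<^sup>2)"
    using n R by (simp add: s_def n_def[symmetric] field_simps power2_eq_square)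
  finally show ?thesis by (simp add: PI.emeasure_eq_measure)
qed

section \<open>Expected loss under a conditional density\<close>

text \<open>The nonnegative integral is a supremum over simple functions from below, so this
  inequality survives for arbitrary \<open>h\<close>. It is applied with \<open>h\<close> built from
  the conditional density.\<close>

lemma nn_integral_superadditive:
  assumes g: "g \<in> borel_measurable M"
  shows "(\<integral>\<^sup>+x. h x \<partial>M) + (\<integral>\<^sup>+x. g x \<partial>M) \<le> (\<integral>\<^sup>+x. h x + g x \<partial>M)"
proof -
  let ?S = "{\<phi>. simple_function M \<phi> \<and> \<phi> \<le> h}"
  have ne: "?S \<noteq> {}" by (auto intro!: exI[of _ "\<lambda>_. 0"] simp: le_fun_def)
  have "(\<integral>\<^sup>+x. h x \<partial>M) + (\<integral>\<^sup>+x. g x \<partial>M)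
      = (SUP \<phi>\<in>?S. integral\<^sup>S M \<phi> + (\<integral>\<^sup>+x. g x \<partial>M))"
    unfolding nn_integral_def[of M h] by (simp only: ennreal_SUP_add_left[OF ne])
  also have "\<dots> \<le> (\<integral>\<^sup>+x. h x + g x \<partial>M)"
  proof (rule SUP_least)
    fix \<phi> assume \<phi>: "\<phi> \<in> ?S"
    then have "integral\<^sup>S M \<phi> + (\<integral>\<^sup>+x. g x \<partial>M) = (\<integral>\<^sup>+x. \<phi> x + g x \<partial>M)"
      using g by (subst nn_integral_add) (auto simp: nn_integral_eq_simple_integral borel_measurable_simple_function)
    also have "\<dots> \<le> (\<integral>\<^sup>+x. h x + g x \<partial>M)"
      using \<phi> by (intro nn_integral_mono add_right_mono) (auto simp: le_fun_def)
    finally show "integral\<^sup>S M \<phi> + (\<integral>\<^sup>+x. g x \<partial>M) \<le> (\<integral>\<^sup>+x. h x + g x \<partial>M)" .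
  qed
  finally show ?thesis .
qed

text \<open>Dropping the negative part only increases the value, and a non-integrable
  \<open>g\<close> has Bochner integral 0.\<close>

lemma ennreal_integral_le_nn_integral:
  fixes g :: "'a \<Rightarrow> real"
  shows "ennreal (\<integral>x. g x \<partial>M) \<le> (\<integral>\<^sup>+x. g x \<partial>M)"
proof (cases "integrable M g")
  case True
  then have "(\<integral>\<^sup>+x. g x \<partial>M) < \<infinity>"
    using real_integrable_def by (auto simp: less_top)
  moreover have "(\<integral>x. g x \<partial>M) \<le> enn2real (\<integral>\<^sup>+x. g x \<partial>M)"
    using True by (subst real_lebesgue_integral_def) auto
  ultimately show ?thesis
    by (metis ennreal_enn2real ennreal_leI infinity_ennreal_def)
qed (simp add: not_integrable_integral_eq)

lemma snd_in_space:
  assumes sets: "sets P = sets (M \<Otimes>\<^sub>M N)" and z: "z \<in> space P"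
  shows "snd z \<in> space N"
proof -
  have "snd \<in> P \<rightarrow>\<^sub>M N" by (subst measurable_cong_sets[OF sets refl]) (rule measurable_snd)
  then show ?thesis using z by (rule measurable_space)
qed

text \<open>The conditional density is not assumed to be jointly measurable, so all bounds go through a
  measurable minorant \<open>m\<close> of it.\<close>
locale conditional_minorant = prob_space P
  for P :: "(real \<times> 'x) measure" +
  fixes N :: "'x measure" and f m :: "'x \<Rightarrow> real \<Rightarrow> ennreal"
  assumes sets_P [measurable_cong]: "sets P = sets (borel \<Otimes>\<^sub>M N)"
    and cdf: "\<And>C t. C \<in> sets N \<Longrightarrow> emeasure P {z\<in>space P. fst z \<le> t \<and> snd z \<in> C}
        = (\<integral>\<^sup>+z. indicator C (snd z) * (\<integral>\<^sup>+s. indicator {..t} s * f (snd z) s \<partial>lborel) \<partial>P)"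
    and m_measurable [measurable]: "(\<lambda>(x, s). m x s) \<in> borel_measurable (N \<Otimes>\<^sub>M borel)"
    and m_finite: "\<And>x s. m x s < \<infinity>"
    and m_le: "AE z in P. f (snd z) \<in> borel_measurable borel \<and> (\<forall>s. m (snd z) s \<le> f (snd z) s)"
begin

lemmas snd_space = snd_in_space[OF sets_P]

text \<open>Subtracting the formula \<open>cdf\<close> at \<open>t1\<close> from that at
  \<open>t2\<close> would require additivity of integrals involving \<open>f\<close>. Instead, the
  integral of the minorant over the cell is added to the formula at \<open>t1\<close>, where
  superadditivity is enough, and the finite probability is cancelled at the end.\<close>

lemma cell_set_bound:
  assumes t: "t1 \<le> t2" and C [measurable]: "C \<in> sets N"
  shows "(\<integral>\<^sup>+z. indicator C (snd z) * (\<integral>\<^sup>+s. indicator {t1<..t2} s * m (snd z) s \<partial>lborel) \<partial>P)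
    \<le> (\<integral>\<^sup>+z. indicator C (snd z) * indicator {t1<..t2} (fst z) \<partial>P)"
proof -
  let ?G = "\<lambda>t z. indicator C (snd z) * (\<integral>\<^sup>+s. indicator {..t} s * f (snd z) s \<partial>lborel)"
  let ?H = "\<lambda>z. indicator C (snd z) * (\<integral>\<^sup>+s. indicator {t1<..t2} s * m (snd z) s \<partial>lborel)"
  let ?F = "\<lambda>t. emeasure P {z\<in>space P. fst z \<le> t \<and> snd z \<in> C}"
  have [measurable]: "?H \<in> borel_measurable P" by measurable
  have "?F t1 + (\<integral>\<^sup>+z. ?H z \<partial>P) \<le> (\<integral>\<^sup>+z. ?G t1 z + ?H z \<partial>P)"
    unfolding cdf[OF C] by (intro nn_integral_superadditive) measurable
  also have "\<dots> \<le> (\<integral>\<^sup>+z. ?G t2 z \<partial>P)"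
  proof (intro nn_integral_mono_AE, use m_le in eventually_elim)
    case (elim z)
    have [measurable]: "f (snd z) \<in> borel_measurable borel" using elim by blast
    have "(\<integral>\<^sup>+s. indicator {..t1} s * f (snd z) s \<partial>lborel) + (\<integral>\<^sup>+s. indicator {t1<..t2} s * m (snd z) s \<partial>lborel)
        \<le> (\<integral>\<^sup>+s. indicator {..t1} s * f (snd z) s \<partial>lborel) + (\<integral>\<^sup>+s. indicator {t1<..t2} s * f (snd z) s \<partial>lborel)"
      using elim by (intro add_left_mono nn_integral_mono mult_left_mono) auto
    also have "\<dots> = (\<integral>\<^sup>+s. indicator {..t1} s * f (snd z) s + indicator {t1<..t2} s * f (snd z) s \<partial>lborel)"
      by (subst nn_integral_add) auto
    also have "\<dots> = (\<integral>\<^sup>+s. indicator {..t2} s * f (snd z) s \<partial>lborel)"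
      using t by (intro nn_integral_cong) (auto simp: indicator_def)
    finally show ?case by (auto simp: indicator_def)
  qed
  also have "\<dots> = ?F t2" by (rule cdf[OF C, symmetric])
  also have "\<dots> = ?F t1 + emeasure P {z\<in>space P. t1 < fst z \<and> fst z \<le> t2 \<and> snd z \<in> C}"
    using t by (subst plus_emeasure) (auto intro!: arg_cong[where f = "emeasure P"])
  finally have "(\<integral>\<^sup>+z. ?H z \<partial>P) \<le> emeasure P {z\<in>space P. t1 < fst z \<and> fst z \<le> t2 \<and> snd z \<in> C}"
    by (simp add: ennreal_add_left_cancel_le)
  also have "\<dots> = (\<integral>\<^sup>+z. indicator {z\<in>space P. t1 < fst z \<and> fst z \<le> t2 \<and> snd z \<in> C} z \<partial>P)"
    by (intro nn_integral_indicator[symmetric]) measurable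
  also have "\<dots> = (\<integral>\<^sup>+z. indicator C (snd z) * indicator {t1<..t2} (fst z) \<partial>P)"
    by (intro nn_integral_cong) (auto simp: indicator_def)
  finally show ?thesis .
qed

lemma cell_bound:
  assumes t: "t1 \<le> t2" and v: "v \<in> borel_measurable N"
  shows "(\<integral>\<^sup>+z. v (snd z) * (\<integral>\<^sup>+s. indicator {t1<..t2} s * m (snd z) s \<partial>lborel) \<partial>P)
    \<le> (\<integral>\<^sup>+z. v (snd z) * indicator {t1<..t2} (fst z) \<partial>P)"
  using v
proof (induction v rule: borel_measurable_induct)
  case (cong f g)
  have "snd z \<in> space N" if "z \<in> space P" for z
    by (rule snd_space) fact
  then have "(\<integral>\<^sup>+z. f (snd z) * h z \<partial>P) = (\<integral>\<^sup>+z. g (snd z) * h z \<partial>P)" for h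
    using cong.hyps(3) by (intro nn_integral_cong) simp
  then show ?case using cong.IH by simp
next
  case (set A)
  then show ?case by (intro cell_set_bound t)
next
  case (mult u c)
  note [measurable] = mult.hyps(2)
  have "(\<integral>\<^sup>+z. c * u (snd z) * g z \<partial>P) = c * (\<integral>\<^sup>+z. u (snd z) * g z \<partial>P)"
    if [measurable]: "g \<in> borel_measurable P" for g
    by (simp only: mult.assoc) (rule nn_integral_cmult, measurable)
  then show ?case using mult.IH by (simp add: mult_left_mono)
next
  case (add u v)
  note [measurable] = add.hyps(1,3)
  have "(\<integral>\<^sup>+z. (v (snd z) + u (snd z)) * g z \<partial>P) = (\<integral>\<^sup>+z. v (snd z) * g z \<partial>P) + (\<integral>\<^sup>+z. u (snd z) * g z \<partial>P)"
    if [measurable]: "g \<in> borel_measurable P" for g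
    by (simp only: distrib_right) (rule nn_integral_add; measurable)
  then show ?case using add.IH by (simp add: add_mono)
next
  case (seq U)
  note [measurable] = seq.hyps(1)
  have inc: "incseq (\<lambda>i z. U i (snd z) * g z)" for g :: "real \<times> 'x \<Rightarrow> ennreal"
    using seq.hyps(3) by (auto simp: incseq_def le_fun_def intro!: mult_right_mono)
  have "(\<integral>\<^sup>+z. (SUP i. U i) (snd z) * g z \<partial>P) = (SUP i. \<integral>\<^sup>+z. U i (snd z) * g z \<partial>P)"
    if [measurable]: "g \<in> borel_measurable P" for g
  proof -
    have "(SUP i. U i) (snd z) * g z = (SUP i. U i (snd z) * g z)" for z
      by (simp add: SUP_apply image_comp SUP_mult_right_ennreal)
    then show ?thesis
      by (simp only:) (rule nn_integral_monotone_convergence_SUP[OF inc], measurable)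
  qed
  with seq.IH show ?case by (auto intro!: SUP_mono)
qed

end

section \<open>Approximation by functions constant on grid cells\<close>

text \<open>Rounding up keeps grid points to the right, so right continuity suffices in the limit.\<close>
definition grid_ceil :: "nat \<Rightarrow> real \<Rightarrow> real" where
  "grid_ceil n s = of_int \<lceil>s * real (Suc n)\<rceil> / real (Suc n)"

lemma grid_ceil_measurable [measurable]: "grid_ceil n \<in> borel_measurable borel"
  unfolding grid_ceil_def by measurable

lemma grid_ceil_ge: "s \<le> grid_ceil n s"
  unfolding grid_ceil_def by (simp add: pos_le_divide_eq le_of_int_ceiling)

lemma grid_ceil_le: "grid_ceil n s \<le> s + 1 / Suc n"
proof -
  have "real_of_int \<lceil>s * Suc n\<rceil> \<le> s * Suc n + 1" by (rule of_int_ceiling_le_add_one)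
  then have "grid_ceil n s \<le> (s * Suc n + 1) / Suc n"
    unfolding grid_ceil_def by (intro divide_right_mono) auto
  then show ?thesis by (simp add: add_divide_distrib)
qed

lemma grid_ceil_tendsto: "(\<lambda>n. grid_ceil n s) \<longlonglongrightarrow> s"
proof (rule tendsto_sandwich[of "\<lambda>_. s" "\<lambda>n. grid_ceil n s" _ "\<lambda>n. s + 1 / Suc n"])
  show "(\<lambda>n. s + 1 / Suc n) \<longlonglongrightarrow> s"
    using tendsto_add[OF tendsto_const LIMSEQ_inverse_real_of_nat, of s] by (simp add: inverse_eq_divide)
qed (auto simp: grid_ceil_ge grid_ceil_le[unfolded of_nat_Suc] intro!: always_eventually)

text \<open>The half-open cells partition the line, so exactly one summand survives. Enumerating
  them by \<open>int_decode\<close> gives a series over the naturals, which can be exchanged with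
  integrals.\<close>

lemma grid_ceil_expand:
  fixes g :: "real \<Rightarrow> ennreal"
  defines "c \<equiv> \<lambda>n i. real_of_int (int_decode i) / Suc n"
  shows "g (grid_ceil n s) = (\<Sum>i. g (c n i) * indicator {c n i - 1 / Suc n <.. c n i} s)"
proof -
  let ?i = "int_encode \<lceil>s * Suc n\<rceil>"
  have *: "s \<in> {c n i - 1 / Suc n <.. c n i} \<longleftrightarrow> i = ?i" for i
  proof -
    have "s \<in> {c n i - 1 / Suc n <.. c n i} \<longleftrightarrow> s * Suc n \<in> {of_int (int_decode i) - 1 <.. of_int (int_decode i)}"
    proof -
      have "c n i - 1 / Suc n = (of_int (int_decode i) - 1) / Suc n"
        by (simp add: c_def diff_divide_distrib)
      then show ?thesis
        by (simp add: c_def pos_divide_less_eq pos_le_divide_eq)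
    qed
    also have "\<dots> \<longleftrightarrow> \<lceil>s * Suc n\<rceil> = int_decode i"
      by (auto simp: ceiling_eq_iff)
    also have "\<dots> \<longleftrightarrow> i = ?i" by (metis int_decode_inverse int_encode_inverse)
    finally show ?thesis .
  qed
  have "(\<Sum>i. g (c n i) * indicator {c n i - 1 / Suc n <.. c n i} s)
      = (\<Sum>i\<in>{?i}. g (c n i) * indicator {c n i - 1 / Suc n <.. c n i} s)"
    using * by (intro suminf_finite) (auto simp: indicator_def)
  also have "\<dots> = g (c n ?i)" using *[of ?i] by (simp add: indicator_def)
  finally show ?thesis by (simp add: c_def grid_ceil_def)
qed

context conditional_minorant
begin

lemma grid_bound:
  assumes w [measurable]: "(\<lambda>(s, x). w s x) \<in> borel_measurable (borel \<Otimes>\<^sub>M N)"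
  shows "(\<integral>\<^sup>+z. \<integral>\<^sup>+s. w (grid_ceil n s) (snd z) * m (snd z) s \<partial>lborel \<partial>P)
     \<le> (\<integral>\<^sup>+z. w (grid_ceil n (fst z)) (snd z) \<partial>P)"
proof -
  define c where "c i = real_of_int (int_decode i) / Suc n" for i
  define I where "I i = {c i - 1 / Suc n <.. c i}" for i
  have [measurable]: "I i \<in> sets borel" for i by (simp add: I_def)
  have expand: "g (grid_ceil n s) = (\<Sum>i. g (c i) * indicator (I i) s)" for g :: "real \<Rightarrow> ennreal" and s
    unfolding c_def I_def by (rule grid_ceil_expand)
  have wc [measurable]: "w (c i) \<in> borel_measurable N" for i
    using measurable_compose[OF measurable_Pair1' w, of "c i"] by simp
  have sp: "snd z \<in> space N" if "z \<in> space P" for z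
    by (rule snd_space) fact
  have "(\<integral>\<^sup>+z. \<integral>\<^sup>+s. w (grid_ceil n s) (snd z) * m (snd z) s \<partial>lborel \<partial>P)
     = (\<integral>\<^sup>+z. (\<Sum>i. w (c i) (snd z) * (\<integral>\<^sup>+s. indicator (I i) s * m (snd z) s \<partial>lborel)) \<partial>P)"
  proof (intro nn_integral_cong)
    fix z assume "z \<in> space P"
    then have [measurable]: "snd z \<in> space N" by (rule sp)
    have "(\<integral>\<^sup>+s. w (grid_ceil n s) (snd z) * m (snd z) s \<partial>lborel)
       = (\<integral>\<^sup>+s. (\<Sum>i. w (c i) (snd z) * (indicator (I i) s * m (snd z) s)) \<partial>lborel)"
      by (subst expand[of "\<lambda>y. w y (snd z)"]) (simp add: mult.assoc flip: ennreal_suminf_multc)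
    also have "\<dots> = (\<Sum>i. w (c i) (snd z) * (\<integral>\<^sup>+s. indicator (I i) s * m (snd z) s \<partial>lborel))"
      by (subst nn_integral_suminf) (simp_all add: nn_integral_cmult)
    finally show "(\<integral>\<^sup>+s. w (grid_ceil n s) (snd z) * m (snd z) s \<partial>lborel)
       = (\<Sum>i. w (c i) (snd z) * (\<integral>\<^sup>+s. indicator (I i) s * m (snd z) s \<partial>lborel))" .
  qed
  also have "\<dots> = (\<Sum>i. \<integral>\<^sup>+z. w (c i) (snd z) * (\<integral>\<^sup>+s. indicator (I i) s * m (snd z) s \<partial>lborel) \<partial>P)"
    by (subst nn_integral_suminf) simp_all
  also have "\<dots> \<le> (\<Sum>i. \<integral>\<^sup>+z. w (c i) (snd z) * indicator (I i) (fst z) \<partial>P)"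
    unfolding I_def by (intro suminf_le cell_bound wc) auto
  also have "\<dots> = (\<integral>\<^sup>+z. (\<Sum>i. w (c i) (snd z) * indicator (I i) (fst z)) \<partial>P)"
    by (subst nn_integral_suminf) simp_all
  also have "\<dots> = (\<integral>\<^sup>+z. w (grid_ceil n (fst z)) (snd z) \<partial>P)"
    by (intro nn_integral_cong) (simp add: expand[of "\<lambda>y. w y _"])
  finally show ?thesis .
qed

text \<open>Passes to the limit in \<open>grid_bound\<close>: by Fatou on the left, first in
  \<open>s\<close> and then in \<open>z\<close>, and by dominated convergence with the constant
  \<open>b\<close> on the right.\<close>

lemma right_continuous_bound:
  fixes w :: "real \<Rightarrow> 'x \<Rightarrow> real"
  assumes [measurable]: "(\<lambda>(s, x). w s x) \<in> borel_measurable (borel \<Otimes>\<^sub>M N)"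
    and w0: "\<And>s x. 0 \<le> w s x" and wb: "\<And>s x. w s x \<le> b"
    and rc: "\<And>s x. (\<lambda>n. w (grid_ceil n s) x) \<longlonglongrightarrow> w s x"
  shows "(\<integral>\<^sup>+z. \<integral>\<^sup>+s. w s (snd z) * m (snd z) s \<partial>lborel \<partial>P) \<le> (\<integral>\<^sup>+z. w (fst z) (snd z) \<partial>P)"
proof -
  let ?wg = "\<lambda>n s x. ennreal (w (grid_ceil n s) x)"
  have lim: "liminf (\<lambda>n. ?wg n s x * m x s) = ennreal (w s x) * m x s" for s x
  proof (intro lim_imp_Liminf)
    show "(\<lambda>n. ?wg n s x * m x s) \<longlonglongrightarrow> ennreal (w s x) * m x s"
      using m_finite[of x s] by (intro tendsto_mult_ennreal tendsto_const tendsto_ennrealI rc) auto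
  qed simp
  have sp: "snd z \<in> space N" if "z \<in> space P" for z
    by (rule snd_space) fact
  have "(\<integral>\<^sup>+z. \<integral>\<^sup>+s. w s (snd z) * m (snd z) s \<partial>lborel \<partial>P)
      \<le> (\<integral>\<^sup>+z. liminf (\<lambda>n. \<integral>\<^sup>+s. ?wg n s (snd z) * m (snd z) s \<partial>lborel) \<partial>P)"
  proof (intro nn_integral_mono)
    fix z assume "z \<in> space P"
    then have [measurable]: "snd z \<in> space N" by (rule sp)
    have "(\<integral>\<^sup>+s. w s (snd z) * m (snd z) s \<partial>lborel) = (\<integral>\<^sup>+s. liminf (\<lambda>n. ?wg n s (snd z) * m (snd z) s) \<partial>lborel)"
      by (simp only: lim)
    also have "\<dots> \<le> liminf (\<lambda>n. \<integral>\<^sup>+s. ?wg n s (snd z) * m (snd z) s \<partial>lborel)"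
      by (rule nn_integral_liminf) measurable
    finally show "(\<integral>\<^sup>+s. w s (snd z) * m (snd z) s \<partial>lborel) \<le> liminf (\<lambda>n. \<integral>\<^sup>+s. ?wg n s (snd z) * m (snd z) s \<partial>lborel)" .
  qed
  also have "\<dots> \<le> liminf (\<lambda>n. \<integral>\<^sup>+z. \<integral>\<^sup>+s. ?wg n s (snd z) * m (snd z) s \<partial>lborel \<partial>P)"
    by (rule nn_integral_liminf) measurable
  also have "\<dots> \<le> liminf (\<lambda>n. \<integral>\<^sup>+z. ?wg n (fst z) (snd z) \<partial>P)"
    by (intro Liminf_mono always_eventually allI grid_bound) measurable
  also have "\<dots> = (\<integral>\<^sup>+z. w (fst z) (snd z) \<partial>P)"
  proof (intro lim_imp_Liminf nn_integral_dominated_convergence[where w = "\<lambda>_. ennreal b"])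
    show "AE z in P. (\<lambda>n. ?wg n (fst z) (snd z)) \<longlonglongrightarrow> ennreal (w (fst z) (snd z))"
      by (intro AE_I2 tendsto_ennrealI rc)
    show "AE z in P. ?wg n (fst z) (snd z) \<le> ennreal b" for n
      by (intro AE_I2 ennreal_leI wb)
    show "(\<integral>\<^sup>+z. ennreal b \<partial>P) < \<infinity>" by (simp add: emeasure_space_1)
  qed (simp, measurable)
  finally show ?thesis .
qed

end


section \<open>Knight's remainder and its conditional mean\<close>

text \<open>The remainder in Knight's identity, \<open>W(u, a) = \<integral>\<^sub>0\<^sup>a (1{u < s} - 1{u < 0}) ds\<close>.\<close>
definition knight_rem :: "real \<Rightarrow> real \<Rightarrow> real" where
  "knight_rem u a = (if 0 < a then (if 0 \<le> u then max 0 (a - u) else 0)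
                     else (if u < 0 then max 0 (u - a) else 0))"

lemma knight_rem_measurable [measurable]:
  "(\<lambda>(u, a). knight_rem u a) \<in> borel_measurable (borel \<Otimes>\<^sub>M borel)"
  unfolding knight_rem_def by measurable

lemma knight_rem_nonneg: "0 \<le> knight_rem u a"
  by (simp add: knight_rem_def)

lemma knight_rem_le: "knight_rem u a \<le> \<bar>a\<bar>"
  by (simp add: knight_rem_def)

text \<open>In its first argument the remainder may jump at 0 but is continuous from the right,
  hence the approach from above.\<close>

lemma knight_rem_tendsto:
  assumes u: "u \<longlonglongrightarrow> l" and ge: "\<And>n. l \<le> u n"
  shows "(\<lambda>n. knight_rem (u n) a) \<longlonglongrightarrow> knight_rem l a"
proof (cases "0 \<le> l")
  case True
  then have "0 \<le> u n" for n using ge[of n] by linarith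
  then show ?thesis
    using True by (auto simp: knight_rem_def not_less[symmetric] intro!: tendsto_intros u)
next
  case False
  then have "eventually (\<lambda>n. u n < 0) sequentially"
    using u by (intro order_tendstoD(2)) auto
  then have "eventually (\<lambda>n. knight_rem (u n) a = (if 0 < a then 0 else max 0 (u n - a))) sequentially"
    by eventually_elim (simp add: knight_rem_def)
  moreover have "(\<lambda>n. if 0 < a then 0 else max 0 (u n - a)) \<longlonglongrightarrow> (if 0 < a then 0 else max 0 (l - a))"
    by (auto intro!: tendsto_intros u)
  ultimately have "(\<lambda>n. knight_rem (u n) a) \<longlonglongrightarrow> (if 0 < a then 0 else max 0 (l - a))"
    by (simp only: tendsto_cong)
  moreover have "knight_rem l a = (if 0 < a then 0 else max 0 (l - a))"
    using False by (simp add: knight_rem_def)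
  ultimately show ?thesis by simp
qed

text \<open>For positive \<open>a\<close> the left side is the integral of
  \<open>(a - t) * (c1 - c2 * t)\<close> over \<open>t\<close> in [0, a]; negative \<open>a\<close>
  is symmetric. Where the tent is negative, \<open>ennreal\<close> replaces it by 0, which only
  raises the right side.\<close>

lemma knight_rem_density_bound:
  fixes c1 c2 q a :: real
  shows "ennreal (c1 * a\<^sup>2 / 2 - c2 * \<bar>a\<bar>^3 / 6)
    \<le> (\<integral>\<^sup>+s. ennreal (knight_rem (s - q) a) * ennreal (c1 - c2 * \<bar>s - q\<bar>) \<partial>lborel)"
proof (cases "0 < a")
  case True
  let ?g = "\<lambda>s. (a - (s - q)) * (c1 - c2 * (s - q))"
  let ?F = "\<lambda>s. c1 * (a * (s - q) - (s - q)\<^sup>2 / 2) - c2 * (a * (s - q)\<^sup>2 / 2 - (s - q)^3 / 3)"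
  have "(\<integral>s. ?g s * indicator {q..q + a} s \<partial>lborel) = ?F (q + a) - ?F q"
    using True by (intro integral_FTC_Icc_real)
      (auto intro!: derivative_eq_intros continuous_intros simp: power2_eq_square field_simps)
  also have "\<dots> = c1 * a\<^sup>2 / 2 - c2 * \<bar>a\<bar>^3 / 6"
    using True by (simp add: power2_eq_square power3_eq_cube field_simps)
  finally have "ennreal (c1 * a\<^sup>2 / 2 - c2 * \<bar>a\<bar>^3 / 6) \<le> (\<integral>\<^sup>+s. ennreal (?g s * indicator {q..q + a} s) \<partial>lborel)"
    using ennreal_integral_le_nn_integral[of lborel "\<lambda>s. ?g s * indicator {q..q + a} s"] by simp
  also have "\<dots> \<le> (\<integral>\<^sup>+s. ennreal (knight_rem (s - q) a) * ennreal (c1 - c2 * \<bar>s - q\<bar>) \<partial>lborel)"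
    using True
    by (intro nn_integral_mono) (auto simp: knight_rem_def indicator_def simp flip: ennreal_mult')
  finally show ?thesis .
next
  case False
  let ?g = "\<lambda>s. ((s - q) - a) * (c1 - c2 * (q - s))"
  let ?F = "\<lambda>s. c1 * ((s - q)\<^sup>2 / 2 - a * (s - q)) + c2 * ((s - q)^3 / 3 - a * (s - q)\<^sup>2 / 2)"
  have "(\<integral>s. ?g s * indicator {q + a..q} s \<partial>lborel) = ?F q - ?F (q + a)"
    using False by (intro integral_FTC_Icc_real)
      (auto intro!: derivative_eq_intros continuous_intros simp: power2_eq_square field_simps)
  also have "\<dots> = c1 * a\<^sup>2 / 2 - c2 * \<bar>a\<bar>^3 / 6"
    using False by (simp add: power2_eq_square power3_eq_cube field_simps)
  finally have "ennreal (c1 * a\<^sup>2 / 2 - c2 * \<bar>a\<bar>^3 / 6) \<le> (\<integral>\<^sup>+s. ennreal (?g s * indicator {q + a..q} s) \<partial>lborel)"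
    using ennreal_integral_le_nn_integral[of lborel "\<lambda>s. ?g s * indicator {q + a..q} s"] by simp
  \<comment> \<open>For \<open>a \<le> 0\<close> the remainder is 0 at \<open>s = q\<close>, where
    \<open>?g\<close> may be positive; this single point is removed.\<close>
  also have "\<dots> = (\<integral>\<^sup>+s. ennreal (?g s * indicator {q + a..<q} s) \<partial>lborel)"
    by (intro nn_integral_cong_AE, use AE_lborel_singleton[of q] in eventually_elim)
      (auto simp: indicator_def)
  also have "\<dots> \<le> (\<integral>\<^sup>+s. ennreal (knight_rem (s - q) a) * ennreal (c1 - c2 * \<bar>s - q\<bar>) \<partial>lborel)"
    using False
    by (intro nn_integral_mono) (auto simp: knight_rem_def indicator_def simp flip: ennreal_mult')
  finally show ?thesis .
qed

lemma density_ge_tent: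
  fixes f f' :: "real \<Rightarrow> real"
  assumes d: "\<And>t. (f has_real_derivative f' t) (at t)" and b: "\<And>t. \<bar>f' t\<bar> \<le> c2"
    and q: "c1 \<le> f q"
  shows "c1 - c2 * \<bar>s - q\<bar> \<le> f s"
proof -
  have "norm (f s - f q) \<le> c2 * norm (s - q)"
    using d b by (intro field_differentiable_bound[of UNIV f f'])
      (auto intro: has_field_derivative_at_within)
  with q show ?thesis by (simp add: abs_le_iff)
qed

text \<open>\<open>q\<close> is the conditional quantile and \<open>a\<close> a perturbation of it.\<close>
lemma expected_knight_rem_ge:
  fixes P :: "(real \<times> 'x) measure" and f f' :: "'x \<Rightarrow> real \<Rightarrow> real"
  assumes P: "prob_space P" and sets: "sets P = sets (borel \<Otimes>\<^sub>M N)"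
    and cdf: "\<And>C t. C \<in> sets N \<Longrightarrow> emeasure P {z\<in>space P. fst z \<le> t \<and> snd z \<in> C}
        = (\<integral>\<^sup>+z. indicator C (snd z) * (\<integral>\<^sup>+s. indicator {..t} s * ennreal (f (snd z) s) \<partial>lborel) \<partial>P)"
    and d: "AE z in P. \<forall>t. (f (snd z) has_real_derivative f' (snd z) t) (at t) \<and> \<bar>f' (snd z) t\<bar> \<le> c2"
    and fq: "AE z in P. c1 \<le> f (snd z) (q (snd z))"
    and q [measurable]: "q \<in> borel_measurable N" and a [measurable]: "a \<in> borel_measurable N"
    and ab: "\<And>x. \<bar>a x\<bar> \<le> b"
  shows "(\<integral>z. c1 * (a (snd z))\<^sup>2 / 2 - c2 * \<bar>a (snd z)\<bar>^3 / 6 \<partial>P)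
     \<le> (\<integral>z. knight_rem (fst z - q (snd z)) (a (snd z)) \<partial>P)"
proof -
  interpret prob_space P by fact
  note [measurable_cong] = sets
  \<comment> \<open>The tent around the quantile lies below the density by the mean value theorem,
    and it is jointly measurable because \<open>q\<close> is measurable.\<close>
  interpret conditional_minorant P N "\<lambda>x s. ennreal (f x s)" "\<lambda>x s. ennreal (c1 - c2 * \<bar>s - q x\<bar>)"
  proof (unfold_locales, fact sets, fact cdf)
    show "(\<lambda>(x, s). ennreal (c1 - c2 * \<bar>s - q x\<bar>)) \<in> borel_measurable (N \<Otimes>\<^sub>M borel)" by measurable
    show "AE z in P. (\<lambda>s. ennreal (f (snd z) s)) \<in> borel_measurable borel
        \<and> (\<forall>s. ennreal (c1 - c2 * \<bar>s - q (snd z)\<bar>) \<le> ennreal (f (snd z) s))"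
      using d fq
    proof eventually_elim
      case (elim z)
      have "continuous_on UNIV (f (snd z))"
        using elim(1) by (auto intro!: continuous_at_imp_continuous_on DERIV_isCont)
      then have "f (snd z) \<in> borel_measurable borel" by (rule borel_measurable_continuous_onI)
      moreover have "c1 - c2 * \<bar>s - q (snd z)\<bar> \<le> f (snd z) s" for s
        using elim by (intro density_ge_tent[of "f (snd z)" "f' (snd z)"]) auto
      ultimately show ?case by (auto intro: ennreal_leI)
    qed
  qed simp
  let ?W = "\<lambda>z. knight_rem (fst z - q (snd z)) (a (snd z))"
  let ?g = "\<lambda>z. c1 * (a (snd z))\<^sup>2 / 2 - c2 * \<bar>a (snd z)\<bar>^3 / 6"
  have "ennreal (\<integral>z. ?g z \<partial>P) \<le> (\<integral>\<^sup>+z. ?g z \<partial>P)"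
    by (rule ennreal_integral_le_nn_integral)
  also have "\<dots> \<le> (\<integral>\<^sup>+z. \<integral>\<^sup>+s. ennreal (knight_rem (s - q (snd z)) (a (snd z))) * ennreal (c1 - c2 * \<bar>s - q (snd z)\<bar>) \<partial>lborel \<partial>P)"
    by (intro nn_integral_mono knight_rem_density_bound)
  also have "\<dots> \<le> (\<integral>\<^sup>+z. ?W z \<partial>P)"
  proof (rule right_continuous_bound[where b = b])
    show "knight_rem (s - q x) (a x) \<le> b" for s x
      using knight_rem_le[of "s - q x" "a x"] ab[of x] by linarith
    show "(\<lambda>n. knight_rem (grid_ceil n s - q x) (a x)) \<longlonglongrightarrow> knight_rem (s - q x) (a x)" for s x
      by (intro knight_rem_tendsto tendsto_diff grid_ceil_tendsto tendsto_const) (simp add: grid_ceil_ge)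
  qed (measurable, simp add: knight_rem_nonneg)
  also have "\<dots> = ennreal (\<integral>z. ?W z \<partial>P)"
  proof (intro nn_integral_eq_integral integrable_const_bound[where B = b] AE_I2)
    show "norm (?W z) \<le> b" for z
      using knight_rem_le[of "fst z - q (snd z)" "a (snd z)"] ab[of "snd z"] knight_rem_nonneg
      by (simp add: order_trans)
  qed (measurable, simp add: knight_rem_nonneg)
  finally show ?thesis
    by (subst (asm) ennreal_le_iff) (auto intro!: integral_nonneg_AE knight_rem_nonneg)
qed

section \<open>Weights against the conditional quantile probability\<close>

lemma nn_integral_conditional_prob:
  fixes P :: "(real \<times> 'x) measure" and v :: "'x \<Rightarrow> ennreal"
  assumes P: "prob_space P" and sets [measurable_cong]: "sets P = sets (borel \<Otimes>\<^sub>M N)"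
    and A [measurable]: "Measurable.pred P A" and \<tau>: "0 \<le> \<tau>"
    and cond: "\<And>C. C \<in> sets N \<Longrightarrow> measure P {z\<in>space P. A z \<and> snd z \<in> C} = \<tau> * measure P {z\<in>space P. snd z \<in> C}"
    and v: "v \<in> borel_measurable N"
  shows "(\<integral>\<^sup>+z. v (snd z) * indicator (Collect A) z \<partial>P) = ennreal \<tau> * (\<integral>\<^sup>+z. v (snd z) \<partial>P)"
proof -
  have A_ind [measurable]: "(\<lambda>z. indicator (Collect A) z :: ennreal) \<in> borel_measurable P" by measurable
  show ?thesis
    using v
  proof (induction v rule: borel_measurable_induct)
    case (cong f g)
    have "snd z \<in> space N" if "z \<in> space P" for z
      using sets that by (rule snd_in_space)
    then have "(\<integral>\<^sup>+z. f (snd z) * h z \<partial>P) = (\<integral>\<^sup>+z. g (snd z) * h z \<partial>P)" for h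
      using cong.hyps(3) by (intro nn_integral_cong) simp
    from this[of "indicator (Collect A)"] this[of "\<lambda>_. 1"] show ?case using cong.IH by simp
  next
    case (set C)
    interpret prob_space P by fact
    note [measurable] = set
    have "(\<integral>\<^sup>+z. indicator C (snd z) * indicator (Collect A) z \<partial>P) = (\<integral>\<^sup>+z. indicator {z\<in>space P. A z \<and> snd z \<in> C} z \<partial>P)"
      by (intro nn_integral_cong) (auto simp: indicator_def)
    also have "\<dots> = ennreal (measure P {z\<in>space P. A z \<and> snd z \<in> C})"
      by (subst nn_integral_indicator) (auto simp: emeasure_eq_measure)
    also have "\<dots> = ennreal \<tau> * (\<integral>\<^sup>+z. indicator {z\<in>space P. snd z \<in> C} z \<partial>P)"
      using \<tau> by (subst nn_integral_indicator) (auto simp: emeasure_eq_measure cond[OF set] ennreal_mult')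
    also have "(\<integral>\<^sup>+z. indicator {z\<in>space P. snd z \<in> C} z \<partial>P) = (\<integral>\<^sup>+z. indicator C (snd z) \<partial>P)"
      by (intro nn_integral_cong) (auto simp: indicator_def)
    finally show ?case .
  next
    case (mult u c)
    note [measurable] = mult.hyps(2)
    have *: "(\<integral>\<^sup>+z. c * u (snd z) * g z \<partial>P) = c * (\<integral>\<^sup>+z. u (snd z) * g z \<partial>P)"
      if [measurable]: "g \<in> borel_measurable P" for g
      by (simp only: mult.assoc) (rule nn_integral_cmult, measurable)
    show ?case using *[OF A_ind] *[OF borel_measurable_const, of 1] mult.IH by (simp add: mult.left_commute)
  next
    case (add u v)
    note [measurable] = add.hyps(1,3)
    have *: "(\<integral>\<^sup>+z. (v (snd z) + u (snd z)) * g z \<partial>P) = (\<integral>\<^sup>+z. v (snd z) * g z \<partial>P) + (\<integral>\<^sup>+z. u (snd z) * g z \<partial>P)"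
      if [measurable]: "g \<in> borel_measurable P" for g
      by (simp only: distrib_right) (rule nn_integral_add; measurable)
    show ?case using *[OF A_ind] *[OF borel_measurable_const, of 1] add.IH by (simp add: distrib_left)
  next
    case (seq U)
    note [measurable] = seq.hyps(1)
    have inc: "incseq (\<lambda>i z. U i (snd z) * g z)" for g :: "real \<times> 'x \<Rightarrow> ennreal"
      using seq.hyps(3) by (auto simp: incseq_def le_fun_def intro!: mult_right_mono)
    have *: "(\<integral>\<^sup>+z. (SUP i. U i) (snd z) * g z \<partial>P) = (SUP i. \<integral>\<^sup>+z. U i (snd z) * g z \<partial>P)"
      if [measurable]: "g \<in> borel_measurable P" for g
    proof -
      have "(SUP i. U i) (snd z) * g z = (SUP i. U i (snd z) * g z)" for z
        by (simp add: SUP_apply image_comp SUP_mult_right_ennreal)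
      then show ?thesis
        by (simp only:) (rule nn_integral_monotone_convergence_SUP[OF inc], measurable)
    qed
    show ?case
      using *[OF A_ind] *[OF borel_measurable_const, of 1] seq.IH by (simp add: SUP_mult_left_ennreal)
  qed
qed

lemma expectation_conditional_prob:
  fixes P :: "(real \<times> 'x) measure" and v :: "'x \<Rightarrow> real"
  assumes P: "prob_space P" and sets [measurable_cong]: "sets P = sets (borel \<Otimes>\<^sub>M N)"
    and A [measurable]: "Measurable.pred P A" and \<tau>: "0 \<le> \<tau>"
    and cond: "\<And>C. C \<in> sets N \<Longrightarrow> measure P {z\<in>space P. A z \<and> snd z \<in> C} = \<tau> * measure P {z\<in>space P. snd z \<in> C}"
    and v [measurable]: "v \<in> borel_measurable N" and b: "\<And>x. \<bar>v x\<bar> \<le> b"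
  shows "(\<integral>z. v (snd z) * indicator (Collect A) z \<partial>P) = \<tau> * (\<integral>z. v (snd z) \<partial>P)"
proof -
  interpret prob_space P by fact
  have nonneg: "(\<integral>z. u (snd z) * indicator (Collect A) z \<partial>P) = \<tau> * (\<integral>z. u (snd z) \<partial>P)"
    if [measurable]: "u \<in> borel_measurable N" and u: "\<And>x. 0 \<le> u x" for u :: "'x \<Rightarrow> real"
  proof -
    have "(\<integral>\<^sup>+z. ennreal (u (snd z) * indicator (Collect A) z) \<partial>P)
       = (\<integral>\<^sup>+z. ennreal (u (snd z)) * indicator (Collect A) z \<partial>P)"
      by (intro nn_integral_cong) (auto simp: indicator_def)
    also have "\<dots> = ennreal \<tau> * (\<integral>\<^sup>+z. ennreal (u (snd z)) \<partial>P)"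
      by (rule nn_integral_conditional_prob[OF P sets A \<tau> cond]) auto
    finally show ?thesis
      using u \<tau> by (simp add: integral_eq_nn_integral enn2real_mult)
  qed
  have b0: "0 \<le> b" using b by (rule order_trans[OF abs_ge_zero])
  have int [simp]: "integrable P (\<lambda>z. v (snd z))" "integrable P (\<lambda>z. v (snd z) * indicator (Collect A) z)"
    using b by (intro integrable_const_bound[where B = b] AE_I2; auto simp: indicator_def b0)+
  have intb [simp]: "integrable P (\<lambda>z. b * indicator (Collect A) z)"
    by (intro integrable_const_bound[where B = "\<bar>b\<bar>"] AE_I2) (auto simp: indicator_def)
  \<comment> \<open>A signed weight is reduced to the nonnegative weights \<open>v + b\<close> and
    \<open>b\<close>.\<close>
  have "(\<integral>z. (v (snd z) + b) * indicator (Collect A) z \<partial>P) = \<tau> * (\<integral>z. v (snd z) + b \<partial>P)"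
  proof (rule nonneg)
    show "0 \<le> v x + b" for x using b[of x] by linarith
  qed measurable
  moreover have "(\<integral>z. b * indicator (Collect A) z \<partial>P) = \<tau> * (\<integral>z. b \<partial>P)"
  proof (rule nonneg)
    show "0 \<le> b" by (rule b0)
  qed measurable
  moreover have "(\<integral>z. (v (snd z) + b) * indicator (Collect A) z \<partial>P)
      = (\<integral>z. v (snd z) * indicator (Collect A) z \<partial>P) + (\<integral>z. b * indicator (Collect A) z \<partial>P)"
    by (simp only: distrib_right) (rule Bochner_Integration.integral_add[OF int(2) intb])
  moreover have "(\<integral>z. v (snd z) + b \<partial>P) = (\<integral>z. v (snd z) \<partial>P) + (\<integral>z. b \<partial>P)"
    by (rule Bochner_Integration.integral_add) simp_all
  ultimately show ?thesis
    by (simp only: distrib_left)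
qed

section \<open>The penalized composite quantile estimator\<close>

lemma check_loss_knight:
  "check_loss \<tau> (u - a) - check_loss \<tau> u = - a * (\<tau> - (if u < 0 then 1 else 0)) + knight_rem u a"
  by (auto simp: check_loss_def knight_rem_def max_def algebra_simps)

lemma check_loss_lipschitz:
  assumes "0 \<le> \<tau>" "\<tau> \<le> 1"
  shows "\<bar>check_loss \<tau> u - check_loss \<tau> v\<bar> \<le> \<bar>u - v\<bar>"
proof -
  have le: "check_loss \<tau> u - check_loss \<tau> v \<le> \<bar>u - v\<bar>" for u v
  proof -
    have *: "check_loss \<tau> w = max (\<tau> * w) ((\<tau> - 1) * w)" for w
    proof (cases "w < 0")
      case True
      then show ?thesis by (simp add: check_loss_def algebra_simps max_def)
    next
      case False
      then show ?thesis by (simp add: check_loss_def algebra_simps max_def)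
    qed
    have "\<bar>c * (u - v)\<bar> \<le> 1 * \<bar>u - v\<bar>" if "\<bar>c\<bar> \<le> 1" for c :: real
      unfolding abs_mult using that by (intro mult_right_mono) auto
    from this[of \<tau>] this[of "\<tau> - 1"]
    have "\<tau> * u - \<tau> * v \<le> \<bar>u - v\<bar>" "(\<tau> - 1) * u - (\<tau> - 1) * v \<le> \<bar>u - v\<bar>"
      using assms by (auto simp: abs_le_iff right_diff_distrib)
    then show ?thesis unfolding * by linarith
  qed
  from le[of u v] le[of v u] show ?thesis by (simp add: abs_le_iff abs_minus_commute)
qed

text \<open>In Knight's identity the linear part scales exactly with \<open>\<theta>\<close>; the
  rest is convexity of the remainder in its second argument, where it vanishes at 0.\<close>

lemma check_loss_convex:
  assumes "0 \<le> \<theta>" "\<theta> \<le> 1"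
  shows "check_loss \<tau> (u - \<theta> * a) - check_loss \<tau> u \<le> \<theta> * (check_loss \<tau> (u - a) - check_loss \<tau> u)"
proof -
  have "knight_rem u (\<theta> * a) \<le> \<theta> * knight_rem u a"
  proof (cases "\<theta> = 0")
    case False
    then have th: "0 < \<theta>" using assms by simp
    have "0 \<le> u \<Longrightarrow> \<theta> * a - u \<le> \<theta> * (a - u)" "u < 0 \<Longrightarrow> u - \<theta> * a \<le> \<theta> * (u - a)"
      using mult_right_mono[of \<theta> 1 "\<bar>u\<bar>"] assms by (auto simp: algebra_simps)
    moreover have "0 < \<theta> * a \<longleftrightarrow> 0 < a" using th by (simp add: zero_less_mult_iff)
    moreover have "0 \<le> \<theta> * max 0 z" "\<theta> * z \<le> \<theta> * max 0 z" for z
      using th by (auto intro: mult_left_mono)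
    ultimately show ?thesis
      unfolding knight_rem_def by (smt (verit) th mult_nonneg_nonneg)
  qed (simp add: knight_rem_def)
  then show ?thesis
    by (simp add: check_loss_knight algebra_simps)
qed

section \<open>Norms of stacked coefficient vectors\<close>

lemma full_norm_sq: "(full_norm K p \<beta>)\<^sup>2 = (\<Sum>j\<in>{0..p}. (grp_norm K \<beta> j)\<^sup>2)"
  unfolding full_norm_def grp_norm_def
  by (subst sum.swap) (simp add: sum_nonneg)

lemma full_norm_sq_blk: "(full_norm K p \<beta>)\<^sup>2 = (\<Sum>k\<in>{1..K}. (blk_norm p \<beta> k)\<^sup>2)"
  unfolding full_norm_def blk_norm_def by (simp add: sum_nonneg)

lemma full_norm_nonneg [simp]: "0 \<le> full_norm K p \<beta>"
  by (simp add: full_norm_def sum_nonneg)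

lemma grp_norm_L2: "grp_norm K \<beta> j = L2_set (\<lambda>k. \<beta> k j) {1..K}"
  by (simp add: grp_norm_def L2_set_def)

lemma grp_norm_nonneg [simp]: "0 \<le> grp_norm K \<beta> j"
  by (simp add: grp_norm_L2)

lemma blk_norm_nonneg [simp]: "0 \<le> blk_norm p \<beta> k"
  by (simp add: blk_norm_def sum_nonneg)

lemma grp_norm_scale: "0 \<le> \<theta> \<Longrightarrow> grp_norm K (\<lambda>k j. \<theta> * \<beta> k j) j = \<theta> * grp_norm K \<beta> j"
  by (simp add: grp_norm_L2 L2_set_right_distrib)

lemma full_norm_scale: "0 \<le> \<theta> \<Longrightarrow> full_norm K p (\<lambda>k j. \<theta> * \<beta> k j) = \<theta> * full_norm K p \<beta>"
  by (simp add: full_norm_def power_mult_distrib real_sqrt_mult flip: sum_distrib_left)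

lemma sum_grp_norm_le:
  assumes "A \<subseteq> {0..p}"
  shows "(\<Sum>j\<in>A. grp_norm K \<beta> j) \<le> sqrt (card A) * full_norm K p \<beta>"
proof -
  have fin: "finite A" using assms finite_subset by blast
  have "(\<Sum>j\<in>A. grp_norm K \<beta> j) \<le> (\<Sum>j\<in>A. \<bar>1\<bar> * \<bar>grp_norm K \<beta> j\<bar>)" by simp
  also have "\<dots> \<le> L2_set (\<lambda>_. 1) A * L2_set (grp_norm K \<beta>) A" by (rule L2_set_mult_ineq)
  also have "L2_set (\<lambda>_. 1) A = sqrt (card A)" by (simp add: L2_set_def)
  also have "L2_set (grp_norm K \<beta>) A \<le> sqrt ((full_norm K p \<beta>)\<^sup>2)"
    unfolding L2_set_def full_norm_sq using assms by (intro real_sqrt_le_mono sum_mono2) auto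
  finally show ?thesis by (simp add: mult_left_mono)
qed

text \<open>Each coordinate is at most its group norm. In this way the cone condition, which speaks
  of groups, bounds the l1 radius of every quantile block.\<close>

lemma l1_le_grp_norm:
  assumes "k \<in> {1..K}"
  shows "(\<Sum>j\<in>{0..p}. \<bar>\<beta> k j\<bar>) \<le> (\<Sum>j\<in>{0..p}. grp_norm K \<beta> j)"
proof (intro sum_mono)
  fix j
  have "\<bar>\<beta> k j\<bar> \<le> L2_set (\<lambda>k. \<bar>\<beta> k j\<bar>) {1..K}"
    using assms by (intro member_le_L2_set) auto
  then show "\<bar>\<beta> k j\<bar> \<le> grp_norm K \<beta> j" by (simp add: grp_norm_L2 L2_set_def)
qed

text \<open>Rounding each coordinate toward 0 keeps the rational point in the same l1 ball.
  Extensional functions are used so that the candidates form a countable set.\<close>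

lemma rational_l1_approx:
  fixes v :: "nat \<Rightarrow> real"
  assumes "0 < e"
  shows "\<exists>t\<in>{0..p} \<rightarrow>\<^sub>E \<rat>. (\<Sum>j\<in>{0..p}. \<bar>t j\<bar>) \<le> (\<Sum>j\<in>{0..p}. \<bar>v j\<bar>)
    \<and> (\<Sum>j\<in>{0..p}. \<bar>v j - t j\<bar>) \<le> e"
proof -
  define e' where "e' = e / real (p + 1)"
  have e': "0 < e'" using assms by (simp add: e'_def)
  have "\<exists>r\<in>\<rat>. \<bar>r\<bar> \<le> \<bar>x\<bar> \<and> \<bar>x - r\<bar> \<le> e'" for x :: real
  proof -
    consider "x = 0" | "0 < x" | "x < 0" by linarith
    then show ?thesis
    proof cases
      case 1
      then show ?thesis using e' by (intro bexI[of _ 0]) auto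
    next
      case 2
      then obtain r where "r \<in> \<rat>" "max 0 (x - e') < r" "r < x"
        using Rats_dense_in_real[of "max 0 (x - e')" x] e' by auto
      then show ?thesis by (intro bexI[of _ r]) auto
    next
      case 3
      then obtain r where "r \<in> \<rat>" "x < r" "r < min 0 (x + e')"
        using Rats_dense_in_real[of x "min 0 (x + e')"] e' by auto
      then show ?thesis by (intro bexI[of _ r]) auto
    qed
  qed
  then obtain r :: "real \<Rightarrow> real" where r: "\<And>x. r x \<in> \<rat>" "\<And>x. \<bar>r x\<bar> \<le> \<bar>x\<bar>" "\<And>x. \<bar>x - r x\<bar> \<le> e'"
    by metis
  let ?t = "restrict (\<lambda>j. r (v j)) {0..p}"
  have "(\<Sum>j\<in>{0..p}. \<bar>v j - ?t j\<bar>) \<le> (\<Sum>j\<in>{0..p}. e')"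
    using r by (intro sum_mono) auto
  also have "\<dots> = e" by (simp add: e'_def)
  finally show ?thesis
    using r by (intro bexI[of _ ?t]) (auto intro!: sum_mono)
qed

text \<open>Clipping turns the almost sure bound on the covariates into a bound that holds everywhere.\<close>
definition clip :: "real \<Rightarrow> (nat \<Rightarrow> real) \<Rightarrow> nat \<Rightarrow> real" where
  "clip C x j = (if \<bar>x j\<bar> \<le> C then x j else 0)"

lemma clip_le: "0 \<le> C \<Longrightarrow> \<bar>clip C x j\<bar> \<le> C"
  by (simp add: clip_def)

section \<open>Residuals, scores and excess loss under the model\<close>

locale quantile_model =
  fixes K :: nat and \<tau> :: "nat \<Rightarrow> real" and p :: nat and P :: "(real \<times> (nat \<Rightarrow> real)) measure"
    and f f' :: "(nat \<Rightarrow> real) \<Rightarrow> real \<Rightarrow> real" and \<beta>s :: "nat \<Rightarrow> nat \<Rightarrow> real" and c1 c2 Cx :: real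
  assumes K: "1 \<le> K" and \<tau>: "\<And>k. k \<in> {1..K} \<Longrightarrow> 0 < \<tau> k \<and> \<tau> k < 1"
    and c1: "0 < c1" and c2: "0 < c2" and Cx: "0 < Cx"
    and model: "qr_model K \<tau> p P f f' \<beta>s c1 c2 Cx"
begin

abbreviation N :: "(nat \<Rightarrow> real) measure" where
  "N \<equiv> \<Pi>\<^sub>M j\<in>(UNIV::nat set). (borel :: real measure)"

sublocale prob_space P
  using model by (simp add: qr_model_def)

lemma sets_P [measurable_cong]: "sets P = sets (borel \<Otimes>\<^sub>M N)"
  using model by (simp add: qr_model_def obs_space_def)

definition lin :: "(nat \<Rightarrow> real) \<Rightarrow> (nat \<Rightarrow> real) \<Rightarrow> real" where
  "lin v x = xdot p (clip Cx x) v"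

text \<open>Only the perturbation \<open>lin\<close> is clipped. The residual keeps the raw
  covariates, so that the quantile condition of the model applies to its sign as it stands.\<close>

definition resid :: "nat \<Rightarrow> real \<times> (nat \<Rightarrow> real) \<Rightarrow> real" where
  "resid k z = fst z - xdot p (snd z) (\<beta>s k)"

definition excess :: "nat \<Rightarrow> (nat \<Rightarrow> real) \<Rightarrow> real \<times> (nat \<Rightarrow> real) \<Rightarrow> real" where
  "excess k v z = check_loss (\<tau> k) (resid k z - lin v (snd z)) - check_loss (\<tau> k) (resid k z)"

definition sign_score :: "nat \<Rightarrow> real \<times> (nat \<Rightarrow> real) \<Rightarrow> real" where
  "sign_score k z = \<tau> k - (if resid k z < 0 then 1 else 0)"

lemma clip_measurable [measurable]: "(\<lambda>x. clip Cx x j) \<in> borel_measurable N"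
  unfolding clip_def by measurable

lemma xdot_measurable [measurable]: "(\<lambda>x. xdot p x v) \<in> borel_measurable N"
  unfolding xdot_def by measurable

lemma lin_measurable [measurable]: "lin v \<in> borel_measurable N"
  unfolding lin_def xdot_def by measurable

lemma resid_measurable [measurable]: "resid k \<in> borel_measurable P"
  unfolding resid_def by measurable

lemma sign_score_measurable [measurable]: "sign_score k \<in> borel_measurable P"
  unfolding sign_score_def by measurable

lemma excess_measurable [measurable]: "excess k v \<in> borel_measurable P"
  unfolding excess_def check_loss_def by measurable

lemma AE_bounded: "AE z in P. \<forall>j\<in>{0..p}. \<bar>snd z j\<bar> \<le> Cx"
proof -
  have "AE z in P. \<forall>j\<in>{0..p}. \<bar>snd z j\<bar> < Cx" using model unfolding qr_model_def by blast
  then show ?thesis by eventually_elim (auto intro: less_imp_le)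
qed

lemma lin_eq: "\<forall>j\<in>{0..p}. \<bar>x j\<bar> \<le> Cx \<Longrightarrow> lin v x = xdot p x v"
  by (simp add: lin_def xdot_def clip_def)

lemma AE_lin_eq: "AE z in P. lin v (snd z) = xdot p (snd z) v"
  using AE_bounded by eventually_elim (rule lin_eq)

lemma lin_abs_le: "\<bar>lin v x\<bar> \<le> Cx * (\<Sum>j\<in>{0..p}. \<bar>v j\<bar>)"
  unfolding lin_def xdot_def sum_distrib_left
  using Cx by (intro order_trans[OF sum_abs] sum_mono) (auto simp: abs_mult clip_le intro: mult_right_mono)

lemma lin_diff: "lin v x - lin w x = lin (\<lambda>j. v j - w j) x"
  by (simp add: lin_def xdot_def sum_subtractf right_diff_distrib)

lemma excess_abs_le: "k \<in> {1..K} \<Longrightarrow> \<bar>excess k v z\<bar> \<le> \<bar>lin v (snd z)\<bar>"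
  unfolding excess_def using check_loss_lipschitz[of "\<tau> k" "resid k z - lin v (snd z)" "resid k z"] \<tau>[of k]
  by simp

lemma excess_lipschitz:
  "k \<in> {1..K} \<Longrightarrow> \<bar>excess k v z - excess k w z\<bar> \<le> \<bar>lin v (snd z) - lin w (snd z)\<bar>"
  unfolding excess_def
  using check_loss_lipschitz[of "\<tau> k" "resid k z - lin v (snd z)" "resid k z - lin w (snd z)"] \<tau>[of k]
  by (simp add: abs_minus_commute)

lemma excess_integrable [simp]: "k \<in> {1..K} \<Longrightarrow> integrable P (excess k v)"
  using excess_abs_le[of k v] lin_abs_le[of v]
  by (intro integrable_const_bound[where B = "Cx * (\<Sum>j\<in>{0..p}. \<bar>v j\<bar>)"] AE_I2)
    (auto intro: order_trans)

lemma excess_knight: "excess k v z = - lin v (snd z) * sign_score k z + knight_rem (resid k z) (lin v (snd z))"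
  unfolding excess_def sign_score_def by (rule check_loss_knight)

lemma expectation_neg_resid:
  fixes v :: "(nat \<Rightarrow> real) \<Rightarrow> real"
  assumes k: "k \<in> {1..K}" and [measurable]: "v \<in> borel_measurable N" and b: "\<And>x. \<bar>v x\<bar> \<le> b"
  shows "(\<integral>z. v (snd z) * (if resid k z < 0 then 1 else 0) \<partial>P) = \<tau> k * (\<integral>z. v (snd z) \<partial>P)"
proof -
  have "(\<integral>z. v (snd z) * indicator (Collect (\<lambda>z. resid k z < 0)) z \<partial>P) = \<tau> k * (\<integral>z. v (snd z) \<partial>P)"
  proof (rule expectation_conditional_prob[OF prob_space_axioms sets_P])
    show "measure P {z \<in> space P. resid k z < 0 \<and> snd z \<in> C} = \<tau> k * measure P {z \<in> space P. snd z \<in> C}"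
      if "C \<in> sets N" for C
      using model k that unfolding qr_model_def resid_def by blast
  qed (use \<tau>[OF k] b in auto)
  moreover have "(\<lambda>z. v (snd z) * indicator (Collect (\<lambda>z. resid k z < 0)) z) = (\<lambda>z. v (snd z) * (if resid k z < 0 then 1 else 0))"
    by (auto simp: indicator_def)
  ultimately show ?thesis by simp
qed

lemma bounded_integrable:
  fixes v :: "(nat \<Rightarrow> real) \<Rightarrow> real"
  assumes [measurable]: "v \<in> borel_measurable N" and b: "\<And>x. \<bar>v x\<bar> \<le> b"
  shows "integrable P (\<lambda>z. v (snd z))" "integrable P (\<lambda>z. v (snd z) * (if resid k z < 0 then 1 else 0))"
proof -
  have "0 \<le> b" using b[of undefined] by linarith
  then show "integrable P (\<lambda>z. v (snd z))" "integrable P (\<lambda>z. v (snd z) * (if resid k z < 0 then 1 else 0))"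
    using b by (intro integrable_const_bound[where B = b] AE_I2; auto)+
qed

lemma expectation_sign_score:
  fixes v :: "(nat \<Rightarrow> real) \<Rightarrow> real"
  assumes k: "k \<in> {1..K}" and v: "v \<in> borel_measurable N" and b: "\<And>x. \<bar>v x\<bar> \<le> b"
  shows "(\<integral>z. v (snd z) * sign_score k z \<partial>P) = 0"
  using expectation_neg_resid[OF k v b] bounded_integrable[OF v b]
  by (simp add: sign_score_def right_diff_distrib mult.commute)

lemma sign_score_abs_le: "k \<in> {1..K} \<Longrightarrow> \<bar>sign_score k z\<bar> \<le> 1"
  using \<tau>[of k] by (auto simp: sign_score_def)

text \<open>The sign score has conditional variance \<open>\<tau> k * (1 - \<tau> k)\<close>, which
  is at most 1/4. This is the source of the variance \<open>M\<^sup>2 / 4\<close> in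
  \<open>norm_sum_tail\<close>.\<close>

lemma expectation_sign_score_sq:
  fixes v :: "(nat \<Rightarrow> real) \<Rightarrow> real"
  assumes k: "k \<in> {1..K}" and v: "v \<in> borel_measurable N" and b: "\<And>x. \<bar>v x\<bar> \<le> b" and v0: "\<And>x. 0 \<le> v x"
  shows "(\<integral>z. v (snd z) * (sign_score k z)\<^sup>2 \<partial>P) \<le> b / 4"
proof -
  have sqe: "v (snd z) * (sign_score k z)\<^sup>2
      = (\<tau> k)\<^sup>2 * v (snd z) + (1 - 2 * \<tau> k) * (v (snd z) * (if resid k z < 0 then 1 else 0))" for z
    by (simp add: sign_score_def power2_eq_square algebra_simps)
  have "(\<integral>z. v (snd z) * (sign_score k z)\<^sup>2 \<partial>P)
     = (\<tau> k)\<^sup>2 * (\<integral>z. v (snd z) \<partial>P) + (1 - 2 * \<tau> k) * (\<integral>z. v (snd z) * (if resid k z < 0 then 1 else 0) \<partial>P)"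
    unfolding sqe using bounded_integrable[OF v b] by simp
  also have "\<dots> = \<tau> k * (1 - \<tau> k) * (\<integral>z. v (snd z) \<partial>P)"
    unfolding expectation_neg_resid[OF k v b] by (simp add: power2_eq_square algebra_simps)
  also have "\<dots> \<le> 1 / 4 * b"
  proof (rule mult_mono)
    have "0 \<le> (\<tau> k - 1/2)\<^sup>2" by simp
    then show "\<tau> k * (1 - \<tau> k) \<le> 1 / 4" by (simp add: power2_eq_square algebra_simps)
    have "(\<integral>z. v (snd z) \<partial>P) \<le> (\<integral>z. b \<partial>P)"
      using b bounded_integrable[OF v b] by (intro integral_mono) (auto simp: abs_le_iff)
    then show "(\<integral>z. v (snd z) \<partial>P) \<le> b" by (simp add: prob_space)
    show "0 \<le> (\<integral>z. v (snd z) \<partial>P)" using v0 by (intro integral_nonneg_AE) auto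
  qed simp
  finally show ?thesis by simp
qed

text \<open>The linear term of Knight's identity has mean zero, and the tent bounds the mean of the
  remainder. Clipping disappears inside the expectations because it changes nothing almost
  surely.\<close>

lemma expected_excess_ge:
  assumes k: "k \<in> {1..K}"
  shows "c1 / 2 * (\<integral>z. (xdot p (snd z) v)\<^sup>2 \<partial>P) - c2 / 6 * (\<integral>z. \<bar>xdot p (snd z) v\<bar>^3 \<partial>P)
     \<le> (\<integral>z. excess k v z \<partial>P)"
proof -
  define b where "b = Cx * (\<Sum>j\<in>{0..p}. \<bar>v j\<bar>)"
  have lb: "\<bar>lin v x\<bar> \<le> b" for x unfolding b_def by (rule lin_abs_le)
  have b0: "0 \<le> b" using lb[of undefined] by linarith
  have i1: "integrable P (\<lambda>z. lin v (snd z) * sign_score k z)"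
    using mult_mono[OF lb sign_score_abs_le[OF k] b0]
    by (intro integrable_const_bound[where B = b] AE_I2) (auto simp: abs_mult)
  have i2: "integrable P (\<lambda>z. knight_rem (resid k z) (lin v (snd z)))"
    using order_trans[OF knight_rem_le lb]
    by (intro integrable_const_bound[where B = b] AE_I2) (auto simp: knight_rem_nonneg)
  have i3: "integrable P (\<lambda>z. (lin v (snd z))\<^sup>2)"
    using power_mono[OF lb abs_ge_zero, of _ 2] by (intro integrable_const_bound[where B = "b\<^sup>2"] AE_I2) auto
  have i4: "integrable P (\<lambda>z. \<bar>lin v (snd z)\<bar>^3)"
    using power_mono[OF lb abs_ge_zero, of _ 3] by (intro integrable_const_bound[where B = "b^3"] AE_I2) (auto simp: power_abs)
  have e2: "(\<integral>z. (xdot p (snd z) v)\<^sup>2 \<partial>P) = (\<integral>z. (lin v (snd z))\<^sup>2 \<partial>P)"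
    by (intro integral_cong_AE, measurable) (use AE_lin_eq[of v] in eventually_elim, simp)
  have e3: "(\<integral>z. \<bar>xdot p (snd z) v\<bar>^3 \<partial>P) = (\<integral>z. \<bar>lin v (snd z)\<bar>^3 \<partial>P)"
    by (intro integral_cong_AE, measurable) (use AE_lin_eq[of v] in eventually_elim, simp)
  have "c1 / 2 * (\<integral>z. (xdot p (snd z) v)\<^sup>2 \<partial>P) - c2 / 6 * (\<integral>z. \<bar>xdot p (snd z) v\<bar>^3 \<partial>P)
    = (\<integral>z. c1 * (lin v (snd z))\<^sup>2 / 2 - c2 * \<bar>lin v (snd z)\<bar>^3 / 6 \<partial>P)"
    unfolding e2 e3 using i3 i4 by simp
  also have "\<dots> \<le> (\<integral>z. knight_rem (fst z - xdot p (snd z) (\<beta>s k)) (lin v (snd z)) \<partial>P)"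
  proof (rule expected_knight_rem_ge[OF prob_space_axioms sets_P, where f = f and f' = f' and b = b])
    show "AE z in P. c1 \<le> f (snd z) (xdot p (snd z) (\<beta>s k))"
    proof -
      have "AE z in P. \<forall>k\<in>{1..K}. c1 \<le> f (snd z) (xdot p (snd z) (\<beta>s k))"
        using model unfolding qr_model_def by blast
      then show ?thesis by eventually_elim (use k in auto)
    qed
  qed (use model lb in \<open>auto simp: qr_model_def\<close>)
  also have "\<dots> = (\<integral>z. knight_rem (resid k z) (lin v (snd z)) \<partial>P)"
    by (simp add: resid_def)
  also have "\<dots> = (\<integral>z. excess k v z \<partial>P)"
    unfolding excess_knight using i1 i2 expectation_sign_score[OF k lin_measurable lb] by simp
  finally show ?thesis .
qed

text \<open>With \<open>?m2\<close>, \<open>?m3\<close> the second and third absolute moments, (C4),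
  the upper bound in (C3) and the small block give \<open>c2 * ?m3 \<le> c1 * ?m2\<close>. The cubic
  term then takes at most a third of the quadratic one: c1/2 - c1/6 = c1/3.\<close>

lemma expected_excess_quadratic:
  assumes C3: "cond_C3 K p P S b B bt Bt" and C4: "dt \<le> d_const K p P S c1 c2 B k"
    and dt: "0 < dt" and k: "k \<in> {1..K}" and \<Delta>: "\<Delta> \<in> cone K p S" and small: "blk_norm p \<Delta> k \<le> dt"
  shows "c1 * bt / 3 * (blk_norm p \<Delta> k)\<^sup>2 \<le> (\<integral>z. excess k (\<Delta> k) z \<partial>P)"
proof (cases "\<exists>j\<in>{0..p}. \<Delta> k j \<noteq> 0")
  case False
  then have "blk_norm p \<Delta> k = 0" "lin (\<Delta> k) x = 0" for x
    by (auto simp: blk_norm_def lin_def xdot_def)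
  then show ?thesis by (simp add: excess_def)
next
  case True
  let ?m2 = "\<lambda>\<Delta>. \<integral>z. (xdot p (snd z) (\<Delta> k))\<^sup>2 \<partial>P"
  let ?m3 = "\<lambda>\<Delta>. \<integral>z. \<bar>xdot p (snd z) (\<Delta> k)\<bar>^3 \<partial>P"
  let ?r = "\<lambda>\<Delta>. ?m2 \<Delta> powr (3/2) / ?m3 \<Delta>"
  define nb where "nb = blk_norm p \<Delta> k"
  have B: "0 < B k" "0 < bt" "bt \<le> b k" using C3 k by (auto simp: cond_C3_def)
  have m2: "b k * nb\<^sup>2 \<le> ?m2 \<Delta>" "?m2 \<Delta> \<le> B k * nb\<^sup>2"
    using C3 k \<Delta> by (auto simp: cond_C3_def nb_def)
  have m3: "0 \<le> ?m3 \<Delta>" by (intro integral_nonneg_AE) auto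
  have m20: "0 \<le> ?m2 \<Delta>" by (intro integral_nonneg_AE) auto
  have nb0: "0 \<le> nb" by (simp add: nb_def)
  have c0: "0 \<le> c1 / (c2 * sqrt (B k))" using c1 c2 B by simp
  have "(INF \<Delta>\<in>{\<Delta>\<in>cone K p S. \<exists>j\<in>{0..p}. \<Delta> k j \<noteq> 0}. ?r \<Delta>) \<le> ?r \<Delta>"
  proof (rule cINF_lower)
    show "bdd_below (?r ` {\<Delta>\<in>cone K p S. \<exists>j\<in>{0..p}. \<Delta> k j \<noteq> 0})"
      by (intro bdd_belowI2[where m = 0] divide_nonneg_nonneg integral_nonneg_AE) auto
  qed (use \<Delta> True in simp)
  then have "dt \<le> c1 / (c2 * sqrt (B k)) * ?r \<Delta>"
    using order_trans[OF C4[unfolded d_const_def] mult_left_mono[OF _ c0]] by blast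
  \<comment> \<open>Division by 0 yields 0, so a vanishing third moment would contradict
    \<open>0 < dt\<close>.\<close>
  moreover from this have m3pos: "0 < ?m3 \<Delta>"
    using dt m3 by (cases "?m3 \<Delta> = 0") (auto simp: less_le)
  ultimately have "dt * (c2 * sqrt (B k) * ?m3 \<Delta>) \<le> c1 * ?m2 \<Delta> powr (3/2)"
    using c2 B by (simp add: field_simps)
  also have "?m2 \<Delta> powr (3/2) = ?m2 \<Delta> * sqrt (?m2 \<Delta>)"
  proof (cases "?m2 \<Delta> = 0")
    case False
    then show ?thesis
      using m20 powr_add[of "?m2 \<Delta>" 1 "1/2"] by (simp add: powr_half_sqrt)
  qed simp
  also have "c1 * (?m2 \<Delta> * sqrt (?m2 \<Delta>)) \<le> c1 * (?m2 \<Delta> * (sqrt (B k) * nb))"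
  proof -
    have "sqrt (?m2 \<Delta>) \<le> sqrt (B k * nb\<^sup>2)" using m2 by simp
    then show ?thesis using c1 m20 nb0 by (intro mult_left_mono) (auto simp: real_sqrt_mult)
  qed
  also have "\<dots> \<le> c1 * (?m2 \<Delta> * (sqrt (B k) * dt))"
    using c1 m20 B small by (intro mult_left_mono) (auto simp: nb_def)
  finally have "(dt * sqrt (B k)) * (c2 * ?m3 \<Delta>) \<le> (dt * sqrt (B k)) * (c1 * ?m2 \<Delta>)"
    by (simp add: mult_ac)
  then have "c2 * ?m3 \<Delta> \<le> c1 * ?m2 \<Delta>" using dt B by simp
  then have "c1 / 3 * ?m2 \<Delta> \<le> c1 / 2 * ?m2 \<Delta> - c2 / 6 * ?m3 \<Delta>" by simp
  also have "\<dots> \<le> (\<integral>z. excess k (\<Delta> k) z \<partial>P)" by (rule expected_excess_ge[OF k])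
  finally have "c1 / 3 * ?m2 \<Delta> \<le> (\<integral>z. excess k (\<Delta> k) z \<partial>P)" .
  moreover have "c1 / 3 * (bt * nb\<^sup>2) \<le> c1 / 3 * ?m2 \<Delta>"
    using c1 B mult_right_mono[OF B(3), of "nb\<^sup>2"] m2 by (intro mult_left_mono) auto
  ultimately show ?thesis by (simp add: nb_def)
qed

section \<open>Exceptional events and their probabilities\<close>

abbreviation sample :: "nat \<Rightarrow> (nat \<Rightarrow> real \<times> (nat \<Rightarrow> real)) measure" where
  "sample n \<equiv> \<Pi>\<^sub>M i\<in>{1..n}. P"

definition score_event :: "nat \<Rightarrow> real \<Rightarrow> nat \<Rightarrow> (nat \<Rightarrow> real \<times> (nat \<Rightarrow> real)) set" where
  "score_event n r j = {\<omega>\<in>space (sample n).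
     r \<le> L2_set (\<lambda>k. \<Sum>i\<in>{1..n}. clip Cx (snd (\<omega> i)) j * sign_score k (\<omega> i)) {1..K}}"

definition rational_ball :: "real \<Rightarrow> (nat \<Rightarrow> real) set" where
  "rational_ball R = {t\<in>{0..p} \<rightarrow>\<^sub>E \<rat>. (\<Sum>j\<in>{0..p}. \<bar>t j\<bar>) \<le> R}"

text \<open>Rational points make this a countable union, hence measurable;
  \<open>deviation_bound\<close> recovers the whole ball by continuity.\<close>

definition deviation_event :: "nat \<Rightarrow> real \<Rightarrow> real \<Rightarrow> nat \<Rightarrow> (nat \<Rightarrow> real \<times> (nat \<Rightarrow> real)) set" where
  "deviation_event n R u k = {\<omega>\<in>space (sample n).
     \<exists>t\<in>rational_ball R. u \<le> (\<Sum>i\<in>{1..n}. (\<integral>z. excess k t z \<partial>P) - excess k t (\<omega> i))}"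

definition unbounded_event :: "nat \<Rightarrow> (nat \<Rightarrow> real \<times> (nat \<Rightarrow> real)) set" where
  "unbounded_event n = {\<omega>\<in>space (sample n). \<exists>i\<in>{1..n}. \<exists>j\<in>{0..p}. Cx < \<bar>snd (\<omega> i) j\<bar>}"

lemma countable_rational_ball: "countable (rational_ball R)"
proof -
  have "countable ({0..p} \<rightarrow>\<^sub>E (\<rat> :: real set))"
    by (intro countable_PiE) (auto simp: countable_rat)
  then show ?thesis unfolding rational_ball_def by (rule countable_subset[rotated]) auto
qed

lemma sets_score_event [measurable]: "score_event n r j \<in> sets (sample n)"
  unfolding score_event_def L2_set_def by measurable

lemma sets_deviation_event [measurable]: "deviation_event n R u k \<in> sets (sample n)"
proof -
  note [simp] = countable_rational_ball
  show ?thesis unfolding deviation_event_def by measurable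
qed

lemma sets_unbounded_event [measurable]: "unbounded_event n \<in> sets (sample n)"
  unfolding unbounded_event_def by measurable

lemma prob_unbounded_event: "measure (sample n) (unbounded_event n) = 0"
proof -
  have "AE \<omega> in sample n. \<forall>i\<in>{1..n}. \<forall>j\<in>{0..p}. \<bar>snd (\<omega> i) j\<bar> \<le> Cx"
    using AE_bounded by (intro AE_finite_allI AE_PiM_component prob_space_axioms) auto
  then have "AE \<omega> in sample n. \<omega> \<notin> unbounded_event n"
    by eventually_elim (auto simp: unbounded_event_def not_less)
  then show ?thesis
    by (simp add: AE_iff_measurable[OF sets_unbounded_event] measure_def unbounded_event_def)
qed

lemma prob_score_event:
  assumes n: "1 \<le> n" and u: "0 \<le> u"
  shows "measure (sample n) (score_event n (Cx * sqrt K * sqrt n * (1/2 + u)) j) \<le> exp (- u\<^sup>2)"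
proof -
  let ?X = "\<lambda>z k. clip Cx (snd z) j * sign_score k z"
  have cl: "\<bar>clip Cx x j\<bar> \<le> Cx" for x using Cx by (simp add: clip_le)
  have cl2: "(clip Cx x j)\<^sup>2 \<le> Cx\<^sup>2" for x using cl[of x] Cx by (simp add: abs_le_square_iff[symmetric])
  have X1: "(?X z k)\<^sup>2 \<le> Cx\<^sup>2" if "k \<in> {1..K}" for z k
  proof -
    have "(sign_score k z)\<^sup>2 \<le> 1\<^sup>2" using sign_score_abs_le[OF that, of z] by (simp add: abs_square_le_1)
    then show ?thesis
      using mult_mono[OF cl2[of "snd z"], of "(sign_score k z)\<^sup>2" 1] by (simp add: power_mult_distrib)
  qed
  \<comment> \<open>There are \<open>K\<close> coordinates, each of size at most \<open>Cx\<close>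
    and second moment at most \<open>Cx\<^sup>2 / 4\<close>.\<close>
  interpret X: bounded_random_vector P ?X "{1..K}" "Cx * sqrt K" "(Cx * sqrt K)\<^sup>2 / 4"
  proof
    show "L2_set (?X z) {1..K} \<le> Cx * sqrt K" for z
    proof -
      have "(\<Sum>k\<in>{1..K}. (?X z k)\<^sup>2) \<le> (\<Sum>k\<in>{1..K}. Cx\<^sup>2)" by (intro sum_mono X1)
      then have "L2_set (?X z) {1..K} \<le> sqrt (K * Cx\<^sup>2)" by (simp add: L2_set_def)
      then show ?thesis using Cx by (simp add: real_sqrt_mult mult.commute)
    qed
    show "(\<integral>z. ?X z k \<partial>P) = 0" if "k \<in> {1..K}" for k
      using expectation_sign_score[OF that clip_measurable cl] .
    have int: "integrable P (\<lambda>z. (?X z k)\<^sup>2)" if "k \<in> {1..K}" for k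
      using X1[OF that] by (intro integrable_const_bound[where B = "Cx\<^sup>2"] AE_I2) auto
    have "(\<integral>z. (L2_set (?X z) {1..K})\<^sup>2 \<partial>P) = (\<Sum>k\<in>{1..K}. \<integral>z. (?X z k)\<^sup>2 \<partial>P)"
      using int by (simp add: L2_set_def sum_nonneg)
    also have "\<dots> \<le> (\<Sum>k\<in>{1..K}. Cx\<^sup>2 / 4)"
    proof (intro sum_mono)
      fix k assume k: "k \<in> {1..K}"
      show "(\<integral>z. (?X z k)\<^sup>2 \<partial>P) \<le> Cx\<^sup>2 / 4"
        unfolding power_mult_distrib
        using cl2 by (intro expectation_sign_score_sq[OF k, of "\<lambda>x. (clip Cx x j)\<^sup>2"]) auto
    qed
    also have "\<dots> = (Cx * sqrt K)\<^sup>2 / 4" by (simp add: power_mult_distrib)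
    finally show "(\<integral>z. (L2_set (?X z) {1..K})\<^sup>2 \<partial>P) \<le> (Cx * sqrt K)\<^sup>2 / 4" .
  qed auto
  show ?thesis
    using X.norm_sum_tail[of "{1..n}" u] n u Cx K by (simp add: score_event_def)
qed

lemma prob_deviation_event:
  assumes n: "1 \<le> n" and R: "0 < R" and u: "0 \<le> u" and k: "k \<in> {1..K}"
  shows "measure (sample n) (deviation_event n R u k)
    \<le> 2 * real (p + 1) * exp (- u\<^sup>2 / (8 * n * R\<^sup>2 * Cx\<^sup>2))"
proof -
  have lin_sum: "lin t x = (\<Sum>j\<in>{0..p}. clip Cx x j * t j)" for t x by (simp add: lin_def xdot_def)
  have "measure (sample n) (deviation_event n R u k)
     \<le> 2 * card {0..p} * exp (- u\<^sup>2 / (8 * card {1..n} * R\<^sup>2 * Cx\<^sup>2))"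
    unfolding deviation_event_def
  proof (rule l1_ball_deviation[where g = "\<lambda>j z. clip Cx (snd z) j"])
    show "\<bar>clip Cx (snd z) j\<bar> \<le> Cx" for j z using Cx by (simp add: clip_le)
  qed (use n R u k Cx in \<open>auto simp: prob_space_axioms countable_rational_ball[unfolded rational_ball_def] rational_ball_def lin_sum[symmetric]
      excess_abs_le excess_lipschitz\<close>)
  then show ?thesis by (simp add: add.commute)
qed

section \<open>Deterministic consequences outside the exceptional events\<close>

lemma deviation_bound:
  assumes n: "1 \<le> n" and \<omega>: "\<omega> \<in> space (sample n)" "\<omega> \<notin> deviation_event n R u k" and k: "k \<in> {1..K}"
    and v: "(\<Sum>j\<in>{0..p}. \<bar>v j\<bar>) \<le> R"
  shows "(\<Sum>i\<in>{1..n}. (\<integral>z. excess k v z \<partial>P) - excess k v (\<omega> i)) \<le> u"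
proof (rule field_le_epsilon)
  fix e :: real assume e: "0 < e"
  \<comment> \<open>Approximation within \<open>e'\<close> changes the expected and the observed
    excess by at most \<open>Cx * e'\<close> each, so the \<open>n\<close> terms lose
    \<open>2 * n * Cx * e' = e\<close> in total.\<close>
  define e' where "e' = e / (2 * n * Cx)"
  have e': "0 < e'" using e n Cx by (simp add: e'_def)
  from rational_l1_approx[OF e', of p v] obtain t where t: "t \<in> {0..p} \<rightarrow>\<^sub>E \<rat>"
      "(\<Sum>j\<in>{0..p}. \<bar>t j\<bar>) \<le> (\<Sum>j\<in>{0..p}. \<bar>v j\<bar>)" "(\<Sum>j\<in>{0..p}. \<bar>v j - t j\<bar>) \<le> e'"
    by blast
  then have tb: "t \<in> rational_ball R" using v by (simp add: rational_ball_def)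
  have d: "\<bar>excess k v z - excess k t z\<bar> \<le> Cx * e'" for z
  proof -
    have "\<bar>excess k v z - excess k t z\<bar> \<le> \<bar>lin (\<lambda>j. v j - t j) (snd z)\<bar>"
      using excess_lipschitz[OF k, of v z t] by (simp add: lin_diff)
    also have "\<dots> \<le> Cx * (\<Sum>j\<in>{0..p}. \<bar>v j - t j\<bar>)" by (rule lin_abs_le)
    also have "\<dots> \<le> Cx * e'" using t(3) Cx by (intro mult_left_mono) auto
    finally show ?thesis .
  qed
  have "(\<integral>z. excess k v z \<partial>P) \<le> (\<integral>z. excess k t z + Cx * e' \<partial>P)"
    using k d by (intro integral_mono) (auto simp: abs_le_iff algebra_simps)
  then have m: "(\<integral>z. excess k v z \<partial>P) \<le> (\<integral>z. excess k t z \<partial>P) + Cx * e'"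
    using k by (simp add: prob_space)
  have "(\<Sum>i\<in>{1..n}. (\<integral>z. excess k v z \<partial>P) - excess k v (\<omega> i))
      \<le> (\<Sum>i\<in>{1..n}. ((\<integral>z. excess k t z \<partial>P) - excess k t (\<omega> i)) + 2 * (Cx * e'))"
  proof (intro sum_mono)
    fix i
    show "(\<integral>z. excess k v z \<partial>P) - excess k v (\<omega> i) \<le> ((\<integral>z. excess k t z \<partial>P) - excess k t (\<omega> i)) + 2 * (Cx * e')"
      using m d[of "\<omega> i"] by (auto simp: abs_le_iff)
  qed
  also have "\<dots> = (\<Sum>i\<in>{1..n}. (\<integral>z. excess k t z \<partial>P) - excess k t (\<omega> i)) + e"
    using n Cx by (simp add: sum.distrib e'_def)
  also have "\<dots> \<le> u + e"
    using \<omega> tb by (force simp: deviation_event_def not_le)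
  finally show "(\<Sum>i\<in>{1..n}. (\<integral>z. excess k v z \<partial>P) - excess k v (\<omega> i)) \<le> u + e" .
qed

text \<open>Comparison with \<open>\<beta>s\<close> bounds the mean excess loss above by
  \<open>lam\<close> times the group norms on \<open>S\<close> minus those off \<open>S\<close>.
  Nonnegativity of Knight's remainder bounds it below by minus \<open>lam / 2\<close> times the sum
  of all group norms. Together the norms off \<open>S\<close> sum to at most three times those on
  \<open>S\<close> plus once the unpenalized intercept.\<close>

lemma minimizer_in_cone:
  assumes n: "1 \<le> n" and lam: "0 < lam" and \<omega>: "\<omega> \<in> space (sample n)" "\<omega> \<notin> unbounded_event n"
    and score: "\<And>j. j \<in> {0..p} \<Longrightarrow> \<omega> \<notin> score_event n (n * lam / 2) j"
    and min: "qr_loss K p n \<tau> lam \<omega> \<beta>h \<le> qr_loss K p n \<tau> lam \<omega> \<beta>s"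
  defines "\<Delta> \<equiv> \<lambda>k j. \<beta>h k j - \<beta>s k j" and "S \<equiv> active_set K p \<beta>s"
  shows "\<Delta> \<in> cone K p S"
    and "(\<Sum>k\<in>{1..K}. \<Sum>i\<in>{1..n}. excess k (\<Delta> k) (\<omega> i)) \<le> n * lam * (\<Sum>j\<in>S. grp_norm K \<Delta> j)"
proof -
  let ?E = "\<Sum>k\<in>{1..K}. \<Sum>i\<in>{1..n}. excess k (\<Delta> k) (\<omega> i)"
  let ?N = "grp_norm K \<Delta>"
  have S: "S \<subseteq> {1..p}" by (auto simp: S_def active_set_def)
  have finS: "finite S" using S finite_subset by blast
  have ex: "excess k (\<Delta> k) (\<omega> i) = check_loss (\<tau> k) (fst (\<omega> i) - xdot p (snd (\<omega> i)) (\<beta>h k))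
      - check_loss (\<tau> k) (fst (\<omega> i) - xdot p (snd (\<omega> i)) (\<beta>s k))" if "i \<in> {1..n}" for i k
  proof -
    have "\<forall>j\<in>{0..p}. \<bar>snd (\<omega> i) j\<bar> \<le> Cx"
      using \<omega> that by (auto simp: unbounded_event_def not_less)
    then have "lin (\<Delta> k) (snd (\<omega> i)) = xdot p (snd (\<omega> i)) (\<beta>h k) - xdot p (snd (\<omega> i)) (\<beta>s k)"
      by (simp add: lin_eq) (simp add: xdot_def \<Delta>_def right_diff_distrib sum_subtractf)
    then show ?thesis by (simp add: excess_def resid_def)
  qed
  have "?E = (\<Sum>k\<in>{1..K}. \<Sum>i\<in>{1..n}. check_loss (\<tau> k) (fst (\<omega> i) - xdot p (snd (\<omega> i)) (\<beta>h k))
      - check_loss (\<tau> k) (fst (\<omega> i) - xdot p (snd (\<omega> i)) (\<beta>s k)))"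
    by (intro sum.cong ex refl)
  then have "?E / n + lam * (\<Sum>j\<in>{1..p}. grp_norm K \<beta>h j - grp_norm K \<beta>s j) \<le> 0"
    using min n by (simp add: qr_loss_def sum_subtractf right_diff_distrib diff_divide_distrib)
  moreover have "- (\<Sum>j\<in>{1..p}. grp_norm K \<beta>h j - grp_norm K \<beta>s j) \<le> (\<Sum>j\<in>S. ?N j) - (\<Sum>j\<in>{1..p} - S. ?N j)"
  proof -
    have on: "grp_norm K \<beta>s j - grp_norm K \<beta>h j \<le> ?N j" for j
    proof -
      have "grp_norm K \<beta>s j \<le> grp_norm K \<beta>h j + L2_set (\<lambda>k. - \<Delta> k j) {1..K}"
        unfolding grp_norm_L2 using L2_set_triangle_ineq[of "\<lambda>k. \<beta>h k j" "\<lambda>k. - \<Delta> k j" "{1..K}"]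
        by (simp add: \<Delta>_def)
      then show ?thesis by (simp add: grp_norm_L2 L2_set_def)
    qed
    have off: "grp_norm K \<beta>s j - grp_norm K \<beta>h j = - ?N j" if "j \<in> {1..p} - S" for j
    proof -
      have z: "grp_norm K \<beta>s j = 0" using that by (simp add: S_def active_set_def)
      then have "\<forall>k\<in>{1..K}. \<beta>s k j = 0" by (simp add: grp_norm_L2 L2_set_eq_0_iff)
      then have "grp_norm K \<beta>h j = ?N j" by (simp add: grp_norm_def \<Delta>_def)
      with z show ?thesis by simp
    qed
    have "- (\<Sum>j\<in>{1..p}. grp_norm K \<beta>h j - grp_norm K \<beta>s j) = (\<Sum>j\<in>{1..p}. grp_norm K \<beta>s j - grp_norm K \<beta>h j)"
      by (simp add: sum_subtractf)
    also have "\<dots> = (\<Sum>j\<in>{1..p} - S. grp_norm K \<beta>s j - grp_norm K \<beta>h j) + (\<Sum>j\<in>S. grp_norm K \<beta>s j - grp_norm K \<beta>h j)"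
      using S by (intro sum.subset_diff) auto
    also have "\<dots> \<le> (\<Sum>j\<in>{1..p} - S. - ?N j) + (\<Sum>j\<in>S. ?N j)"
      by (intro add_mono sum_mono on eq_refl off)
    finally show ?thesis by (simp add: sum_negf)
  qed
  ultimately have basic: "?E / n \<le> lam * ((\<Sum>j\<in>S. ?N j) - (\<Sum>j\<in>{1..p} - S. ?N j))"
    using lam mult_left_mono[of "- (\<Sum>j\<in>{1..p}. grp_norm K \<beta>h j - grp_norm K \<beta>s j)" _ lam]
    by (smt (verit) mult_minus_right)
  have off0: "0 \<le> (\<Sum>j\<in>{1..p} - S. ?N j)" by (intro sum_nonneg) simp
  have "?E / n \<le> lam * (\<Sum>j\<in>S. ?N j)"
    using basic off0 lam mult_left_mono[of "(\<Sum>j\<in>S. ?N j) - (\<Sum>j\<in>{1..p} - S. ?N j)" "\<Sum>j\<in>S. ?N j" lam]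
    by linarith
  then show "?E \<le> n * lam * (\<Sum>j\<in>S. ?N j)"
    using n by (simp add: pos_divide_le_eq mult_ac)
  let ?G = "\<lambda>j k. \<Sum>i\<in>{1..n}. clip Cx (snd (\<omega> i)) j * sign_score k (\<omega> i)"
  have "(\<Sum>k\<in>{1..K}. \<Sum>i\<in>{1..n}. lin (\<Delta> k) (snd (\<omega> i)) * sign_score k (\<omega> i))
      = (\<Sum>k\<in>{1..K}. \<Sum>j\<in>{0..p}. \<Delta> k j * ?G j k)"
  proof (rule sum.cong[OF refl])
    fix k
    show "(\<Sum>i\<in>{1..n}. lin (\<Delta> k) (snd (\<omega> i)) * sign_score k (\<omega> i)) = (\<Sum>j\<in>{0..p}. \<Delta> k j * ?G j k)"
      unfolding lin_def xdot_def sum_distrib_left sum_distrib_right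
      by (subst sum.swap) (simp add: mult_ac)
  qed
  also have "\<dots> = (\<Sum>j\<in>{0..p}. \<Sum>k\<in>{1..K}. \<Delta> k j * ?G j k)" by (rule sum.swap)
  also have "\<dots> \<le> (\<Sum>j\<in>{0..p}. ?N j * (n * lam / 2))"
  proof (intro sum_mono)
    fix j assume j: "j \<in> {0..p}"
    have "(\<Sum>k\<in>{1..K}. \<Delta> k j * ?G j k) \<le> (\<Sum>k\<in>{1..K}. \<bar>\<Delta> k j\<bar> * \<bar>?G j k\<bar>)"
      by (intro sum_mono) (simp flip: abs_mult)
    also have "\<dots> \<le> ?N j * L2_set (?G j) {1..K}"
      unfolding grp_norm_L2 by (rule L2_set_mult_ineq)
    also have "\<dots> \<le> ?N j * (n * lam / 2)"
      using score[OF j] \<omega>(1) by (intro mult_left_mono) (auto simp: score_event_def not_le)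
    finally show "(\<Sum>k\<in>{1..K}. \<Delta> k j * ?G j k) \<le> ?N j * (n * lam / 2)" .
  qed
  also have "\<dots> = n * lam / 2 * (\<Sum>j\<in>{0..p}. ?N j)"
    by (simp add: sum_distrib_left mult_ac)
  finally have le: "(\<Sum>k\<in>{1..K}. \<Sum>i\<in>{1..n}. lin (\<Delta> k) (snd (\<omega> i)) * sign_score k (\<omega> i)) \<le> n * lam / 2 * (\<Sum>j\<in>{0..p}. ?N j)" .
  have "- (\<Sum>k\<in>{1..K}. \<Sum>i\<in>{1..n}. lin (\<Delta> k) (snd (\<omega> i)) * sign_score k (\<omega> i)) \<le> ?E"
    unfolding sum_negf[symmetric] by (intro sum_mono) (simp add: excess_knight knight_rem_nonneg)
  with le have lower: "- (n * lam / 2 * (\<Sum>j\<in>{0..p}. ?N j)) \<le> ?E" by linarith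
  have split: "(\<Sum>j\<in>{0..p}. ?N j) = ?N 0 + (\<Sum>j\<in>S. ?N j) + (\<Sum>j\<in>{1..p} - S. ?N j)"
  proof -
    have "{0..p} = insert 0 {1..p}" by auto
    moreover have "(\<Sum>j\<in>{1..p}. ?N j) = (\<Sum>j\<in>{1..p} - S. ?N j) + (\<Sum>j\<in>S. ?N j)"
      using S by (intro sum.subset_diff) auto
    ultimately show ?thesis by simp
  qed
  have "lam * (- (\<Sum>j\<in>{0..p}. ?N j) / 2) \<le> ?E / n"
    using lower n by (simp add: pos_le_divide_eq mult_ac)
  then have "lam * (- (\<Sum>j\<in>{0..p}. ?N j) / 2) \<le> lam * ((\<Sum>j\<in>S. ?N j) - (\<Sum>j\<in>{1..p} - S. ?N j))"
    using basic by linarith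
  then have "- (\<Sum>j\<in>{0..p}. ?N j) / 2 \<le> (\<Sum>j\<in>S. ?N j) - (\<Sum>j\<in>{1..p} - S. ?N j)"
    using lam by (simp only: mult_le_cancel_left_pos)
  then have fin: "(\<Sum>j\<in>{1..p} - S. ?N j) \<le> 3 * (\<Sum>j\<in>S. ?N j) + ?N 0"
    using split by simp
  have "{0..p} - (S \<union> {0}) = {1..p} - S" using S by auto
  moreover have "(\<Sum>j\<in>S \<union> {0}. ?N j) = ?N 0 + (\<Sum>j\<in>S. ?N j)"
  proof -
    have "0 \<notin> S" using S by auto
    then show ?thesis using finS by simp
  qed
  moreover have "3 * (\<Sum>j\<in>S. ?N j) + ?N 0 \<le> 3 * (?N 0 + (\<Sum>j\<in>S. ?N j))"
  proof -
    have "3 * y + x \<le> 3 * (x + y)" if "0 \<le> x" for x y :: real using that by (simp add: distrib_left)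
    then show ?thesis by simp
  qed
  ultimately show "\<Delta> \<in> cone K p S"
    unfolding cone_def mem_Collect_eq using fin by (simp only:)
qed

text \<open>The curvature bound is available only up to \<open>dt\<close>, so it is applied on the
  sphere of radius \<open>r\<close>. The cone is closed under scaling, and \<open>rate\<close> says
  that on this sphere the curvature exceeds the deviations of the \<open>K\<close> losses plus the
  penalty.\<close>

lemma estimation_error_le:
  fixes u r dt :: real
  assumes n: "1 \<le> n" and lam: "0 < lam" and \<omega>: "\<omega> \<in> space (sample n)" "\<omega> \<notin> unbounded_event n"
    and score: "\<And>j. j \<in> {0..p} \<Longrightarrow> \<omega> \<notin> score_event n (n * lam / 2) j"
    and min: "qr_loss K p n \<tau> lam \<omega> \<beta>h \<le> qr_loss K p n \<tau> lam \<omega> \<beta>s"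
    and S: "S = active_set K p \<beta>s"
    and dev: "\<And>k. k \<in> {1..K} \<Longrightarrow> \<omega> \<notin> deviation_event n (4 * sqrt (real (card S) + 1) * r) u k"
    and C3: "cond_C3 K p P S b B bt Bt"
    and C4: "\<And>k. k \<in> {1..K} \<Longrightarrow> dt \<le> d_const K p P S c1 c2 B k"
    and r: "0 < r" "r < dt" and dt: "0 < dt"
    and rate: "K * u + n * lam * (sqrt (card S) * r) < n * (c1 * bt / 3 * r\<^sup>2)"
  shows "full_norm K p (\<lambda>k j. \<beta>h k j - \<beta>s k j) \<le> r"
proof (rule ccontr)
  let ?\<Delta> = "\<lambda>k j. \<beta>h k j - \<beta>s k j"
  assume "\<not> full_norm K p ?\<Delta> \<le> r"
  then have F: "r < full_norm K p ?\<Delta>" by simp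
  define \<theta> where "\<theta> = r / full_norm K p ?\<Delta>"
  have \<theta>: "0 < \<theta>" "\<theta> \<le> 1" using F r by (auto simp: \<theta>_def)
  define D where "D = (\<lambda>k j. \<theta> * ?\<Delta> k j)"
  have Dr: "full_norm K p D = r"
    unfolding D_def using full_norm_scale[of \<theta> K p ?\<Delta>] \<theta> F r by (simp add: \<theta>_def)
  have gD: "grp_norm K D j = \<theta> * grp_norm K ?\<Delta> j" for j
    unfolding D_def using grp_norm_scale[of \<theta> K ?\<Delta>] \<theta> by simp
  note cone = minimizer_in_cone[OF n lam \<omega> score min, folded S]
  have Ssub: "S \<subseteq> {1..p}" by (auto simp: S active_set_def)
  then have finS: "finite S" using finite_subset by blast
  have Dcone: "D \<in> cone K p S"
    using cone(1) \<theta> by (simp add: cone_def gD flip: sum_distrib_left)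
  have "0 \<notin> S" using Ssub by auto
  then have cardS: "card (S \<union> {0}) = card S + 1" using finS by simp
  \<comment> \<open>The factor 4 is 1 + 3 from the cone; \<open>S\<close> with the intercept has
    \<open>card S + 1\<close> groups, which gives the root by Cauchy-Schwarz.\<close>
  have l1: "(\<Sum>j\<in>{0..p}. grp_norm K D j) \<le> 4 * sqrt (real (card S) + 1) * r"
  proof -
    have "(\<Sum>j\<in>{0..p}. grp_norm K D j) = (\<Sum>j\<in>{0..p} - (S \<union> {0}). grp_norm K D j) + (\<Sum>j\<in>S \<union> {0}. grp_norm K D j)"
      using Ssub by (intro sum.subset_diff) auto
    also have "\<dots> \<le> 4 * (\<Sum>j\<in>S \<union> {0}. grp_norm K D j)"
      using Dcone by (simp add: cone_def)
    also have "(\<Sum>j\<in>S \<union> {0}. grp_norm K D j) \<le> sqrt (card (S \<union> {0})) * full_norm K p D"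
      using Ssub by (intro sum_grp_norm_le) auto
    finally show ?thesis by (simp only: cardS Dr of_nat_add of_nat_1 mult.assoc)
  qed
  have "n * (c1 * bt / 3 * r\<^sup>2) - K * u
     = (\<Sum>k\<in>{1..K}. n * (c1 * bt / 3 * (blk_norm p D k)\<^sup>2) - u)"
    unfolding Dr[symmetric] full_norm_sq_blk by (simp add: sum_subtractf sum_distrib_left)
  also have "\<dots> \<le> (\<Sum>k\<in>{1..K}. \<Sum>i\<in>{1..n}. excess k (D k) (\<omega> i))"
  proof (intro sum_mono)
    fix k assume k: "k \<in> {1..K}"
    have "(blk_norm p D k)\<^sup>2 \<le> (full_norm K p D)\<^sup>2"
      unfolding full_norm_sq_blk using k by (intro member_le_sum) auto
    then have "blk_norm p D k \<le> r" using Dr r by (simp add: power2_le_iff_abs_le)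
    then have "c1 * bt / 3 * (blk_norm p D k)\<^sup>2 \<le> (\<integral>z. excess k (D k) z \<partial>P)"
      using r by (intro expected_excess_quadratic[OF C3 C4[OF k] dt k Dcone]) auto
    then have "n * (c1 * bt / 3 * (blk_norm p D k)\<^sup>2) \<le> n * (\<integral>z. excess k (D k) z \<partial>P)"
      by (intro mult_left_mono) auto
    moreover have "(\<Sum>i\<in>{1..n}. (\<integral>z. excess k (D k) z \<partial>P) - excess k (D k) (\<omega> i)) \<le> u"
      using order_trans[OF l1_le_grp_norm[OF k] l1] by (intro deviation_bound[OF n \<omega>(1) dev[OF k] k])
    ultimately show "n * (c1 * bt / 3 * (blk_norm p D k)\<^sup>2) - u \<le> (\<Sum>i\<in>{1..n}. excess k (D k) (\<omega> i))"
      by (simp add: sum_subtractf)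
  qed
  also have "\<dots> \<le> (\<Sum>k\<in>{1..K}. \<Sum>i\<in>{1..n}. \<theta> * excess k (?\<Delta> k) (\<omega> i))"
  proof (intro sum_mono)
    fix k i
    have "lin (D k) x = \<theta> * lin (?\<Delta> k) x" for x
      by (simp add: D_def lin_def xdot_def sum_distrib_left mult_ac)
    then show "excess k (D k) (\<omega> i) \<le> \<theta> * excess k (?\<Delta> k) (\<omega> i)"
      unfolding excess_def using \<theta> by (simp only:) (intro check_loss_convex; simp)
  qed
  also have "\<dots> = \<theta> * (\<Sum>k\<in>{1..K}. \<Sum>i\<in>{1..n}. excess k (?\<Delta> k) (\<omega> i))"
    by (simp add: sum_distrib_left)
  also have "\<dots> \<le> \<theta> * (n * lam * (\<Sum>j\<in>S. grp_norm K ?\<Delta> j))"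
    using \<theta> cone(2) by (intro mult_left_mono) auto
  also have "\<dots> = n * lam * (\<Sum>j\<in>S. grp_norm K D j)"
    by (simp add: gD sum_distrib_left mult_ac)
  also have "\<dots> \<le> n * lam * (sqrt (card S) * r)"
    using lam sum_grp_norm_le[of S p K D, unfolded Dr] Ssub
    by (intro mult_left_mono) (auto simp: subset_iff)
  finally show False using rate by linarith
qed

end

section \<open>Constants and conclusion\<close>

text \<open>The constant is large enough for \<open>\<delta>\<^sup>*\<close> to absorb the contribution of the penalty as well.\<close>
lemma error_rate_bound:
  fixes K n s D1 D2 L lp Cx :: real
  assumes K: "1 \<le> K" and n: "1 \<le> n" and s: "0 \<le> s" and pos: "0 < D1" "0 < D2" "0 < L" "0 < Cx" and lp: "0 \<le> lp"
  defines "Cs \<equiv> (4 * K * Cx * sqrt (8 * L) + 2 * Cx * sqrt (D2 * K)) / (32 * D1) + Cx"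
  shows "4 * K * sqrt (s + 1) * Cx * sqrt (8 * L * lp / n) + (Cx * sqrt (K / n) + 2 * Cx * sqrt (D2 * K * lp / n)) * sqrt s
     < 8 * Cs * sqrt ((s + 1) / n) * (4 * D1 * sqrt lp + sqrt (2 * K))"
proof -
  define a where "a = sqrt ((s + 1) / n)"
  have a: "0 < a" using s n by (simp add: a_def)
  have 1: "sqrt (s + 1) * sqrt (8 * L * lp / n) = a * (sqrt (8 * L) * sqrt lp)"
    by (simp add: a_def real_sqrt_mult real_sqrt_divide)
  have 2: "sqrt (X / n) * sqrt s \<le> a * sqrt X" if "0 \<le> X" for X
  proof -
    have "sqrt X * sqrt s / sqrt n \<le> sqrt X * sqrt (s + 1) / sqrt n"
      using that s n by (intro divide_right_mono mult_left_mono) auto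
    then show ?thesis by (simp add: a_def real_sqrt_divide mult.commute)
  qed
  have 3: "sqrt (D2 * K * lp / n) * sqrt s \<le> a * (sqrt (D2 * K) * sqrt lp)"
    using 2[of "D2 * K * lp"] K pos lp by (simp add: real_sqrt_mult)
  have "4 * K * sqrt (s + 1) * Cx * sqrt (8 * L * lp / n) + (Cx * sqrt (K / n) + 2 * Cx * sqrt (D2 * K * lp / n)) * sqrt s
     = 4 * K * Cx * (sqrt (s + 1) * sqrt (8 * L * lp / n)) + Cx * (sqrt (K / n) * sqrt s) + 2 * Cx * (sqrt (D2 * K * lp / n) * sqrt s)"
    by (simp add: algebra_simps)
  also have "\<dots> \<le> 4 * K * Cx * (a * (sqrt (8 * L) * sqrt lp)) + Cx * (a * sqrt K) + 2 * Cx * (a * (sqrt (D2 * K) * sqrt lp))"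
    unfolding 1 using pos K 2[of K] 3 less_imp_le[OF a] by (intro add_mono mult_left_mono) auto
  also have "\<dots> = a * ((4 * K * Cx * sqrt (8 * L) + 2 * Cx * sqrt (D2 * K)) * sqrt lp + Cx * sqrt K)"
    by (simp add: algebra_simps)
  also have "\<dots> < a * (8 * Cs * (4 * D1 * sqrt lp) + 8 * Cs * sqrt (2 * K))"
  proof (intro mult_strict_left_mono add_le_less_mono a)
    \<comment> \<open>The fraction in \<open>Cs\<close> is solved from this inequality and pays for
      the terms with \<open>sqrt lp\<close>. The extra summand \<open>Cx\<close> pays for the part
      of the penalty without logarithm and makes the bound strict.\<close>
    have "4 * K * Cx * sqrt (8 * L) + 2 * Cx * sqrt (D2 * K) \<le> 32 * D1 * Cs"
      using pos by (simp add: Cs_def field_simps)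
    then have "(4 * K * Cx * sqrt (8 * L) + 2 * Cx * sqrt (D2 * K)) * sqrt lp \<le> 32 * D1 * Cs * sqrt lp"
      by (intro mult_right_mono) (use lp in auto)
    then show "(4 * K * Cx * sqrt (8 * L) + 2 * Cx * sqrt (D2 * K)) * sqrt lp \<le> 8 * Cs * (4 * D1 * sqrt lp)"
      by (simp add: mult_ac)
    have "Cx \<le> Cs" using pos K by (simp add: Cs_def)
    then have "Cx * sqrt K < 8 * Cs * sqrt K" using pos K by (intro mult_strict_right_mono) auto
    also have "\<dots> \<le> 8 * Cs * sqrt (2 * K)"
      using \<open>Cx \<le> Cs\<close> pos K by (intro mult_left_mono) auto
    finally show "Cx * sqrt K < 8 * Cs * sqrt (2 * K)" .
  qed
  finally show ?thesis by (simp add: a_def algebra_simps)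
qed


theorem theorem1:
  fixes K :: nat and \<tau> :: "nat \<Rightarrow> real" and Cx c1 c2 bt Bt dt D1 D2 :: real
  assumes "K \<ge> 1"
    and "\<forall>k\<in>{1..K}. 0 < \<tau> k \<and> \<tau> k < 1"
    and "\<forall>k\<in>{1..K}. \<forall>k'\<in>{1..K}. k < k' \<longrightarrow> \<tau> k < \<tau> k'"
    and "Cx > 0" and "c1 > 0" and "c2 > 0" and "bt > 0" and "Bt > 0" and "dt > 0"
    and "D1 > 0" and "D2 > 0"
  shows "\<exists>Cs>0. \<forall>(n::nat) (p::nat) (P :: (real \<times> (nat \<Rightarrow> real)) measure)
            (f :: (nat \<Rightarrow> real) \<Rightarrow> real \<Rightarrow> real) (f' :: (nat \<Rightarrow> real) \<Rightarrow> real \<Rightarrow> real)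
            (\<beta>s :: nat \<Rightarrow> nat \<Rightarrow> real) (b :: nat \<Rightarrow> real) (B :: nat \<Rightarrow> real).
     n \<ge> 1 \<longrightarrow> p \<ge> 2 \<longrightarrow>
     qr_model K \<tau> p P f f' \<beta>s c1 c2 Cx \<longrightarrow>
     cond_C3 K p P (active_set K p \<beta>s) b B bt Bt \<longrightarrow>
     (\<forall>k\<in>{1..K}. d_const K p P (active_set K p \<beta>s) c1 c2 B k \<ge> dt) \<longrightarrow>
     (let s = card (active_set K p \<beta>s);
          lam = Cx * sqrt (real K / real n) + 2 * Cx * sqrt (D2 * real K * ln (real p) / real n);
          \<delta> = 8 * Cs * sqrt ((real s + 1) / real n) * (4 * D1 * sqrt (ln (real p)) + sqrt (2 * real K));
          bound = 3 / (c1 * bt) * (max \<delta> (real K * sqrt (8 * Bt / real n)) + c2 * lam * sqrt (real s))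
      in bound < dt \<longrightarrow>
         (\<exists>A\<in>sets (\<Pi>\<^sub>M i\<in>{1..n}. P).
            measure (\<Pi>\<^sub>M i\<in>{1..n}. P) A
              \<ge> 1 - 16 * real p powr (1 - D1) - 2 * real p powr (1 - D2) \<and>
            A \<subseteq> {\<omega>\<in>space (\<Pi>\<^sub>M i\<in>{1..n}. P).
                   \<forall>\<beta>h. (\<forall>\<beta>. qr_loss K p n \<tau> lam \<omega> \<beta>h \<le> qr_loss K p n \<tau> lam \<omega> \<beta>)
                        \<longrightarrow> full_norm K p (\<lambda>k j. \<beta>h k j - \<beta>s k j) \<le> bound}))"
proof -
  \<comment> \<open>Each deviation event will have probability at most
    \<open>2 * (p + 1) * p powr (- L)\<close>. The part \<open>K\<close> of the exponent serves the
    union over the levels, as \<open>K * p powr (- K) \<le> 1\<close> for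
    \<open>p \<ge> 2\<close>.\<close>
  define L where "L = D1 + real K"
  define Cs where "Cs = (4 * K * Cx * sqrt (8 * L) + 2 * Cx * sqrt (D2 * K)) / (32 * D1) + Cx"
  have L: "0 < L" using assms by (simp add: L_def)
  have Cs: "0 < Cs" using assms L by (auto simp: Cs_def intro!: add_nonneg_pos divide_nonneg_pos add_nonneg_nonneg)
  show ?thesis
  proof (intro exI[of _ Cs] conjI allI impI Cs)
    fix n p :: nat and P :: "(real \<times> (nat \<Rightarrow> real)) measure" and f f' :: "(nat \<Rightarrow> real) \<Rightarrow> real \<Rightarrow> real"
      and \<beta>s :: "nat \<Rightarrow> nat \<Rightarrow> real" and b B :: "nat \<Rightarrow> real"
    assume n: "n \<ge> 1" and p: "p \<ge> 2" and model: "qr_model K \<tau> p P f f' \<beta>s c1 c2 Cx"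
      and C3: "cond_C3 K p P (active_set K p \<beta>s) b B bt Bt"
      and C4: "\<forall>k\<in>{1..K}. d_const K p P (active_set K p \<beta>s) c1 c2 B k \<ge> dt"
    interpret quantile_model K \<tau> p P f f' \<beta>s c1 c2 Cx
      using assms model by unfold_locales auto
    define S where "S = active_set K p \<beta>s"
    define s where "s = card S"
    define lam where "lam = Cx * sqrt (real K / real n) + 2 * Cx * sqrt (D2 * real K * ln (real p) / real n)"
    define \<delta> where "\<delta> = 8 * Cs * sqrt ((real s + 1) / real n) * (4 * D1 * sqrt (ln (real p)) + sqrt (2 * real K))"
    define r where "r = 3 / (c1 * bt) * (max \<delta> (real K * sqrt (8 * Bt / real n)) + c2 * lam * sqrt (real s))"
    have lnp: "0 < ln (real p)" using p by simp
    have lam: "0 < lam" unfolding lam_def using assms n lnp by (intro add_pos_nonneg) auto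
    have r: "0 < r"
      unfolding r_def using assms n lam
      by (intro mult_pos_pos add_pos_nonneg) (auto simp: less_max_iff_disj)
    define R where "R = 4 * sqrt (real s + 1) * r"
    have R: "0 < R" using r by (simp add: R_def add_pos_nonneg)
    \<comment> \<open>Chosen so that \<open>u = n * R * q\<close> makes the exponent in
      \<open>prob_deviation_event\<close> equal to \<open>- (L * ln p)\<close>.\<close>
    define q where "q = Cx * sqrt (8 * L * ln p / n)"
    define u where "u = n * R * q"
    have q0: "0 \<le> q" using assms L lnp by (simp add: q_def)
    have u: "0 \<le> u" using R q0 by (simp add: u_def)
    define A where "A = space (sample n) - (unbounded_event n \<union> (\<Union>j\<in>{0..p}. score_event n (n * lam / 2) j)
        \<union> (\<Union>k\<in>{1..K}. deviation_event n R u k))"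
    have A_sets: "A \<in> sets (sample n)" unfolding A_def by measurable
    have A_bound: "full_norm K p (\<lambda>k j. \<beta>h k j - \<beta>s k j) \<le> r"
      if "r < dt" "\<omega> \<in> A" and min: "\<forall>\<beta>. qr_loss K p n \<tau> lam \<omega> \<beta>h \<le> qr_loss K p n \<tau> lam \<omega> \<beta>" for \<omega> \<beta>h
    proof (rule estimation_error_le[OF n lam, where S = S and u = u and dt = dt and bt = bt and b = b and B = B and Bt = Bt])
      \<comment> \<open>The left side is that of \<open>rate\<close> divided by
        \<open>n * r\<close>. The penalty enters with factor 1 instead of \<open>c2\<close>, so
        \<open>\<delta>\<close> has to dominate it too.\<close>
      have "4 * K * sqrt (real s + 1) * q + lam * sqrt s < \<delta>"
        using error_rate_bound[of K n s D1 D2 L Cx "ln p"] assms n L lnp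
        unfolding lam_def \<delta>_def Cs_def q_def by (simp add: mult.assoc)
      also have "\<delta> \<le> max \<delta> (real K * sqrt (8 * Bt / real n)) + c2 * lam * sqrt (real s)"
        using assms lam by (intro add_increasing2) auto
      also have "\<dots> = c1 * bt / 3 * r"
        using assms by (simp add: r_def)
      finally have "(n * r) * (4 * K * sqrt (real s + 1) * q + lam * sqrt s) < (n * r) * (c1 * bt / 3 * r)"
        using n r by (intro mult_strict_left_mono) auto
      then show "real K * u + real n * lam * (sqrt (real (card S)) * r) < real n * (c1 * bt / 3 * r\<^sup>2)"
        by (simp add: u_def R_def s_def power2_eq_square algebra_simps)
      show "\<omega> \<notin> deviation_event n (4 * sqrt (real (card S) + 1) * r) u k" if "k \<in> {1..K}" for k
        using \<open>\<omega> \<in> A\<close> that by (auto simp: A_def R_def s_def)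
      show "\<omega> \<in> space (sample n)" "\<omega> \<notin> unbounded_event n"
        using \<open>\<omega> \<in> A\<close> by (auto simp: A_def)
      show "\<omega> \<notin> score_event n (n * lam / 2) j" if "j \<in> {0..p}" for j
        using \<open>\<omega> \<in> A\<close> that by (auto simp: A_def)
      show "cond_C3 K p P S b B bt Bt" using C3 by (simp only: S_def)
      show "dt \<le> d_const K p P S c1 c2 B k" if "k \<in> {1..K}" for k
        using C4 that by (simp only: S_def)
      show "qr_loss K p n \<tau> lam \<omega> \<beta>h \<le> qr_loss K p n \<tau> lam \<omega> \<beta>s"
        using min by blast
      show "0 < r" by (rule r)
      show "r < dt" by (rule that(1))
      show "0 < dt" by (rule assms(9))
      show "S = active_set K p \<beta>s" by (rule S_def)
    qed
    have score: "measure (sample n) (score_event n (n * lam / 2) j) \<le> p powr (- D2)" for j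
    proof -
      \<comment> \<open>At this value the threshold of \<open>prob_score_event\<close> is exactly
        \<open>n * lam / 2\<close>: the first term of \<open>lam\<close> covers the mean norm of the
        score, the second its fluctuation.\<close>
      let ?v = "sqrt (D2 * ln p)"
      have "n * lam / 2 = Cx * sqrt K * sqrt n * (1/2 + ?v)"
      proof -
        have "n * sqrt (x / n) = sqrt n * sqrt x" for x
        proof -
          have "n * sqrt (x / n) = (n / sqrt n) * sqrt x" by (simp add: real_sqrt_divide)
          then show ?thesis by (simp add: real_div_sqrt)
        qed
        note e = this[of K] this[of "D2 * K * ln p"]
        have "n * lam / 2 = Cx / 2 * (n * sqrt (K / n)) + Cx * (n * sqrt (D2 * K * ln p / n))"
          by (simp add: lam_def algebra_simps)
        then show ?thesis unfolding e by (simp add: real_sqrt_mult algebra_simps)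
      qed
      moreover have "exp (- ?v\<^sup>2) = p powr (- D2)"
        using assms lnp p by (simp add: powr_def)
      ultimately show ?thesis
        using prob_score_event[OF n, of ?v j] assms lnp by simp
    qed
    have dev: "measure (sample n) (deviation_event n R u k) \<le> 2 * (p + 1) * p powr (- L)"
      if k: "k \<in> {1..K}" for k
    proof -
      have "u\<^sup>2 = (8 * n * R\<^sup>2 * Cx\<^sup>2) * (L * ln p)"
        using L lnp n by (simp add: u_def q_def power_mult_distrib power2_eq_square field_simps)
      then have "- u\<^sup>2 / (8 * n * R\<^sup>2 * Cx\<^sup>2) = - (L * ln p)"
        using n R assms by simp
      then show ?thesis
        using prob_deviation_event[OF n R u k] p by (simp add: powr_def)
    qed
    interpret Q: prob_space "sample n" by (intro prob_space_PiM prob_space_axioms)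
    have prob: "1 - 16 * real p powr (1 - D1) - 2 * real p powr (1 - D2) \<le> measure (sample n) A"
    proof -
      let ?S = "\<Union>j\<in>{0..p}. score_event n (n * lam / 2) j" and ?D = "\<Union>k\<in>{1..K}. deviation_event n R u k"
      have "measure (sample n) ?S \<le> (\<Sum>j\<in>{0..p}. p powr (- D2))"
        by (rule order_trans[OF Q.finite_measure_subadditive_finite sum_mono[OF score]])
          (simp, blast intro: sets_score_event)
      \<comment> \<open>The \<open>p + 1\<close> groups include the intercept, and
        \<open>p + 1 \<le> 2 * p\<close> produces the factor 2.\<close>
      also have "\<dots> \<le> 2 * real p powr (1 - D2)"
      proof -
        have "real p powr (1 - D2) = p * p powr (- D2)"
          using p by (simp add: powr_diff powr_minus divide_inverse)
        then show ?thesis using p by (simp add: mult_right_mono flip: mult.assoc)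
      qed
      finally have mS: "measure (sample n) ?S \<le> 2 * real p powr (1 - D2)" .
      have "measure (sample n) ?D \<le> (\<Sum>k\<in>{1..K}. 2 * (p + 1) * p powr (- L))"
        by (rule order_trans[OF Q.finite_measure_subadditive_finite sum_mono[OF dev]])
          (simp, blast intro: sets_deviation_event)
      also have "\<dots> = 2 * (p + 1) * (K * p powr (- real K)) * p powr (- D1)"
        using p by (simp add: L_def powr_add powr_diff powr_minus divide_inverse)
      also have "\<dots> \<le> 2 * (p + 1) * 1 * p powr (- D1)"
      proof -
        have "real K \<le> 2 ^ K" by (simp add: less_imp_le)
        also have "(2::real) ^ K \<le> real p ^ K" using p by (intro power_mono) auto
        finally have "K * p powr (- real K) \<le> 1"
          using p by (simp add: powr_minus powr_realpow field_simps)
        then show ?thesis by (intro mult_right_mono mult_left_mono) auto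
      qed
      also have "\<dots> \<le> 16 * (p * p powr (- D1))"
        using p by (simp add: mult_right_mono flip: mult.assoc)
      also have "\<dots> = 16 * p powr (1 - D1)"
        using p by (simp add: powr_diff powr_minus divide_inverse)
      finally have mD: "measure (sample n) ?D \<le> 16 * p powr (1 - D1)" .
      have "measure (sample n) (unbounded_event n \<union> ?S \<union> ?D) \<le> 0 + 2 * real p powr (1 - D2) + 16 * p powr (1 - D1)"
      proof -
        have m: "unbounded_event n \<in> sets (sample n)" "?S \<in> sets (sample n)" "?D \<in> sets (sample n)"
          by measurable
        show ?thesis
          using measure_Un_le[OF sets.Un[OF m(1,2)] m(3)] measure_Un_le[OF m(1,2)] mS mD
            prob_unbounded_event[of n] by linarith
      qed
      moreover have "measure (sample n) A = 1 - measure (sample n) (unbounded_event n \<union> ?S \<union> ?D)"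
        unfolding A_def by (intro Q.prob_compl) measurable
      ultimately show ?thesis by linarith
    qed
    show "let s = card (active_set K p \<beta>s);
          lam = Cx * sqrt (real K / real n) + 2 * Cx * sqrt (D2 * real K * ln (real p) / real n);
          \<delta> = 8 * Cs * sqrt ((real s + 1) / real n) * (4 * D1 * sqrt (ln (real p)) + sqrt (2 * real K));
          bound = 3 / (c1 * bt) * (max \<delta> (real K * sqrt (8 * Bt / real n)) + c2 * lam * sqrt (real s))
      in bound < dt \<longrightarrow>
         (\<exists>A\<in>sets (\<Pi>\<^sub>M i\<in>{1..n}. P).
            measure (\<Pi>\<^sub>M i\<in>{1..n}. P) A
              \<ge> 1 - 16 * real p powr (1 - D1) - 2 * real p powr (1 - D2) \<and>
            A \<subseteq> {\<omega>\<in>space (\<Pi>\<^sub>M i\<in>{1..n}. P).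
                   \<forall>\<beta>h. (\<forall>\<beta>. qr_loss K p n \<tau> lam \<omega> \<beta>h \<le> qr_loss K p n \<tau> lam \<omega> \<beta>)
                        \<longrightarrow> full_norm K p (\<lambda>k j. \<beta>h k j - \<beta>s k j) \<le> bound})"
      unfolding Let_def S_def[symmetric] s_def[symmetric] lam_def[symmetric] \<delta>_def[symmetric] r_def[symmetric]
      using A_sets prob A_bound A_def by (intro impI bexI[of _ A] conjI) auto
  qed
qed

end
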